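(* There is $Q_0>0$ such that for all $(u_0,v_0)\in H^1(\mathbb{R},\mathbb{C}^2)$ with $\|u_0\|_{L^2}^2+\|v_0\|_{L^2}^2\le Q_0$, there is a positive constant $C(u_0,v_0)$, depending on $(u_0,v_0)$, such that the solution $(u,v)$ of the massive Thirring model $$i(u_t+u_x)+v=2|v|^2u,\qquad i(v_t-v_x)+u=2|u|^2v,$$ with initial datum $(u,v)|_{t=0}=(u_0,v_0)$ satisfies $$\|u(\cdot,t)\|_{H^1}^2+\|v(\cdot,t)\|_{H^1}^2\le C(u_0,v_0)\qquad\text{for all }t\in\mathbb{R}.$$
   Context: Here $(u,v)(x,t)\in\mathbb{C}^2$ with $x\in\mathbb{R}$, and $H^1=H^1(\mathbb{R})$, $L^2=L^2(\mathbb{R})$ are spaces of complex-valued functions. The Cauchy problem for the massive Thirring model is (by known results) globally well-posed in $H^1(\mathbb{R},\mathbb{C}^2)$; "the solution" is the unique solution in $C(\mathbb{R},H^1(\mathbb{R},\mathbb{C}^2))$. *)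

theory Defs
  imports "HOL-Analysis.Analysis"
begin

(* Elements of L^2 and H^1 are represented by individual functions; equality between
   them is equality almost everywhere.  Every a.e. class has a Borel representative,
   so working over lborel loses nothing. *)

definition L2 :: "(real \<Rightarrow> complex) set" where
  "L2 = {f. f \<in> borel_measurable lborel \<and> integrable lborel (\<lambda>x. (cmod (f x))\<^sup>2)}"

definition L2_norm :: "(real \<Rightarrow> complex) \<Rightarrow> real" where
  "L2_norm f = sqrt (LINT x|lborel. (cmod (f x))\<^sup>2)"

definition test_function :: "(real \<Rightarrow> real) \<Rightarrow> bool" where
  "test_function \<phi> \<longleftrightarrow>
     (\<forall>n x. (deriv ^^ n) \<phi> field_differentiable at x) \<and> compact (closure {x. \<phi> x \<noteq> 0})"

(* Only used for f and g in L2, where both integrands are integrable.  Real-valued test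
   functions suffice, by linearity. *)
definition weak_deriv :: "(real \<Rightarrow> complex) \<Rightarrow> (real \<Rightarrow> complex) \<Rightarrow> bool" where
  "weak_deriv f g \<longleftrightarrow> (\<forall>\<phi>. test_function \<phi> \<longrightarrow>
     (LINT x|lborel. complex_of_real (deriv \<phi> x) * f x) =
     - (LINT x|lborel. complex_of_real (\<phi> x) * g x))"

definition H1 :: "(real \<Rightarrow> complex) set" where
  "H1 = {f \<in> L2. \<exists>g \<in> L2. weak_deriv f g}"

(* For f in H1 this is determined up to a null set; for other f it is unspecified. *)
definition dx :: "(real \<Rightarrow> complex) \<Rightarrow> real \<Rightarrow> complex" where
  "dx f = (SOME g. g \<in> L2 \<and> weak_deriv f g)"

definition H1_norm :: "(real \<Rightarrow> complex) \<Rightarrow> real" where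
  "H1_norm f = sqrt ((L2_norm f)\<^sup>2 + (L2_norm (dx f))\<^sup>2)"

(* Space-time functions are curried as u t x, time first. *)

definition continuous_H1 :: "(real \<Rightarrow> real \<Rightarrow> complex) \<Rightarrow> bool" where
  "continuous_H1 u \<longleftrightarrow> (\<forall>t. u t \<in> H1) \<and>
     (\<forall>t. ((\<lambda>s. H1_norm (\<lambda>x. u s x - u t x)) \<longlongrightarrow> 0) (at t))"

definition has_time_deriv ::
    "(real \<Rightarrow> real \<Rightarrow> complex) \<Rightarrow> (real \<Rightarrow> complex) \<Rightarrow> real \<Rightarrow> bool" where
  "has_time_deriv u w t \<longleftrightarrow> w \<in> L2 \<and>
     ((\<lambda>h. L2_norm (\<lambda>x. (u (t + h) x - u t x) / complex_of_real h - w x)) \<longlongrightarrow> 0) (at 0)"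

(* For a curve in C(R, H^1) all terms of the system other than the time derivatives are
   continuous in t with values in L^2, so the distributional and Duhamel forms of the
   system are equivalent to the strong L^2 form used here. *)
definition MTM_solution ::
    "(real \<Rightarrow> real \<Rightarrow> complex) \<Rightarrow> (real \<Rightarrow> real \<Rightarrow> complex) \<Rightarrow> bool" where
  "MTM_solution u v \<longleftrightarrow> continuous_H1 u \<and> continuous_H1 v \<and>
     (\<forall>t. \<exists>ut vt. has_time_deriv u ut t \<and> has_time_deriv v vt t \<and>
       (AE x in lborel.
          \<i> * (ut x + dx (u t) x) + v t x = 2 * complex_of_real ((cmod (v t x))\<^sup>2) * u t x \<and>
          \<i> * (vt x - dx (v t) x) + u t x = 2 * complex_of_real ((cmod (u t x))\<^sup>2) * v t x))"

definition initial_datum ::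
    "(real \<Rightarrow> real \<Rightarrow> complex) \<Rightarrow> (real \<Rightarrow> complex) \<Rightarrow> bool" where
  "initial_datum u u0 \<longleftrightarrow> (AE x in lborel. u 0 x = u0 x)"

end

theory Submission
  imports Defs
begin

text \<open>Besides the charge \<open>\<parallel>u\<parallel>\<^sup>2 + \<parallel>v\<parallel>\<^sup>2\<close> the system conserves a functional that equals
  \<open>\<parallel>u\<^sub>x\<parallel>\<^sup>2 + \<parallel>v\<^sub>x\<parallel>\<^sup>2\<close> plus terms of lower order.  The inequality
  \<open>\<parallel>f\<parallel>\<^sub>\<infinity>\<^sup>2 \<le> (2 / l) \<parallel>f\<parallel>\<^sup>2 + 2 l \<parallel>f\<^sub>x\<parallel>\<^sup>2\<close> bounds these terms by a small multiple of the leading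
  part once the charge is small, so conservation bounds the derivatives for all times.

  Conservation holds directly at \<open>H\<^sup>1\<close> regularity: along the characteristics of \<open>u\<close> the curve
  \<open>u\<close> has the mean-square derivative \<open>i v - 2 i |v|\<^sup>2 u\<close>, which is again in \<open>H\<^sup>1\<close>, so that
  \<open>u\<^sub>x\<close> is differentiable in the mean along them as well; likewise for \<open>v\<close>.  No smooth approximation of the
  solution is needed.\<close>

subsection \<open>Square-integrable functions\<close>

text \<open>The obstacle is the lack of second spatial derivatives: at a fixed point u_x need not
  have a time derivative in L^2, and no single frame serves both components. Along x + s the right
  side for u contains no derivative and lies in H^1, whereas v acquires the extra term 2 v_x, known
  only to be in L^2. The energy is therefore cut into pieces: the one with u_x contains v
  undifferentiated and is treated along x + s, the one with v_x along x - s, and the derivative-free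
  one in either frame. Translation invariance of the integral lets each piece use its own frame; the
  rates then add up to a spatial derivative.

  Space and time derivatives are both limits of difference quotients in L^2, so one set of product
  rules serves both: a spatial derivative is the derivative of the curve of translates. Passing to
  four real components makes the balance of rates an identity between real polynomials.

  The threshold 1/16 for the charge comes from optimizing l in the sup norm inequality: it bounds
  |u|^2 + |v|^2 pointwise by the square root of the leading part.\<close>

definition sqint :: "(real \<Rightarrow> real) \<Rightarrow> bool" where
  "sqint f \<longleftrightarrow> f \<in> borel_measurable borel \<and> integrable lborel (\<lambda>x. (f x)\<^sup>2)"

definition nrm :: "(real \<Rightarrow> real) \<Rightarrow> real" where
  "nrm f = sqrt (LINT x|lborel. (f x)\<^sup>2)"

lemma sqintD:
  assumes "sqint f"
  shows "f \<in> borel_measurable borel" "integrable lborel (\<lambda>x. (f x)\<^sup>2)"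
  using assms by (auto simp: sqint_def)

lemma nrm_nonneg [simp]: "nrm f \<ge> 0"
  by (simp add: nrm_def)

lemma nrm_sq: "(nrm f)\<^sup>2 = (LINT x|lborel. (f x)\<^sup>2)"
  by (simp add: nrm_def)

lemma integrable_mult_sqint:
  assumes "sqint f" "sqint g"
  shows "integrable lborel (\<lambda>x. f x * g x)"
proof (rule Bochner_Integration.integrable_bound[where f = "\<lambda>x. (f x)\<^sup>2 + (g x)\<^sup>2"])
  show "integrable lborel (\<lambda>x. (f x)\<^sup>2 + (g x)\<^sup>2)"
    using assms by (auto simp: sqint_def)
  show "(\<lambda>x. f x * g x) \<in> borel_measurable lborel"
    using assms by (auto simp: sqint_def)
  have "\<bar>f x * g x\<bar> \<le> (f x)\<^sup>2 + (g x)\<^sup>2" for x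
  proof -
    have "2 * (\<bar>f x\<bar> * \<bar>g x\<bar>) \<le> (f x)\<^sup>2 + (g x)\<^sup>2"
      using sum_squares_bound[of "\<bar>f x\<bar>" "\<bar>g x\<bar>"] by (simp add: ac_simps)
    moreover have "0 \<le> \<bar>f x\<bar> * \<bar>g x\<bar>" by simp
    ultimately show ?thesis unfolding abs_mult by linarith
  qed
  then show "AE x in lborel. norm (f x * g x) \<le> norm ((f x)\<^sup>2 + (g x)\<^sup>2)"
    by (auto intro!: AE_I2)
qed

lemma sqint_bound:
  assumes "sqint g" "f \<in> borel_measurable borel" "\<And>x. \<bar>f x\<bar> \<le> \<bar>g x\<bar>"
  shows "sqint f"
  unfolding sqint_def
proof
  show "integrable lborel (\<lambda>x. (f x)\<^sup>2)"
    by (rule Bochner_Integration.integrable_bound[where f = "\<lambda>x. (g x)\<^sup>2"])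
       (use assms in \<open>auto simp: sqint_def abs_le_square_iff\<close>)
qed (use assms in auto)

lemma sqint_cmult [intro]: "sqint f \<Longrightarrow> sqint (\<lambda>x. c * f x)"
  by (auto simp: sqint_def power_mult_distrib)

lemma sqint_divide [intro]: "sqint f \<Longrightarrow> sqint (\<lambda>x. f x / c)"
  using sqint_cmult[of f "1/c"] by simp

lemma sqint_add [intro]:
  assumes "sqint f" "sqint g"
  shows "sqint (\<lambda>x. f x + g x)"
proof -
  have "integrable lborel (\<lambda>x. (f x)\<^sup>2 + (g x)\<^sup>2 + 2 * (f x * g x))"
    using assms integrable_mult_sqint[OF assms] by (auto simp: sqint_def)
  then show ?thesis
    using assms by (auto simp: sqint_def power2_sum algebra_simps)
qed

lemma sqint_minus [intro]: "sqint f \<Longrightarrow> sqint (\<lambda>x. - f x)"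
  by (auto simp: sqint_def)

lemma sqint_diff [intro]: "sqint f \<Longrightarrow> sqint g \<Longrightarrow> sqint (\<lambda>x. f x - g x)"
  using sqint_add[of f "\<lambda>x. - g x"] by auto

lemma sqint_zero [simp, intro]: "sqint (\<lambda>x. 0)"
  by (auto simp: sqint_def)

lemma sqint_mult_bdd:
  assumes "sqint f" "g \<in> borel_measurable borel" "\<And>x. \<bar>g x\<bar> \<le> B"
  shows "sqint (\<lambda>x. f x * g x)"
proof (rule sqint_bound[of "\<lambda>x. B * f x"])
  show "sqint (\<lambda>x. B * f x)" using assms by blast
  show "(\<lambda>x. f x * g x) \<in> borel_measurable borel" using assms by (auto simp: sqint_def)
  show "\<bar>f x * g x\<bar> \<le> \<bar>B * f x\<bar>" for x
  proof -
    have "\<bar>g x\<bar> \<le> \<bar>B\<bar>" using assms(3)[of x] by linarith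
    then show ?thesis
      unfolding abs_mult by (subst mult.commute) (intro mult_right_mono, auto)
  qed
qed

lemma sqint_shift [intro]:
  assumes "sqint f"
  shows "sqint (\<lambda>x. f (x + k))"
proof -
  have [measurable]: "f \<in> borel_measurable borel" using assms by (rule sqintD)
  have "integrable lborel (\<lambda>x. (f (k + 1 * x))\<^sup>2)"
    by (rule lborel_integrable_real_affine[OF sqintD(2)[OF assms]]) simp
  then show ?thesis
    unfolding sqint_def by (simp add: add.commute)
qed

lemma integral_shift:
  fixes f :: "real \<Rightarrow> 'a::{banach, second_countable_topology}"
  shows "(LINT x|lborel. f (x + k)) = (LINT x|lborel. f x)"
  using lborel_integral_real_affine[of 1 f k] by (simp add: add.commute)

lemma nrm_shift [simp]: "nrm (\<lambda>x. f (x + k)) = nrm f"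
  unfolding nrm_def by (subst integral_shift[of "\<lambda>x. (f x)\<^sup>2"]) simp

text \<open>If the square of \<open>f\<close> is not integrable, its integral has the default value
  0, so \<open>nrm f\<close> is 0 and the bound holds in that case too.\<close>

lemma nrm_mono:
  assumes "sqint g" "\<And>x. \<bar>f x\<bar> \<le> \<bar>g x\<bar>"
  shows "nrm f \<le> nrm g"
  unfolding nrm_def
proof (rule real_sqrt_le_mono, cases "integrable lborel (\<lambda>x. (f x)\<^sup>2)")
  case True
  then show "(LINT x|lborel. (f x)\<^sup>2) \<le> (LINT x|lborel. (g x)\<^sup>2)"
    using assms by (intro integral_mono) (auto simp: sqint_def abs_le_square_iff)
next
  case False
  then show "(LINT x|lborel. (f x)\<^sup>2) \<le> (LINT x|lborel. (g x)\<^sup>2)"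
    by (simp add: not_integrable_integral_eq)
qed

lemma nrm_cmult: "nrm (\<lambda>x. c * f x) = \<bar>c\<bar> * nrm f"
  by (simp add: nrm_def power_mult_distrib real_sqrt_mult)

lemma nrm_divide: "nrm (\<lambda>x. f x / c) = nrm f / \<bar>c\<bar>"
  using nrm_cmult[of "1/c" f] by simp

lemma nrm_minus [simp]: "nrm (\<lambda>x. - f x) = nrm f"
  by (simp add: nrm_def)

lemma nrm_zero [simp]: "nrm (\<lambda>x. 0) = 0"
  by (simp add: nrm_def)

lemma integral_power2_eq: "(LINT x|lborel. f x * f x) = (nrm f)\<^sup>2"
  unfolding nrm_sq by (simp add: power2_eq_square)

text \<open>The integral of (s f - g)^2 is a nonnegative quadratic polynomial in s; the estimate is
  its discriminant condition, read off at s = \<open>?I / (nrm f)\<^sup>2\<close>.\<close>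

lemma Cauchy_Schwarz_sqint:
  assumes "sqint f" "sqint g"
  shows "\<bar>LINT x|lborel. f x * g x\<bar> \<le> nrm f * nrm g"
proof -
  let ?I = "LINT x|lborel. f x * g x"
  note [simp] = sqintD(2)[OF assms(1)] sqintD(2)[OF assms(2)] integrable_mult_sqint[OF assms]
  have quad: "2 * s * ?I \<le> s\<^sup>2 * (nrm f)\<^sup>2 + (nrm g)\<^sup>2" for s
  proof -
    have "0 \<le> (LINT x|lborel. (s * f x - g x)\<^sup>2)" by simp
    also have "\<dots> = (LINT x|lborel. s\<^sup>2 * (f x)\<^sup>2 + (g x)\<^sup>2 - 2 * s * (f x * g x))"
      by (intro Bochner_Integration.integral_cong) (auto simp: power2_eq_square algebra_simps)
    also have "\<dots> = s\<^sup>2 * (nrm f)\<^sup>2 + (nrm g)\<^sup>2 - 2 * s * ?I"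
      by (simp add: nrm_sq)
    finally show ?thesis by simp
  qed
  have "?I\<^sup>2 \<le> (nrm f * nrm g)\<^sup>2"
  proof (cases "nrm f = 0")
    case True
    have "2 * s * ?I \<le> (nrm g)\<^sup>2" for s using quad[of s] True by simp
    \<comment> \<open>With \<open>nrm f = 0\<close> the bound is linear in s; if \<open>?I\<close>
      were nonzero, this s would make the left side exceed the right side by 1.\<close>
    from this[of "((nrm g)\<^sup>2 + 1) / (2 * ?I)"] have "?I = 0"
      by (cases "?I = 0") auto
    then show ?thesis by simp
  next
    case False
    have "2 * (?I / (nrm f)\<^sup>2) * ?I \<le> (?I / (nrm f)\<^sup>2)\<^sup>2 * (nrm f)\<^sup>2 + (nrm g)\<^sup>2" by (rule quad)
    also have "(?I / (nrm f)\<^sup>2)\<^sup>2 * (nrm f)\<^sup>2 = ?I\<^sup>2 / (nrm f)\<^sup>2"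
      using False by (simp add: power2_eq_square field_simps)
    finally have "?I\<^sup>2 / (nrm f)\<^sup>2 \<le> (nrm g)\<^sup>2"
      by (simp add: power2_eq_square)
    then show ?thesis using False
      by (simp add: pos_divide_le_eq power_mult_distrib mult.commute)
  qed
  then show ?thesis
    using abs_le_square_iff[of ?I "nrm f * nrm g"] by (simp add: abs_mult)
qed

lemma nrm_add_le:
  assumes "sqint f" "sqint g"
  shows "nrm (\<lambda>x. f x + g x) \<le> nrm f + nrm g"
proof -
  note [simp] = sqintD(2)[OF assms(1)] sqintD(2)[OF assms(2)] integrable_mult_sqint[OF assms]
  have "(nrm (\<lambda>x. f x + g x))\<^sup>2 = (LINT x|lborel. (f x)\<^sup>2 + (g x)\<^sup>2 + 2 * (f x * g x))"
    unfolding nrm_sq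
    by (intro Bochner_Integration.integral_cong) (auto simp: power2_eq_square algebra_simps)
  also have "\<dots> = (nrm f)\<^sup>2 + (nrm g)\<^sup>2 + 2 * (LINT x|lborel. f x * g x)"
    by (simp add: nrm_sq)
  also have "\<dots> \<le> (nrm f + nrm g)\<^sup>2"
    using Cauchy_Schwarz_sqint[OF assms] by (simp add: power2_sum)
  finally show ?thesis
    using power2_le_imp_le by fastforce
qed

lemma nrm_diff_le:
  assumes "sqint f" "sqint g"
  shows "nrm (\<lambda>x. f x - g x) \<le> nrm f + nrm g"
  using nrm_add_le[OF assms(1) sqint_minus[OF assms(2)]] by simp

lemma nrm_mult_bdd:
  assumes "sqint f" "\<And>x. \<bar>g x\<bar> \<le> B"
  shows "nrm (\<lambda>x. f x * g x) \<le> B * nrm f"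
proof -
  have B: "0 \<le> B" using assms(2)[of 0] by linarith
  have "nrm (\<lambda>x. f x * g x) \<le> nrm (\<lambda>x. B * f x)"
  proof (rule nrm_mono)
    show "sqint (\<lambda>x. B * f x)" using assms by blast
    show "\<bar>f x * g x\<bar> \<le> \<bar>B * f x\<bar>" for x
      unfolding abs_mult using assms(2)[of x] B by (subst mult.commute) (intro mult_right_mono, auto)
  qed
  then show ?thesis using B by (simp add: nrm_cmult)
qed

lemma nrm_cong_AE:
  assumes "AE x in lborel. f x = g x" "f \<in> borel_measurable borel" "g \<in> borel_measurable borel"
  shows "nrm f = nrm g"
  unfolding nrm_def using assms by (intro arg_cong[where f=sqrt] integral_cong_AE) auto

lemma sqint_cong_AE:
  assumes "AE x in lborel. f x = g x" "f \<in> borel_measurable borel" "sqint g"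
  shows "sqint f"
proof -
  note [measurable] = assms(2) sqintD(1)[OF assms(3)]
  have "integrable lborel (\<lambda>x. (f x)\<^sup>2) \<longleftrightarrow> integrable lborel (\<lambda>x. (g x)\<^sup>2)"
    by (rule integrable_cong_AE) (use assms in auto)
  then show ?thesis using assms by (simp add: sqint_def)
qed

subsection \<open>Convergence and differentiation in the mean\<close>

text \<open>Membership in L^2 is required for every index, not just eventually along
  \<open>Fl\<close>. Difference quotients satisfy this even at h = 0, where division by zero makes
  them the zero function, and the limit rules are thereby freed from eventual side
  conditions.\<close>

definition L2lim :: "('a \<Rightarrow> real \<Rightarrow> real) \<Rightarrow> (real \<Rightarrow> real) \<Rightarrow> 'a filter \<Rightarrow> bool" where
  "L2lim F f Fl \<longleftrightarrow> (\<forall>h. sqint (F h)) \<and> sqint f \<and> ((\<lambda>h. nrm (\<lambda>x. F h x - f x)) \<longlongrightarrow> 0) Fl"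

lemma L2limD:
  assumes "L2lim F f Fl"
  shows "sqint (F h)" "sqint f" "((\<lambda>h. nrm (\<lambda>x. F h x - f x)) \<longlongrightarrow> 0) Fl"
  using assms by (auto simp: L2lim_def)

lemma L2lim_const [intro]: "sqint f \<Longrightarrow> L2lim (\<lambda>h. f) f Fl"
  by (auto simp: L2lim_def)

lemma L2limI_le:
  assumes "\<And>h. sqint (F h)" "sqint f" "(b \<longlongrightarrow> 0) Fl"
    and "eventually (\<lambda>h. nrm (\<lambda>x. F h x - f x) \<le> b h) Fl"
  shows "L2lim F f Fl"
  unfolding L2lim_def
  using assms by (auto intro: tendsto_sandwich[OF _ assms(4) tendsto_const])

lemma L2lim_add [intro]:
  assumes "L2lim F f Fl" "L2lim G g Fl"
  shows "L2lim (\<lambda>h x. F h x + G h x) (\<lambda>x. f x + g x) Fl"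
proof (rule L2limI_le)
  note a = L2limD[OF assms(1)] and b = L2limD[OF assms(2)]
  show "((\<lambda>h. nrm (\<lambda>x. F h x - f x) + nrm (\<lambda>x. G h x - g x)) \<longlongrightarrow> 0) Fl"
    using tendsto_add[OF a(3) b(3)] by simp
  show "sqint (\<lambda>x. F h x + G h x)" for h using a b by blast
  show "sqint (\<lambda>x. f x + g x)" using a b by blast
  show "\<forall>\<^sub>F h in Fl. nrm (\<lambda>x. F h x + G h x - (f x + g x))
          \<le> nrm (\<lambda>x. F h x - f x) + nrm (\<lambda>x. G h x - g x)"
  proof (rule always_eventually, rule allI)
    fix h
    have "nrm (\<lambda>x. (F h x - f x) + (G h x - g x)) \<le> nrm (\<lambda>x. F h x - f x) + nrm (\<lambda>x. G h x - g x)"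
      by (rule nrm_add_le) (use a b in blast)+
    then show "nrm (\<lambda>x. F h x + G h x - (f x + g x))
        \<le> nrm (\<lambda>x. F h x - f x) + nrm (\<lambda>x. G h x - g x)" by (simp add: algebra_simps)
  qed
qed

lemma L2lim_cmult [intro]:
  assumes "L2lim F f Fl"
  shows "L2lim (\<lambda>h x. c * F h x) (\<lambda>x. c * f x) Fl"
proof (rule L2limI_le)
  note a = L2limD[OF assms]
  show "((\<lambda>h. \<bar>c\<bar> * nrm (\<lambda>x. F h x - f x)) \<longlongrightarrow> 0) Fl"
    using tendsto_mult_left[OF a(3), of "\<bar>c\<bar>"] by simp
  show "\<forall>\<^sub>F h in Fl. nrm (\<lambda>x. c * F h x - c * f x) \<le> \<bar>c\<bar> * nrm (\<lambda>x. F h x - f x)"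
    by (simp add: nrm_cmult flip: right_diff_distrib)
qed (use L2limD[OF assms] in blast)+

lemma L2lim_minus [intro]:
  assumes "L2lim F f Fl"
  shows "L2lim (\<lambda>h x. - F h x) (\<lambda>x. - f x) Fl"
  using L2lim_cmult[OF assms, of "-1"] by simp

lemma L2lim_diff [intro]:
  assumes "L2lim F f Fl" "L2lim G g Fl"
  shows "L2lim (\<lambda>h x. F h x - G h x) (\<lambda>x. f x - g x) Fl"
  using L2lim_add[OF assms(1) L2lim_minus[OF assms(2)]] by simp

lemma L2lim_shift:
  assumes "L2lim F f Fl"
  shows "L2lim (\<lambda>h x. F h (x + k)) (\<lambda>x. f (x + k)) Fl"
proof (rule L2limI_le)
  note a = L2limD[OF assms]
  show "((\<lambda>h. nrm (\<lambda>x. F h x - f x)) \<longlongrightarrow> 0) Fl" by (rule a)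
  show "\<forall>\<^sub>F h in Fl. nrm (\<lambda>x. F h (x + k) - f (x + k)) \<le> nrm (\<lambda>x. F h x - f x)"
    by (rule always_eventually) (use nrm_shift[of "\<lambda>x. F _ x - f x" k] in auto)
qed (use L2limD[OF assms] in blast)+

lemma L2lim_nrm:
  assumes "L2lim F f Fl"
  shows "((\<lambda>h. nrm (F h)) \<longlongrightarrow> nrm f) Fl"
proof -
  note a = L2limD[OF assms]
  have "((\<lambda>h. nrm (F h) - nrm f) \<longlongrightarrow> 0) Fl"
  proof (rule Lim_null_comparison[OF _ a(3)], rule always_eventually, rule allI)
    fix h
    have "nrm (\<lambda>x. (F h x - f x) + f x) \<le> nrm (\<lambda>x. F h x - f x) + nrm f"
      by (rule nrm_add_le) (use a in blast)+
    moreover have "nrm (\<lambda>x. F h x - (F h x - f x)) \<le> nrm (F h) + nrm (\<lambda>x. F h x - f x)"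
      by (rule nrm_diff_le) (use a in blast)+
    ultimately show "norm (nrm (F h) - nrm f) \<le> nrm (\<lambda>x. F h x - f x)"
      by simp
  qed
  then show ?thesis by (simp add: LIM_zero_iff)
qed

lemma L2lim_integral_mult:
  assumes "L2lim F f Fl" "L2lim G g Fl"
  shows "((\<lambda>h. LINT x|lborel. F h x * G h x) \<longlongrightarrow> (LINT x|lborel. f x * g x)) Fl"
proof -
  note a = L2limD[OF assms(1)] and b = L2limD[OF assms(2)]
  have "((\<lambda>h. (LINT x|lborel. F h x * G h x) - (LINT x|lborel. f x * g x)) \<longlongrightarrow> 0) Fl"
  proof (rule Lim_null_comparison)
    show "\<forall>\<^sub>F h in Fl. norm ((LINT x|lborel. F h x * G h x) - (LINT x|lborel. f x * g x))
        \<le> nrm (\<lambda>x. F h x - f x) * nrm (G h) + nrm f * nrm (\<lambda>x. G h x - g x)"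
    proof (rule always_eventually, rule allI)
      fix h
      have "(LINT x|lborel. F h x * G h x) - (LINT x|lborel. f x * g x)
          = (LINT x|lborel. F h x * G h x - f x * g x)"
        using a b by (intro Bochner_Integration.integral_diff[symmetric] integrable_mult_sqint)
      also have "\<dots> = (LINT x|lborel. (F h x - f x) * G h x + f x * (G h x - g x))"
        by (intro Bochner_Integration.integral_cong) (auto simp: algebra_simps)
      also have "\<dots> = (LINT x|lborel. (F h x - f x) * G h x) + (LINT x|lborel. f x * (G h x - g x))"
        by (intro Bochner_Integration.integral_add integrable_mult_sqint) (use a b in blast)+
      finally show "norm ((LINT x|lborel. F h x * G h x) - (LINT x|lborel. f x * g x))
        \<le> nrm (\<lambda>x. F h x - f x) * nrm (G h) + nrm f * nrm (\<lambda>x. G h x - g x)"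
        using Cauchy_Schwarz_sqint[OF sqint_diff[OF a(1) a(2)] b(1), of h h]
          Cauchy_Schwarz_sqint[OF a(2) sqint_diff[OF b(1) b(2)], of h] by simp
    qed
    show "((\<lambda>h. nrm (\<lambda>x. F h x - f x) * nrm (G h) + nrm f * nrm (\<lambda>x. G h x - g x)) \<longlongrightarrow> 0) Fl"
      using tendsto_add[OF tendsto_mult[OF a(3) L2lim_nrm[OF assms(2)]]
          tendsto_mult[OF tendsto_const[of "nrm f"] b(3)]] by simp
  qed
  then show ?thesis by (simp add: LIM_zero_iff)
qed

text \<open>From F G - f g = F (G - g) + (F - f) g: the first product is small because G - g is
  small in the sup norm while \<open>nrm (F h)\<close> stays near \<open>nrm f\<close>, the second
  because g is bounded.\<close>

lemma L2lim_mult_uniform: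
  assumes F: "L2lim F f Fl" and G: "uniform_limit UNIV G g Fl"
    and m: "\<And>h. G h \<in> borel_measurable borel" "\<And>h. bounded (range (G h))"
    and mg: "g \<in> borel_measurable borel" "bounded (range g)"
  shows "L2lim (\<lambda>h x. F h x * G h x) (\<lambda>x. f x * g x) Fl"
proof -
  note a = L2limD[OF F]
  obtain B where B: "\<And>x. \<bar>g x\<bar> \<le> B"
    using mg(2) by (auto simp: bounded_iff)
  have q: "sqint (\<lambda>x. F' x * G' x)"
    if fg: "sqint F'" "G' \<in> borel_measurable borel" "bounded (range G')" for F' G'
  proof -
    obtain B' where "\<And>x. \<bar>G' x\<bar> \<le> B'" using fg(3) by (auto simp: bounded_iff)
    then show ?thesis using fg sqint_mult_bdd by blast
  qed
  have dG: "bounded (range (\<lambda>x. G h x - g x))" for h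
    using bounded_minus_comp[OF m(2)[of h] mg(2)] by simp
  have lim1: "L2lim (\<lambda>h x. (F h x - f x) * g x) (\<lambda>x. 0) Fl"
  proof (rule L2limI_le)
    show "sqint (\<lambda>x. (F h x - f x) * g x)" for h
      by (rule q) (use a mg in auto)
    show "((\<lambda>h. B * nrm (\<lambda>x. F h x - f x)) \<longlongrightarrow> 0) Fl"
      using tendsto_mult_left[OF a(3), of B] by simp
    show "\<forall>\<^sub>F h in Fl. nrm (\<lambda>x. (F h x - f x) * g x - 0) \<le> B * nrm (\<lambda>x. F h x - f x)"
      by (rule always_eventually) (use nrm_mult_bdd[OF sqint_diff[OF a(1) a(2)] B] in auto)
  qed auto
  have lim2: "L2lim (\<lambda>h x. F h x * (G h x - g x)) (\<lambda>x. 0) Fl"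
    unfolding L2lim_def
  proof (intro conjI allI)
    show "sqint (\<lambda>x. F h x * (G h x - g x))" for h
      by (rule q[OF _ _ dG]) (use a m mg in auto)
    show "((\<lambda>h. nrm (\<lambda>x. F h x * (G h x - g x) - 0)) \<longlongrightarrow> 0) Fl"
    proof (rule tendstoI)
      fix e :: real assume e: "e > 0"
      \<comment> \<open>Eventually \<open>nrm (F h)\<close> is below \<open>nrm f + 1\<close>; the
        remaining unit in the denominator makes the final inequality strict.\<close>
      define d where "d = e / (nrm f + 2)"
      have d: "d > 0" using e by (simp add: d_def add_nonneg_pos)
      have "\<forall>\<^sub>F h in Fl. dist (nrm (F h)) (nrm f) < 1"
        using L2lim_nrm[OF F] by (simp add: tendsto_iff)
      moreover have "\<forall>\<^sub>F h in Fl. \<forall>x\<in>UNIV. dist (G h x) (g x) < d"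
        using G d by (simp add: uniform_limit_iff)
      ultimately show "\<forall>\<^sub>F h in Fl. dist (nrm (\<lambda>x. F h x * (G h x - g x) - 0)) 0 < e"
      proof eventually_elim
        case (elim h)
        have "nrm (\<lambda>x. F h x * (G h x - g x)) \<le> d * nrm (F h)"
          by (rule nrm_mult_bdd[OF a(1)]) (use elim(2) in \<open>auto simp: dist_real_def less_imp_le\<close>)
        also have "\<dots> \<le> d * (nrm f + 1)"
          using elim(1) d by (intro mult_left_mono) (auto simp: dist_real_def)
        also have "\<dots> < d * (nrm f + 2)" using d by simp
        also have "\<dots> = e"
          using add_nonneg_pos[OF nrm_nonneg[of f], of 2] by (simp add: d_def)
        finally show ?case by simp
      qed
    qed
  qed simp
  have fg: "sqint (\<lambda>x. f x * g x)" by (rule q) (use a mg in auto)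
  have "L2lim (\<lambda>h x. F h x * (G h x - g x) + (F h x - f x) * g x + f x * g x) (\<lambda>x. 0 + 0 + f x * g x) Fl"
    by (intro L2lim_add lim1 lim2 L2lim_const fg)
  then show ?thesis by (simp add: algebra_simps)
qed

section \<open>Curves in L^2: differentiability in the mean and product rules\<close>

definition mean_deriv :: "(real \<Rightarrow> real \<Rightarrow> real) \<Rightarrow> (real \<Rightarrow> real) \<Rightarrow> real \<Rightarrow> bool" where
  "mean_deriv f f' t \<longleftrightarrow> (\<forall>s. sqint (f s)) \<and> L2lim (\<lambda>h x. (f (t + h) x - f t x) / h) f' (at 0)"

text \<open>The property a factor must have for products to stay within L^2. Curves continuous in
  H^1 acquire it from the sup norm inequality.\<close>

definition bdd_cont :: "(real \<Rightarrow> real \<Rightarrow> real) \<Rightarrow> real \<Rightarrow> bool" where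
  "bdd_cont f t \<longleftrightarrow> (\<forall>s. f s \<in> borel_measurable borel \<and> bounded (range (f s))) \<and>
     uniform_limit UNIV (\<lambda>h. f (t + h)) (f t) (at 0)"

lemma mean_derivD:
  assumes "mean_deriv f f' t"
  shows "sqint (f s)" "sqint f'" "L2lim (\<lambda>h x. (f (t + h) x - f t x) / h) f' (at 0)"
  using assms by (auto simp: mean_deriv_def L2lim_def)

lemma L2lim_cong_AE:
  assumes "L2lim F f Fl" "AE x in lborel. f x = g x" "g \<in> borel_measurable borel"
  shows "L2lim F g Fl"
proof -
  note a = L2limD[OF assms(1)]
  have g: "sqint g" by (rule sqint_cong_AE[OF _ assms(3) a(2)]) (use assms(2) in auto)
  have "nrm (\<lambda>x. F h x - g x) = nrm (\<lambda>x. F h x - f x)" for h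
  proof (rule nrm_cong_AE)
    show "AE x in lborel. F h x - g x = F h x - f x" using assms(2) by auto
  qed (use sqintD(1)[OF a(1)[of h]] sqintD(1)[OF a(2)] assms(3) in auto)
  then show ?thesis using a g by (simp add: L2lim_def)
qed

lemma mean_deriv_cong_AE:
  assumes "mean_deriv f f' t" "AE x in lborel. f' x = g x" "g \<in> borel_measurable borel"
  shows "mean_deriv f g t"
  using assms L2lim_cong_AE by (auto simp: mean_deriv_def)

lemma mean_deriv_L2lim:
  assumes "mean_deriv f f' t"
  shows "L2lim (\<lambda>h. f (t + h)) (f t) (at 0)"
proof (rule L2limI_le)
  note a = mean_derivD[OF assms]
  show "((\<lambda>h. \<bar>h\<bar> * nrm (\<lambda>x. (f (t + h) x - f t x) / h)) \<longlongrightarrow> 0) (at 0)"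
    using tendsto_mult[OF tendsto_rabs_zero[OF tendsto_ident_at] L2lim_nrm[OF a(3)]] by simp
  show "\<forall>\<^sub>F h in at 0. nrm (\<lambda>x. f (t + h) x - f t x) \<le> \<bar>h\<bar> * nrm (\<lambda>x. (f (t + h) x - f t x) / h)"
    by (auto simp: eventually_at_filter nrm_divide)
qed (use mean_derivD[OF assms] in auto)

lemma mean_deriv_add [intro]:
  assumes "mean_deriv f f' t" "mean_deriv g g' t"
  shows "mean_deriv (\<lambda>s x. f s x + g s x) (\<lambda>x. f' x + g' x) t"
proof -
  note a = mean_derivD[OF assms(1)] and b = mean_derivD[OF assms(2)]
  show ?thesis unfolding mean_deriv_def
    using L2lim_add[OF a(3) b(3)] a b by (auto simp: diff_divide_distrib add_divide_distrib algebra_simps)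
qed

lemma mean_deriv_cmult [intro]:
  assumes "mean_deriv f f' t"
  shows "mean_deriv (\<lambda>s x. c * f s x) (\<lambda>x. c * f' x) t"
  using mean_derivD[OF assms] L2lim_cmult[OF mean_derivD(3)[OF assms], of c]
  by (auto simp: mean_deriv_def right_diff_distrib)

lemma mean_deriv_minus [intro]:
  assumes "mean_deriv f f' t"
  shows "mean_deriv (\<lambda>s x. - f s x) (\<lambda>x. - f' x) t"
  using mean_deriv_cmult[OF assms, of "-1"] by simp

lemma mean_deriv_diff [intro]:
  assumes "mean_deriv f f' t" "mean_deriv g g' t"
  shows "mean_deriv (\<lambda>s x. f s x - g s x) (\<lambda>x. f' x - g' x) t"
  using mean_deriv_add[OF assms(1) mean_deriv_minus[OF assms(2)]] by simp

lemma bdd_cont_add [intro]: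
  assumes "bdd_cont f t" "bdd_cont g t"
  shows "bdd_cont (\<lambda>s x. f s x + g s x) t"
  using assms by (auto simp: bdd_cont_def intro!: uniform_limit_add bounded_plus_comp borel_measurable_add)

lemma bdd_cont_cmult [intro]:
  assumes "bdd_cont f t"
  shows "bdd_cont (\<lambda>s x. c * f s x) t"
proof -
  have "bounded (range (\<lambda>x. c * f s x))" for s
    using assms bounded_scaleR_comp[of "f s" UNIV c] by (auto simp: bdd_cont_def)
  moreover have "uniform_limit UNIV (\<lambda>h x. c * f (t + h) x) (\<lambda>x. c * f t x) (at 0)"
    using assms by (intro bounded_linear.uniform_limit[OF bounded_linear_mult_right]) (auto simp: bdd_cont_def)
  ultimately show ?thesis using assms by (auto simp: bdd_cont_def intro!: borel_measurable_times)
qed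

lemma bdd_cont_minus [intro]:
  assumes "bdd_cont f t"
  shows "bdd_cont (\<lambda>s x. - f s x) t"
  using bdd_cont_cmult[OF assms, of "-1"] by simp

lemma bdd_cont_diff [intro]:
  assumes "bdd_cont f t" "bdd_cont g t"
  shows "bdd_cont (\<lambda>s x. f s x - g s x) t"
  using bdd_cont_add[OF assms(1) bdd_cont_minus[OF assms(2)]] by simp

lemma bdd_cont_mult [intro]:
  assumes "bdd_cont f t" "bdd_cont g t"
  shows "bdd_cont (\<lambda>s x. f s x * g s x) t"
proof -
  have "uniform_limit UNIV (\<lambda>h x. f (t + h) x * g (t + h) x) (\<lambda>x. f t x * g t x) (at 0)"
    using assms by (intro uniform_lim_mult) (auto simp: bdd_cont_def image_def bounded_def)
  moreover have "bounded (range (\<lambda>x. f s x * g s x))" for s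
  proof -
    have "bounded (range (f s))" "bounded (range (g s))" using assms by (auto simp: bdd_cont_def)
    then obtain B C where "\<And>x. \<bar>f s x\<bar> \<le> B" "\<And>x. \<bar>g s x\<bar> \<le> C"
      by (auto simp: bounded_iff)
    then have "\<bar>f s x * g s x\<bar> \<le> B * C" for x
      unfolding abs_mult by (intro mult_mono) (auto intro: order_trans[OF abs_ge_zero])
    then show ?thesis by (auto simp: bounded_iff)
  qed
  ultimately show ?thesis using assms by (auto simp: bdd_cont_def intro!: borel_measurable_times)
qed

lemma bdd_contD:
  assumes "bdd_cont f t"
  shows "f s \<in> borel_measurable borel" "bounded (range (f s))"
    "uniform_limit UNIV (\<lambda>h. f (t + h)) (f t) (at 0)"
  using assms by (auto simp: bdd_cont_def)

lemma L2lim_mult_bdd_cont: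
  assumes "L2lim F f (at 0)" "bdd_cont g t"
  shows "L2lim (\<lambda>h x. F h x * g (t + h) x) (\<lambda>x. f x * g t x) (at 0)"
  by (rule L2lim_mult_uniform[OF assms(1) bdd_contD(3)[OF assms(2)]]) (use bdd_contD[OF assms(2)] in auto)

text \<open>The increment is split with one factor at the new time and the other at the old one.
  Each quotient converges in L^2 and meets a factor converging in the sup norm, so both factors are
  taken bounded, in contrast to the rule for integrals that follows.\<close>

lemma mean_deriv_mult:
  assumes "mean_deriv f f' t" "bdd_cont f t" "mean_deriv g g' t" "bdd_cont g t"
  shows "mean_deriv (\<lambda>s x. f s x * g s x) (\<lambda>x. f' x * g t x + f t x * g' x) t"
proof -
  note a = mean_derivD[OF assms(1)] and b = mean_derivD[OF assms(3)]
  have "sqint (\<lambda>x. f s x * g s x)" for s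
  proof -
    obtain B where "\<And>x. \<bar>g s x\<bar> \<le> B" using bdd_contD(2)[OF assms(4), of s] by (auto simp: bounded_iff)
    then show ?thesis using sqint_mult_bdd[OF a(1) bdd_contD(1)[OF assms(4)]] by blast
  qed
  moreover have "L2lim (\<lambda>h x. (f (t + h) x - f t x) / h * g (t + h) x + (g (t + h) x - g t x) / h * f t x)
     (\<lambda>x. f' x * g t x + g' x * f t x) (at 0)"
    by (intro L2lim_add L2lim_mult_bdd_cont[OF a(3) assms(4)] L2lim_mult_uniform[OF b(3) uniform_limit_const])
       (use bdd_contD[OF assms(2)] in auto)
  moreover have "(\<lambda>h x. (f (t + h) x - f t x) / h * g (t + h) x + (g (t + h) x - g t x) / h * f t x) =
     (\<lambda>h x. (f (t + h) x * g (t + h) x - f t x * g t x) / h)"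
    by (intro ext) (simp add: add_divide_distrib[symmetric] algebra_simps)
  ultimately show ?thesis
    unfolding mean_deriv_def by (simp add: mult.commute)
qed

text \<open>Integrating a product asks only for convergence in L^1, which two L^2 limits give by
  Cauchy-Schwarz. The rule therefore covers terms quadratic in the spatial derivatives, for which no
  sup bound is available.\<close>

lemma mean_deriv_integral_mult:
  assumes "mean_deriv f f' t" "mean_deriv g g' t"
  shows "((\<lambda>s. LINT x|lborel. f s x * g s x) has_real_derivative
     (LINT x|lborel. f' x * g t x + f t x * g' x)) (at t)"
proof -
  note a = mean_derivD[OF assms(1)] and b = mean_derivD[OF assms(2)]
  have "((\<lambda>h. (LINT x|lborel. (f (t + h) x - f t x) / h * g (t + h) x) +
      (LINT x|lborel. f t x * ((g (t + h) x - g t x) / h)))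
     \<longlongrightarrow> (LINT x|lborel. f' x * g t x) + (LINT x|lborel. f t x * g' x)) (at 0)"
    by (intro tendsto_add L2lim_integral_mult a b mean_deriv_L2lim[OF assms(2)] L2lim_const)
  moreover have "(LINT x|lborel. (f (t + h) x - f t x) / h * g (t + h) x) +
      (LINT x|lborel. f t x * ((g (t + h) x - g t x) / h))
    = ((LINT x|lborel. f (t + h) x * g (t + h) x) - (LINT x|lborel. f t x * g t x)) / h" for h
  proof -
    have "(LINT x|lborel. (f (t + h) x - f t x) / h * g (t + h) x) +
      (LINT x|lborel. f t x * ((g (t + h) x - g t x) / h))
     = (LINT x|lborel. (f (t + h) x - f t x) / h * g (t + h) x + f t x * ((g (t + h) x - g t x) / h))"
      by (intro Bochner_Integration.integral_add[symmetric] integrable_mult_sqint sqint_divide sqint_diff a b)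
    also have "\<dots> = (LINT x|lborel. (f (t + h) x * g (t + h) x - f t x * g t x) / h)"
      by (intro Bochner_Integration.integral_cong) (auto simp: add_divide_distrib[symmetric] algebra_simps)
    finally show ?thesis
      using integrable_mult_sqint[OF a(1) b(1)] by simp
  qed
  moreover have "(LINT x|lborel. f' x * g t x) + (LINT x|lborel. f t x * g' x)
     = (LINT x|lborel. f' x * g t x + f t x * g' x)"
    by (intro Bochner_Integration.integral_add[symmetric] integrable_mult_sqint a b)
  ultimately show ?thesis by (simp add: DERIV_def)
qed

subsection \<open>Translations\<close>

text \<open>For an open set the positive part of the difference tends to 0 pointwise, and it carries
  half of the integral because the difference has mean zero.\<close>

lemma translation_indicator_open:
  assumes "open U" "emeasure lborel U < \<infinity>" "s \<longlonglongrightarrow> (0::real)"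
  shows "(\<lambda>n. LINT x|lborel. \<bar>indicator U (x + s n) - indicator U x\<bar> :: real) \<longlonglongrightarrow> 0"
proof -
  have [measurable]: "U \<in> sets borel" using assms by auto
  have iU: "integrable lborel (indicator U :: real \<Rightarrow> real)"
    using assms by (intro integrable_real_indicator) auto
  have iUs: "integrable lborel (\<lambda>x. indicator U (x + k) :: real)" for k
    using lborel_integrable_real_affine[OF iU, of 1 k] by (simp add: add.commute)
  let ?p = "\<lambda>n x. max 0 (indicator U x - indicator U (x + s n)) :: real"
  have "(\<lambda>n. LINT x|lborel. ?p n x) \<longlonglongrightarrow> (LINT x::real|lborel. 0)"
  proof (rule integral_dominated_convergence[where w = "indicator U :: real \<Rightarrow> real"])
    show "AE x in lborel. (\<lambda>n. ?p n x) \<longlonglongrightarrow> 0"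
    proof (rule AE_I2)
      fix x :: real
      show "(\<lambda>n. ?p n x) \<longlonglongrightarrow> 0"
      proof (cases "x \<in> U")
        case True
        have "(\<lambda>n. x + s n) \<longlonglongrightarrow> x" using tendsto_add[OF tendsto_const[of x] assms(3)] by simp
        then have "eventually (\<lambda>n. x + s n \<in> U) sequentially"
          using topological_tendstoD[OF _ assms(1) True] by blast
        then have "eventually (\<lambda>n. ?p n x = 0) sequentially"
          by eventually_elim (use True in auto)
        then show ?thesis by (rule tendsto_eventually)
      next
        case False
        then have "?p n x = 0" for n by (auto simp: indicator_def)
        then show ?thesis by simp
      qed
    qed
    show "AE x in lborel. norm (?p n x) \<le> indicator U x" for n
      by (auto simp: indicator_def)
  qed (use iU in auto)
  then have "(\<lambda>n. 2 * (LINT x|lborel. ?p n x)) \<longlonglongrightarrow> 0"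
    using tendsto_mult_left[of _ 0 sequentially 2] by simp
  moreover have "2 * (LINT x|lborel. ?p n x) = (LINT x|lborel. \<bar>indicator U (x + s n) - indicator U x\<bar>)" for n
  proof -
    have 1: "(LINT x|lborel. indicator U (x + s n) - indicator U x :: real) = 0"
      using iU iUs integral_shift[of "indicator U :: real \<Rightarrow> real" "s n"] by simp
    have ip: "integrable lborel (?p n)"
      by (rule Bochner_Integration.integrable_bound[OF iU]) (auto simp: indicator_def)
    have "(LINT x|lborel. \<bar>indicator U (x + s n) - indicator U x :: real\<bar>)
       = (LINT x|lborel. 2 * ?p n x + (indicator U (x + s n) - indicator U x))"
      by (intro Bochner_Integration.integral_cong) (auto simp: max_def)
    also have "\<dots> = 2 * (LINT x|lborel. ?p n x) + (LINT x|lborel. indicator U (x + s n) - indicator U x :: real)"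
      using ip iU iUs by (subst Bochner_Integration.integral_add) auto
    finally show ?thesis using 1 by simp
  qed
  ultimately show ?thesis by simp
qed

text \<open>Approximation in L^1: from open sets of finite measure to measurable ones by outer
  regularity, then to sums and dominated limits. Limit passages go through the local fact
  \<open>approx\<close>, which rests on translation preserving the integral.\<close>

lemma translation_L1:
  fixes f :: "real \<Rightarrow> real"
  assumes "integrable lborel f" "s \<longlonglongrightarrow> 0"
  shows "(\<lambda>n. LINT x|lborel. \<bar>f (x + s n) - f x\<bar>) \<longlonglongrightarrow> 0"
proof -
  have shi: "integrable lborel (\<lambda>x. g (x + k))" if "integrable lborel g" for g :: "real \<Rightarrow> real" and k
    using lborel_integrable_real_affine[OF that, of 1 k] by (simp add: add.commute)
  have approx: "(\<lambda>n. LINT x|lborel. \<bar>g (x + s n) - g x\<bar>) \<longlonglongrightarrow> 0"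
    if g: "integrable lborel g"
      and ap: "\<And>e. e > 0 \<Longrightarrow> \<exists>g'. integrable lborel g' \<and> (LINT x|lborel. \<bar>g x - g' x\<bar>) < e
        \<and> (\<lambda>n. LINT x|lborel. \<bar>g' (x + s n) - g' x\<bar>) \<longlonglongrightarrow> 0" for g :: "real \<Rightarrow> real"
  proof (rule LIMSEQ_I)
    fix e :: real assume "e > 0"
    then obtain g' where g': "integrable lborel g'" "(LINT x|lborel. \<bar>g x - g' x\<bar>) < e / 3"
      "(\<lambda>n. LINT x|lborel. \<bar>g' (x + s n) - g' x\<bar>) \<longlonglongrightarrow> 0" using ap[of "e/3"] by auto
    from LIMSEQ_D[OF g'(3), of "e/3"] \<open>e > 0\<close> obtain N
      where N: "\<And>n. n \<ge> N \<Longrightarrow> \<bar>LINT x|lborel. \<bar>g' (x + s n) - g' x\<bar>\<bar> < e / 3" by auto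
    have "\<bar>LINT x|lborel. \<bar>g (x + s n) - g x\<bar>\<bar> < e" if "n \<ge> N" for n
    proof -
      note [simp] = g g'(1) shi[OF g] shi[OF g'(1)]
      have "(LINT x|lborel. \<bar>g (x + s n) - g x\<bar>)
         \<le> (LINT x|lborel. \<bar>g (x + s n) - g' (x + s n)\<bar> + \<bar>g' (x + s n) - g' x\<bar> + \<bar>g x - g' x\<bar>)"
        by (intro integral_mono) auto
      also have "\<dots> = (LINT x|lborel. \<bar>g (x + s n) - g' (x + s n)\<bar>)
         + (LINT x|lborel. \<bar>g' (x + s n) - g' x\<bar>) + (LINT x|lborel. \<bar>g x - g' x\<bar>)"
        by simp
      also have "(LINT x|lborel. \<bar>g (x + s n) - g' (x + s n)\<bar>) = (LINT x|lborel. \<bar>g x - g' x\<bar>)"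
        by (rule integral_shift[of "\<lambda>x. \<bar>g x - g' x\<bar>"])
      finally show ?thesis using g'(2) N[OF that] by simp
    qed
    then show "\<exists>no. \<forall>n\<ge>no. norm ((LINT x|lborel. \<bar>g (x + s n) - g x\<bar>) - 0) < e" by auto
  qed
  show ?thesis using assms(1)
  proof (induction rule: integrable_induct)
    case (base A c)
    have [measurable]: "A \<in> sets borel" using base by simp
    have iA: "integrable lborel (indicator A :: real \<Rightarrow> real)"
      using base by (intro integrable_real_indicator) auto
    have "(\<lambda>n. LINT x|lborel. \<bar>indicator A (x + s n) - indicator A x :: real\<bar>) \<longlonglongrightarrow> 0"
    proof (rule approx[OF iA])
      fix e :: real assume "e > 0"
      then obtain U where U: "open U" "A \<subseteq> U" "emeasure lborel (U - A) < ennreal e"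
        using outer_regular_lborel[of A e] by auto
      have [measurable]: "U \<in> sets borel" using U by auto
      have "emeasure lborel U = emeasure lborel A + emeasure lborel (U - A)"
        using plus_emeasure[of A lborel "U - A"] U by (simp add: Un_absorb1 Un_absorb2)
      then have fU: "emeasure lborel U < \<infinity>"
        using U(3) base by (auto simp: less_top[symmetric] ennreal_add_eq_top)
      then have iU: "integrable lborel (indicator U :: real \<Rightarrow> real)"
        by (intro integrable_real_indicator) auto
      have "(LINT x|lborel. \<bar>indicator A x - indicator U x :: real\<bar>) = (LINT x|lborel. indicator (U - A) x)"
        using U(2) by (intro Bochner_Integration.integral_cong) (auto simp: indicator_def)
      also have "\<dots> = measure lborel (U - A)" by simp
      also have "\<dots> < e"
        using U(3) \<open>e > 0\<close> by (cases "emeasure lborel (U - A)") (auto simp: measure_def ennreal_less_iff)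
      finally show "\<exists>g'. integrable lborel g' \<and> (LINT x|lborel. \<bar>indicator A x - g' x\<bar>) < e
        \<and> (\<lambda>n. LINT x|lborel. \<bar>g' (x + s n) - g' x\<bar>) \<longlonglongrightarrow> 0"
        using iU translation_indicator_open[OF U(1) fU assms(2)] by blast
    qed
    from tendsto_mult_right[OF this, of "\<bar>c\<bar>"] show ?case
      by (simp flip: left_diff_distrib add: abs_mult)
  next
    case (add f g)
    note [simp] = add(1,2) shi[OF add(1)] shi[OF add(2)]
    show ?case
    proof (rule Lim_null_comparison)
      show "\<forall>\<^sub>F n in sequentially. norm (LINT x|lborel. \<bar>f (x + s n) + g (x + s n) - (f x + g x)\<bar>)
        \<le> (LINT x|lborel. \<bar>f (x + s n) - f x\<bar>) + (LINT x|lborel. \<bar>g (x + s n) - g x\<bar>)"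
      proof (rule always_eventually, rule allI)
        fix n
        have "(LINT x|lborel. \<bar>f (x + s n) + g (x + s n) - (f x + g x)\<bar>)
          \<le> (LINT x|lborel. \<bar>f (x + s n) - f x\<bar> + \<bar>g (x + s n) - g x\<bar>)"
          by (intro integral_mono) auto
        also have "\<dots> = (LINT x|lborel. \<bar>f (x + s n) - f x\<bar>) + (LINT x|lborel. \<bar>g (x + s n) - g x\<bar>)"
          by simp
        finally show "norm (LINT x|lborel. \<bar>f (x + s n) + g (x + s n) - (f x + g x)\<bar>)
          \<le> (LINT x|lborel. \<bar>f (x + s n) - f x\<bar>) + (LINT x|lborel. \<bar>g (x + s n) - g x\<bar>)" by simp
      qed
      show "(\<lambda>n. (LINT x|lborel. \<bar>f (x + s n) - f x\<bar>) + (LINT x|lborel. \<bar>g (x + s n) - g x\<bar>)) \<longlonglongrightarrow> 0"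
        using tendsto_add[OF add(3,4)] by simp
    qed
  next
    case (lim f q)
    show ?case
    proof (rule approx[OF lim(4)])
      fix e :: real assume e: "e > 0"
      note [measurable] = borel_measurable_integrable[OF lim(4)] borel_measurable_integrable[OF lim(1)]
      have "(\<lambda>i. LINT x|lborel. \<bar>f x - q i x\<bar>) \<longlonglongrightarrow> (LINT x::real|lborel. 0)"
      proof (rule integral_dominated_convergence[where w = "\<lambda>x. 3 * norm (f x)"])
        show "AE x in lborel. (\<lambda>i. \<bar>f x - q i x\<bar>) \<longlonglongrightarrow> 0"
        proof (rule AE_I2)
          fix x :: real
          have "(\<lambda>i. q i x) \<longlonglongrightarrow> f x" using lim(2)[of x] by simp
          then have "(\<lambda>i. \<bar>f x - q i x\<bar>) \<longlonglongrightarrow> \<bar>f x - f x\<bar>" by (intro tendsto_intros)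
          then show "(\<lambda>i. \<bar>f x - q i x\<bar>) \<longlonglongrightarrow> 0" by simp
        qed
        show "AE x in lborel. norm \<bar>f x - q i x\<bar> \<le> 3 * norm (f x)" for i
        proof (rule AE_I2)
          fix x :: real
          show "norm \<bar>f x - q i x\<bar> \<le> 3 * norm (f x)" using lim(3)[of x i] by simp
        qed
      qed (use lim in auto)
      then obtain i where "(LINT x|lborel. \<bar>f x - q i x\<bar>) < e"
        using LIMSEQ_D[of _ 0 e] e by fastforce
      then show "\<exists>g'. integrable lborel g' \<and> (LINT x|lborel. \<bar>f x - g' x\<bar>) < e
        \<and> (\<lambda>n. LINT x|lborel. \<bar>g' (x + s n) - g' x\<bar>) \<longlonglongrightarrow> 0"
        using lim(1,5) by blast
    qed
  qed
qed

text \<open>For nonnegative p and q one has (p - q)^2 \<le> |p^2 - q^2|, so the L^1 statement for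
  f^2 gives the L^2 statement for f.\<close>

lemma translation_L2_nonneg:
  assumes "sqint f" "\<And>x. f x \<ge> 0"
  shows "L2lim (\<lambda>h x. f (x + h)) f (at 0)"
  unfolding L2lim_def
proof (intro conjI allI)
  show "((\<lambda>h. nrm (\<lambda>x. f (x + h) - f x)) \<longlongrightarrow> 0) (at 0)"
    unfolding tendsto_at_iff_sequentially comp_def
  proof (intro allI impI)
    fix s :: "nat \<Rightarrow> real" assume s: "s \<longlonglongrightarrow> 0"
    have "(\<lambda>n. sqrt (LINT x|lborel. \<bar>(f (x + s n))\<^sup>2 - (f x)\<^sup>2\<bar>)) \<longlonglongrightarrow> sqrt 0"
      by (intro tendsto_real_sqrt translation_L1[of "\<lambda>x. (f x)\<^sup>2"] s sqintD assms)
    then have *: "(\<lambda>n. sqrt (LINT x|lborel. \<bar>(f (x + s n))\<^sup>2 - (f x)\<^sup>2\<bar>)) \<longlonglongrightarrow> 0" by simp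
    show "(\<lambda>n. nrm (\<lambda>x. f (x + s n) - f x)) \<longlonglongrightarrow> 0"
    proof (rule Lim_null_comparison[OF _ *], rule always_eventually, rule allI)
      fix n
      have "(LINT x|lborel. (f (x + s n) - f x)\<^sup>2) \<le> (LINT x|lborel. \<bar>(f (x + s n))\<^sup>2 - (f x)\<^sup>2\<bar>)"
      proof (rule integral_mono)
        show "integrable lborel (\<lambda>x. (f (x + s n) - f x)\<^sup>2)"
          by (intro sqintD sqint_diff sqint_shift assms)
        show "integrable lborel (\<lambda>x. \<bar>(f (x + s n))\<^sup>2 - (f x)\<^sup>2\<bar>)"
          using sqintD(2)[OF sqint_shift[OF assms(1)]] sqintD(2)[OF assms(1)] by auto
        fix x :: real
        have "(f (x + s n) - f x)\<^sup>2 = \<bar>f (x + s n) - f x\<bar> * \<bar>f (x + s n) - f x\<bar>"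
          by (simp add: power2_eq_square)
        also have "\<dots> \<le> \<bar>f (x + s n) - f x\<bar> * \<bar>f (x + s n) + f x\<bar>"
          using assms(2)[of x] assms(2)[of "x + s n"] by (intro mult_left_mono) auto
        also have "\<dots> = \<bar>(f (x + s n))\<^sup>2 - (f x)\<^sup>2\<bar>"
          unfolding abs_mult[symmetric] by (simp add: power2_eq_square algebra_simps)
        finally show "(f (x + s n) - f x)\<^sup>2 \<le> \<bar>(f (x + s n))\<^sup>2 - (f x)\<^sup>2\<bar>" .
      qed
      then show "norm (nrm (\<lambda>x. f (x + s n) - f x)) \<le> sqrt (LINT x|lborel. \<bar>(f (x + s n))\<^sup>2 - (f x)\<^sup>2\<bar>)"
        by (simp add: nrm_def)
    qed
  qed
qed (use assms in auto)

lemma translation_L2: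
  assumes "sqint f"
  shows "L2lim (\<lambda>h x. f (x + h)) f (at 0)"
proof -
  have [measurable]: "f \<in> borel_measurable borel" using assms by (rule sqintD)
  have "L2lim (\<lambda>h x. max 0 (f (x + h))) (\<lambda>x. max 0 (f x)) (at 0)"
    by (rule translation_L2_nonneg[of "\<lambda>x. max 0 (f x)"], rule sqint_bound[OF assms]) auto
  moreover have "L2lim (\<lambda>h x. max 0 (- f (x + h))) (\<lambda>x. max 0 (- f x)) (at 0)"
    by (rule translation_L2_nonneg[of "\<lambda>x. max 0 (- f x)"], rule sqint_bound[OF assms]) auto
  ultimately have "L2lim (\<lambda>h x. max 0 (f (x + h)) - max 0 (- f (x + h))) (\<lambda>x. max 0 (f x) - max 0 (- f x)) (at 0)"
    by (rule L2lim_diff)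
  moreover have "max 0 y - max 0 (- y) = y" for y :: real by auto
  ultimately show ?thesis by simp
qed

text \<open>Differentiability of the curve of translates, that is, membership of \<open>f\<close> in
  the domain of the generator of the translation group on L^2. In this form the rules for curves
  become rules for spatial derivatives.\<close>

definition L2_deriv :: "(real \<Rightarrow> real) \<Rightarrow> (real \<Rightarrow> real) \<Rightarrow> bool" where
  "L2_deriv f g \<longleftrightarrow> mean_deriv (\<lambda>s x. f (x + s)) g 0"

text \<open>Bounded uniformly continuous functions: sup norm continuity of the translates at 0 is
  uniform continuity of \<open>f\<close>.\<close>

definition BUC :: "(real \<Rightarrow> real) \<Rightarrow> bool" where
  "BUC f \<longleftrightarrow> bdd_cont (\<lambda>s x. f (x + s)) 0"

lemma L2_derivD:
  assumes "L2_deriv f g"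
  shows "sqint f" "sqint g" "L2lim (\<lambda>h x. (f (x + h) - f x) / h) g (at 0)"
  using mean_derivD(1)[OF assms[unfolded L2_deriv_def], of 0] mean_derivD[OF assms[unfolded L2_deriv_def]] by simp_all

lemma L2_deriv_add [intro]: "L2_deriv f f' \<Longrightarrow> L2_deriv g g' \<Longrightarrow> L2_deriv (\<lambda>x. f x + g x) (\<lambda>x. f' x + g' x)"
  and L2_deriv_diff [intro]: "L2_deriv f f' \<Longrightarrow> L2_deriv g g' \<Longrightarrow> L2_deriv (\<lambda>x. f x - g x) (\<lambda>x. f' x - g' x)"
  and L2_deriv_cmult [intro]: "L2_deriv f f' \<Longrightarrow> L2_deriv (\<lambda>x. c * f x) (\<lambda>x. c * f' x)"
  and L2_deriv_minus [intro]: "L2_deriv f f' \<Longrightarrow> L2_deriv (\<lambda>x. - f x) (\<lambda>x. - f' x)"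
  unfolding L2_deriv_def by auto

lemma L2_deriv_divide [intro]: "L2_deriv f f' \<Longrightarrow> L2_deriv (\<lambda>x. f x / c) (\<lambda>x. f' x / c)"
  using L2_deriv_cmult[of f f' "1 / c"] by simp

lemma BUC_add [intro]: "BUC f \<Longrightarrow> BUC g \<Longrightarrow> BUC (\<lambda>x. f x + g x)"
  and BUC_diff [intro]: "BUC f \<Longrightarrow> BUC g \<Longrightarrow> BUC (\<lambda>x. f x - g x)"
  and BUC_mult [intro]: "BUC f \<Longrightarrow> BUC g \<Longrightarrow> BUC (\<lambda>x. f x * g x)"
  and BUC_cmult [intro]: "BUC f \<Longrightarrow> BUC (\<lambda>x. c * f x)"
  and BUC_minus [intro]: "BUC f \<Longrightarrow> BUC (\<lambda>x. - f x)"
  unfolding BUC_def by auto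

lemma L2_deriv_mult:
  assumes "L2_deriv f f'" "BUC f" "L2_deriv g g'" "BUC g"
  shows "L2_deriv (\<lambda>x. f x * g x) (\<lambda>x. f' x * g x + f x * g' x)"
  using mean_deriv_mult[OF assms[unfolded L2_deriv_def BUC_def]] by (simp add: L2_deriv_def)

lemma L2_deriv_mean_deriv:
  assumes "L2_deriv f g"
  shows "mean_deriv (\<lambda>s x. f (x + s)) (\<lambda>x. g (x + t)) t"
proof -
  have "L2lim (\<lambda>h x. (f (x + (t + h)) - f (x + t)) / h) (\<lambda>x. g (x + t)) (at 0)"
    using L2lim_shift[OF L2_derivD(3)[OF assms], of t] by (simp add: add.assoc)
  then show ?thesis using L2_derivD[OF assms] by (auto simp: mean_deriv_def)
qed

lemma L2_deriv_shift:
  assumes "L2_deriv f g"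
  shows "L2_deriv (\<lambda>x. f (x + k)) (\<lambda>x. g (x + k))"
proof -
  have "L2lim (\<lambda>h x. (f (x + k + h) - f (x + k)) / h) (\<lambda>x. g (x + k)) (at 0)"
    by (rule L2lim_shift[OF L2_derivD(3)[OF assms]])
  moreover have "sqint (\<lambda>x. f (x + s + k))" for s
    using sqint_shift[OF L2_derivD(1)[OF assms], of "s + k"] by (simp add: add.assoc)
  ultimately show ?thesis
    unfolding L2_deriv_def mean_deriv_def by (simp add: algebra_simps)
qed

text \<open>Let p be the increment itself. The scalar function of s given by the integral of f (x +
  s) p(x) has derivative at most \<open>nrm g * nrm p\<close> in modulus, and over [0, k] it grows
  by the square of \<open>nrm p\<close>. Pairing with p thus replaces a mean value theorem for
  L^2-valued curves.\<close>

lemma nrm_increment_le: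
  assumes "L2_deriv f g"
  shows "nrm (\<lambda>x. f (x + k) - f x) \<le> \<bar>k\<bar> * nrm g"
proof (cases "k = 0")
  case False
  note a = L2_derivD[OF assms]
  define p where "p = (\<lambda>x. f (x + k) - f x)"
  have p: "sqint p" unfolding p_def by (intro sqint_diff sqint_shift a)
  define \<phi> where "\<phi> s = (LINT x|lborel. f (x + s) * p x)" for s
  have Lp: "mean_deriv (\<lambda>s. p) (\<lambda>x. 0) s" for s
    using p by (auto simp: mean_deriv_def)
  have d: "(\<phi> has_real_derivative (LINT x|lborel. g (x + s) * p x)) (at s)" for s
    using mean_deriv_integral_mult[OF L2_deriv_mean_deriv[OF assms] Lp, of s] by (simp add: \<phi>_def[abs_def])
  have bd: "\<bar>LINT x|lborel. g (x + s) * p x\<bar> \<le> nrm g * nrm p" for s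
    using Cauchy_Schwarz_sqint[OF sqint_shift[OF a(2)] p] by simp
  have "\<bar>\<phi> k - \<phi> 0\<bar> \<le> (nrm g * nrm p) * \<bar>k - 0\<bar>"
    using field_differentiable_bound[of UNIV \<phi> "\<lambda>s. LINT x|lborel. g (x + s) * p x" "nrm g * nrm p" k 0] d bd
    by simp
  moreover have "\<phi> k - \<phi> 0 = (LINT x|lborel. f (x + k) * p x - f (x + 0) * p x)"
    unfolding \<phi>_def
    by (intro Bochner_Integration.integral_diff[symmetric] integrable_mult_sqint sqint_shift a p)
  moreover have "\<dots> = (LINT x|lborel. p x * p x)"
    by (intro Bochner_Integration.integral_cong) (auto simp: p_def algebra_simps)
  ultimately have "nrm p * nrm p \<le> (\<bar>k\<bar> * nrm g) * nrm p"
    by (simp add: integral_power2_eq power2_eq_square ac_simps)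
  then have "nrm p \<le> \<bar>k\<bar> * nrm g"
    using nrm_nonneg[of p] by (cases "nrm p = 0") (auto simp: mult_le_cancel_right)
  then show ?thesis by (simp add: p_def)
qed simp

text \<open>The integral of f (x + s) g (x + s) does not depend on s, so its derivative at s = 0,
  given by the product rule, vanishes.\<close>

lemma L2_deriv_integral_by_parts:
  assumes "L2_deriv f f'" "L2_deriv g g'"
  shows "(LINT x|lborel. f' x * g x + f x * g' x) = 0"
proof -
  have "((\<lambda>s. LINT x|lborel. f (x + s) * g (x + s)) has_real_derivative
     (LINT x|lborel. f' x * g (x + 0) + f (x + 0) * g' x)) (at 0)"
    by (rule mean_deriv_integral_mult[OF assms[unfolded L2_deriv_def]])
  moreover have "(LINT x|lborel. f (x + s) * g (x + s)) = (LINT x|lborel. f x * g x)" for s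
    by (rule integral_shift[of "\<lambda>x. f x * g x"])
  ultimately have "((\<lambda>s::real. LINT x|lborel. f x * g x) has_real_derivative
     (LINT x|lborel. f' x * g x + f x * g' x)) (at 0)" by simp
  from DERIV_unique[OF this DERIV_const] show ?thesis by simp
qed

text \<open>The spatial derivative is a closed operator: it commutes with the time derivative in the mean
  as soon as the spatial derivative of the latter is continuous.  The estimate pairs the spatial
  difference quotient with itself and uses the scalar mean value theorem in time.\<close>

lemma mean_deriv_L2_deriv_commute:
  assumes mean_deriv: "\<And>s. mean_deriv f (G s) s"
    and f: "\<And>s. L2_deriv (f s) (fx s)"
    and G: "\<And>s. L2_deriv (G s) (Gx s)"
    and cont: "L2lim (\<lambda>h. Gx (t + h)) (Gx t) (at 0)"
  shows "mean_deriv fx (Gx t) t"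
proof -
  note af = L2_derivD[OF f] and aG = L2_derivD[OF G]
  have key: "nrm (\<lambda>x. (fx (t + h) x - fx t x) / h - Gx t x) \<le> e"
    if h: "h \<noteq> 0" and e: "\<And>s. \<bar>s\<bar> \<le> \<bar>h\<bar> \<Longrightarrow> nrm (\<lambda>x. Gx (t + s) x - Gx t x) \<le> e" for h e
  proof -
    define q where "q = (\<lambda>x. (f (t + h) x - f t x) / h - G t x)"
    define qx where "qx = (\<lambda>x. (fx (t + h) x - fx t x) / h - Gx t x)"
    have q: "L2_deriv q qx" unfolding q_def qx_def by (intro L2_deriv_diff L2_deriv_divide f G)
    have bound: "nrm (\<lambda>x. q (x + k) - q x) \<le> \<bar>k\<bar> * e" for k
    proof -
      define p where "p = (\<lambda>x. q (x + k) - q x)"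
      have p: "sqint p" unfolding p_def by (intro sqint_diff sqint_shift L2_derivD[OF q])
      have Lp: "mean_deriv (\<lambda>s. p) (\<lambda>x. 0) s" for s
        using p by (auto simp: mean_deriv_def)
      define D where "D = (\<lambda>s x. f s (x + k) - f s x)"
      define D' where "D' = (\<lambda>s x. G s (x + k) - G s x)"
      have LD: "mean_deriv D (D' s) s" for s
      proof -
        have "mean_deriv (\<lambda>s x. f s (x + k)) (\<lambda>x. G s (x + k)) s"
          using L2lim_shift[OF mean_derivD(3)[OF mean_deriv[of s]], of k] af(1) by (auto simp: mean_deriv_def)
        then show ?thesis unfolding D_def D'_def by (intro mean_deriv_diff mean_deriv)
      qed
      \<comment> \<open>Subtracting the linear term makes the increment of \<open>\<phi>\<close>
        over [0, h] equal to h times the square of \<open>nrm p\<close>, while its derivative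
        involves only the change of \<open>D'\<close> between the times t and t + s.\<close>
      define \<phi> where "\<phi> s = (LINT x|lborel. D (t + s) x * p x) - s * (LINT x|lborel. D' t x * p x)" for s
      have sD': "sqint (D' s)" for s unfolding D'_def by (intro sqint_diff sqint_shift aG)
      have sD: "sqint (D s)" for s unfolding D_def by (intro sqint_diff sqint_shift af)
      have d0: "((\<lambda>s. LINT x|lborel. D (t + s) x * p x) has_real_derivative (LINT x|lborel. D' (t + s) x * p x)) (at s)" for s
      proof -
        have "((\<lambda>s. LINT x|lborel. D s x * p x) has_real_derivative (LINT x|lborel. D' (t + s) x * p x)) (at (s + t))"
          using mean_deriv_integral_mult[OF LD Lp, of "t + s"] by (simp add: add.commute)
        then show ?thesis
          unfolding DERIV_shift by (simp add: add.commute)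
      qed
      have d: "(\<phi> has_real_derivative (LINT x|lborel. D' (t + s) x * p x) - (LINT x|lborel. D' t x * p x)) (at s)" for s
        unfolding \<phi>_def[abs_def] by (rule derivative_eq_intros d0 refl)+ simp
      have bd: "\<bar>(LINT x|lborel. D' (t + s) x * p x) - (LINT x|lborel. D' t x * p x)\<bar> \<le> \<bar>k\<bar> * e * nrm p"
        if "\<bar>s\<bar> \<le> \<bar>h\<bar>" for s
      proof -
        have "(LINT x|lborel. D' (t + s) x * p x) - (LINT x|lborel. D' t x * p x)
          = (LINT x|lborel. D' (t + s) x * p x - D' t x * p x)"
          by (intro Bochner_Integration.integral_diff[symmetric] integrable_mult_sqint p sD')
        also have "\<dots> = (LINT x|lborel. (D' (t + s) x - D' t x) * p x)"
          by (intro Bochner_Integration.integral_cong) (auto simp: algebra_simps)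
        finally have "\<bar>(LINT x|lborel. D' (t + s) x * p x) - (LINT x|lborel. D' t x * p x)\<bar>
           \<le> nrm (\<lambda>x. D' (t + s) x - D' t x) * nrm p"
          using Cauchy_Schwarz_sqint[OF sqint_diff[OF sD' sD'] p] by simp
        \<comment> \<open>A spatial increment is bounded by |k| times the norm of the spatial
          derivative; this is where the continuity of \<open>Gx\<close> in time enters.\<close>
        also have "nrm (\<lambda>x. D' (t + s) x - D' t x) \<le> \<bar>k\<bar> * nrm (\<lambda>x. Gx (t + s) x - Gx t x)"
          using nrm_increment_le[OF L2_deriv_diff[OF G[of "t + s"] G[of t]], of k]
          by (simp add: D'_def algebra_simps)
        also have "\<dots> \<le> \<bar>k\<bar> * e" using e[OF that] by (intro mult_left_mono) auto
        finally show ?thesis by (simp add: mult_right_mono)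
      qed
      have "norm (\<phi> h - \<phi> 0) \<le> (\<bar>k\<bar> * e * nrm p) * norm (h - 0)"
      proof (rule field_differentiable_bound[OF _ has_field_derivative_at_within[OF d]])
        show "norm ((LINT x|lborel. D' (t + s) x * p x) - (LINT x|lborel. D' t x * p x)) \<le> \<bar>k\<bar> * e * nrm p"
          if "s \<in> {-\<bar>h\<bar>..\<bar>h\<bar>}" for s
          using bd[of s] that by (simp add: abs_le_iff)
      qed auto
      moreover have "\<phi> h - \<phi> 0 = h * (LINT x|lborel. p x * p x)"
      proof -
        have "(LINT x|lborel. p x * p x)
            = (LINT x|lborel. (D (t + h) x * p x - D t x * p x) / h - D' t x * p x)"
        proof (intro Bochner_Integration.integral_cong refl)
          fix x
          have "p x = (D (t + h) x - D t x) / h - D' t x"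
            by (simp add: p_def q_def D_def D'_def diff_divide_distrib add_divide_distrib)
          then have "p x * p x = ((D (t + h) x - D t x) / h - D' t x) * p x" by simp
          then show "p x * p x = (D (t + h) x * p x - D t x * p x) / h - D' t x * p x"
            by (simp add: left_diff_distrib)
        qed
        also have "\<dots> = ((LINT x|lborel. D (t + h) x * p x) - (LINT x|lborel. D t x * p x)) / h
            - (LINT x|lborel. D' t x * p x)"
          using integrable_mult_sqint[OF sD p] integrable_mult_sqint[OF sD' p] by simp
        finally show ?thesis using h by (simp add: \<phi>_def field_simps)
      qed
      ultimately have "\<bar>h\<bar> * (nrm p * nrm p) \<le> \<bar>h\<bar> * (\<bar>k\<bar> * e * nrm p)"
        by (simp add: integral_power2_eq power2_eq_square ac_simps abs_mult)
      then have "nrm p * nrm p \<le> (\<bar>k\<bar> * e) * nrm p" using h by simp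
      moreover have "0 \<le> e" using e[of 0] nrm_nonneg order_trans by fastforce
      ultimately have "nrm p \<le> \<bar>k\<bar> * e"
        using nrm_nonneg[of p] by (cases "nrm p = 0") (auto simp: mult_le_cancel_right)
      then show ?thesis by (simp add: p_def)
    qed
    \<comment> \<open>The bound |k| e holds for all k; dividing by k and letting k tend to 0
      replaces increments of q by its derivative \<open>qx\<close>.\<close>
    have "nrm qx \<le> e"
    proof (rule tendsto_upperbound[OF L2lim_nrm[OF L2_derivD(3)[OF q]]])
      have "nrm (\<lambda>x. (q (x + k) - q x) / k) \<le> e" if "k \<noteq> 0" for k
        using bound[of k] that by (simp add: nrm_divide pos_divide_le_eq mult.commute)
      then show "\<forall>\<^sub>F k in at 0. nrm (\<lambda>x. (q (x + k) - q x) / k) \<le> e"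
        by (auto simp: eventually_at_filter)
    qed simp
    then show ?thesis by (simp add: qx_def)
  qed
  have "((\<lambda>h. nrm (\<lambda>x. (fx (t + h) x - fx t x) / h - Gx t x)) \<longlongrightarrow> 0) (at 0)"
  proof (rule tendstoI)
    fix e :: real assume e: "e > 0"
    from tendstoD[OF L2limD(3)[OF cont], of "e/2"] e
    obtain d where d: "d > 0" "\<And>s. s \<noteq> 0 \<Longrightarrow> \<bar>s\<bar> < d \<Longrightarrow> nrm (\<lambda>x. Gx (t + s) x - Gx t x) < e / 2"
      by (auto simp: eventually_at)
    have d': "nrm (\<lambda>x. Gx (t + s) x - Gx t x) \<le> e / 2" if "\<bar>s\<bar> < d" for s
      using d(2)[of s] that e by (cases "s = 0") auto
    have "nrm (\<lambda>x. (fx (t + h) x - fx t x) / h - Gx t x) \<le> e / 2" if "h \<noteq> 0" "\<bar>h\<bar> < d" for h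
      by (rule key) (use that d' in auto)
    then have "nrm (\<lambda>x. (fx (t + h) x - fx t x) / h - Gx t x) < e" if "h \<noteq> 0" "\<bar>h\<bar> < d" for h
      using that e by fastforce
    then show "\<forall>\<^sub>F h in at 0. dist (nrm (\<lambda>x. (fx (t + h) x - fx t x) / h - Gx t x)) 0 < e"
      using d(1) by (auto simp: eventually_at)
  qed
  moreover have "sqint (\<lambda>x. (fx (t + h) x - fx t x) / h)" for h by (intro sqint_divide sqint_diff af)
  ultimately show ?thesis
    using af aG by (auto simp: mean_deriv_def L2lim_def)
qed

subsection \<open>Moving frames\<close>

text \<open>The shift is anchored at t, where it is the identity, so derivatives taken at the anchor
  appear without translation. The values 1 and -1 of \<open>\<sigma>\<close> give the two families
  of characteristics of the system.\<close>

definition frame :: "real \<Rightarrow> real \<Rightarrow> (real \<Rightarrow> real \<Rightarrow> real) \<Rightarrow> real \<Rightarrow> real \<Rightarrow> real" where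
  "frame \<sigma> t f s x = f s (x + \<sigma> * (s - t))"

lemma frame_self [simp]: "frame \<sigma> t f t = f t"
  by (auto simp: frame_def)

lemma tendsto_scaled_at_0: "\<sigma> \<noteq> 0 \<Longrightarrow> filterlim (\<lambda>h. \<sigma> * h) (at 0) (at (0::real))"
  unfolding filterlim_at by (auto intro!: tendsto_eq_intros simp: eventually_at_filter)

text \<open>Translation is an isometry, so the change in time is unaffected by the shift; what
  remains is continuity of translations on the single function \<open>f t\<close>.\<close>

lemma L2lim_frame:
  assumes "L2lim (\<lambda>h. f (t + h)) (f t) (at 0)" "\<sigma> \<noteq> 0"
  shows "L2lim (\<lambda>h. frame \<sigma> t f (t + h)) (f t) (at 0)"
proof (rule L2limI_le)
  note a = L2limD[OF assms(1)]
  have sq: "sqint (f s)" for s using a(1)[of "s - t"] by simp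
  have tr: "((\<lambda>h. nrm (\<lambda>x. f t (x + \<sigma> * h) - f t x)) \<longlongrightarrow> 0) (at 0)"
    using filterlim_compose[OF L2limD(3)[OF translation_L2[OF a(2)]] tendsto_scaled_at_0[OF assms(2)]] .
  show "((\<lambda>h. nrm (\<lambda>x. f (t + h) x - f t x) + nrm (\<lambda>x. f t (x + \<sigma> * h) - f t x)) \<longlongrightarrow> 0) (at 0)"
    using tendsto_add[OF a(3) tr] by simp
  show "sqint (frame \<sigma> t f (t + h))" for h
    unfolding frame_def[abs_def] using sq by blast
  show "sqint (f t)" by (rule a)
  show "\<forall>\<^sub>F h in at 0. nrm (\<lambda>x. frame \<sigma> t f (t + h) x - f t x)
        \<le> nrm (\<lambda>x. f (t + h) x - f t x) + nrm (\<lambda>x. f t (x + \<sigma> * h) - f t x)"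
  proof (rule always_eventually, rule allI)
    fix h
    have "nrm (\<lambda>x. (f (t + h) (x + \<sigma> * h) - f t (x + \<sigma> * h)) + (f t (x + \<sigma> * h) - f t x))
      \<le> nrm (\<lambda>x. f (t + h) (x + \<sigma> * h) - f t (x + \<sigma> * h)) + nrm (\<lambda>x. f t (x + \<sigma> * h) - f t x)"
      by (intro nrm_add_le sqint_diff sqint_shift sq)
    then show "nrm (\<lambda>x. frame \<sigma> t f (t + h) x - f t x)
        \<le> nrm (\<lambda>x. f (t + h) x - f t x) + nrm (\<lambda>x. f t (x + \<sigma> * h) - f t x)"
      using nrm_shift[of "\<lambda>x. f (t + h) x - f t x" "\<sigma> * h"] by (simp add: frame_def)
  qed
qed

lemma bdd_cont_frame:
  assumes "bdd_cont f t" "BUC (f t)" "\<sigma> \<noteq> 0"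
  shows "bdd_cont (frame \<sigma> t f) t"
  unfolding bdd_cont_def
proof (intro conjI allI)
  note a = bdd_contD[OF assms(1)]
  fix s
  show "frame \<sigma> t f s \<in> borel_measurable borel"
    unfolding frame_def[abs_def] using a(1)[of s] by simp
  show "bounded (range (frame \<sigma> t f s))"
    by (rule bounded_subset[OF a(2)[of s]]) (auto simp: frame_def)
next
  have u: "uniform_limit UNIV (\<lambda>h x. f t (x + h)) (f t) (at 0)"
    using bdd_contD(3)[OF assms(2)[unfolded BUC_def]] by simp
  have us: "uniform_limit UNIV (\<lambda>h x. f t (x + \<sigma> * h)) (f t) (at 0)"
    using filterlim_compose[OF u tendsto_scaled_at_0[OF assms(3)]] .
  have "uniform_limit UNIV (\<lambda>h x. f (t + h) (x + \<sigma> * h)) (f t) (at 0)"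
  proof (rule uniform_limitI)
    fix e :: real assume "e > 0"
    then have "\<forall>\<^sub>F h in at 0. \<forall>x\<in>UNIV. dist (f (t + h) x) (f t x) < e / 2"
      "\<forall>\<^sub>F h in at 0. \<forall>x\<in>UNIV. dist (f t (x + \<sigma> * h)) (f t x) < e / 2"
      using uniform_limitD[OF bdd_contD(3)[OF assms(1)], of "e/2"] uniform_limitD[OF us, of "e/2"] by auto
    then show "\<forall>\<^sub>F h in at 0. \<forall>x\<in>UNIV. dist (f (t + h) (x + \<sigma> * h)) (f t x) < e"
      by eventually_elim (metis UNIV_I dist_triangle_half_r dist_commute)
  qed
  then show "uniform_limit UNIV (\<lambda>h. frame \<sigma> t f (t + h)) (frame \<sigma> t f t) (at 0)"
    by (simp add: frame_def[abs_def])
qed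

lemma mean_deriv_frame:
  assumes "mean_deriv f f' s" "L2_deriv (f s) fx" "\<sigma> \<noteq> 0"
  shows "mean_deriv (frame \<sigma> t f) (\<lambda>x. f' (x + \<sigma> * (s - t)) + \<sigma> * fx (x + \<sigma> * (s - t))) s"
proof -
  note a = mean_derivD[OF assms(1)] and b = L2_derivD[OF assms(2)]
  \<comment> \<open>The time quotient, completed by the derivative at r = s, is a curve continuous
    at s in L^2; the previous rule for continuous curves then handles this quotient at the shifted
    point.\<close>
  define \<delta> where "\<delta> = (\<lambda>r x. if r = s then f' x else (f r x - f s x) / (r - s))"
  have "L2lim (\<lambda>h. \<delta> (s + h)) (\<delta> s) (at 0)"
  proof (rule L2limI_le)
    show "sqint (\<delta> (s + h))" for h
      by (cases "h = 0") (simp_all add: \<delta>_def[abs_def] a sqint_divide sqint_diff)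
    show "sqint (\<delta> s)" using a by (simp add: \<delta>_def)
    show "\<forall>\<^sub>F h in at 0. nrm (\<lambda>x. \<delta> (s + h) x - \<delta> s x) \<le> nrm (\<lambda>x. (f (s + h) x - f s x) / h - f' x)"
      by (auto simp: eventually_at_filter \<delta>_def)
  qed (rule L2limD(3)[OF a(3)])
  from L2lim_frame[OF this assms(3)]
  have 1: "L2lim (\<lambda>h x. \<delta> (s + h) (x + \<sigma> * h)) f' (at 0)"
    by (simp add: frame_def[abs_def]) (simp add: \<delta>_def cong: if_cong)
  have 2: "L2lim (\<lambda>h x. \<sigma> * ((f s (x + \<sigma> * h) - f s x) / (\<sigma> * h))) (\<lambda>x. \<sigma> * fx x) (at 0)"
  proof (rule L2lim_cmult)
    show "L2lim (\<lambda>h x. (f s (x + \<sigma> * h) - f s x) / (\<sigma> * h)) fx (at 0)"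
      unfolding L2lim_def
    proof (intro conjI allI)
      show "sqint (\<lambda>x. (f s (x + \<sigma> * h) - f s x) / (\<sigma> * h))" for h by (intro sqint_divide sqint_diff sqint_shift b)
      show "((\<lambda>h. nrm (\<lambda>x. (f s (x + \<sigma> * h) - f s x) / (\<sigma> * h) - fx x)) \<longlongrightarrow> 0) (at 0)"
        using filterlim_compose[OF L2limD(3)[OF b(3)] tendsto_scaled_at_0[OF assms(3)]] .
    qed (rule b)
  qed
  have "L2lim (\<lambda>h x. (f (s + h) (x + \<sigma> * h) - f s x) / h) (\<lambda>x. f' x + \<sigma> * fx x) (at 0)"
  proof (rule L2limI_le[OF _ _ L2limD(3)[OF L2lim_add[OF 1 2]]])
    show "sqint (\<lambda>x. (f (s + h) (x + \<sigma> * h) - f s x) / h)" for h by (intro sqint_divide sqint_diff sqint_shift a)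
    show "sqint (\<lambda>x. f' x + \<sigma> * fx x)" by (intro sqint_add sqint_cmult a b)
    show "\<forall>\<^sub>F h in at 0. nrm (\<lambda>x. (f (s + h) (x + \<sigma> * h) - f s x) / h - (f' x + \<sigma> * fx x))
      \<le> nrm (\<lambda>x. \<delta> (s + h) (x + \<sigma> * h) + \<sigma> * ((f s (x + \<sigma> * h) - f s x) / (\<sigma> * h)) - (f' x + \<sigma> * fx x))"
      using assms(3) by (auto simp: eventually_at_filter \<delta>_def add_divide_distrib[symmetric])
  qed
  from L2lim_shift[OF this, of "\<sigma> * (s - t)"]
  have "L2lim (\<lambda>h x. (frame \<sigma> t f (s + h) x - frame \<sigma> t f s x) / h)
     (\<lambda>x. f' (x + \<sigma> * (s - t)) + \<sigma> * fx (x + \<sigma> * (s - t))) (at 0)"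
    by (simp add: frame_def algebra_simps)
  moreover have "sqint (frame \<sigma> t f r)" for r
    unfolding frame_def[abs_def] using a by blast
  ultimately show ?thesis by (simp add: mean_deriv_def)
qed

lemma L2_deriv_frame: "L2_deriv (f s) (fx s) \<Longrightarrow> L2_deriv (frame \<sigma> t f s) (frame \<sigma> t fx s)"
  unfolding frame_def[abs_def] by (rule L2_deriv_shift)

subsection \<open>Primitives of square-integrable functions\<close>

text \<open>Absolute continuity with derivative in L^2: the continuous representative of an H^1
  function. An integral against an indicator makes Cauchy-Schwarz directly applicable to
  increments.\<close>

definition L2_prim :: "(real \<Rightarrow> real) \<Rightarrow> (real \<Rightarrow> real) \<Rightarrow> bool" where
  "L2_prim f g \<longleftrightarrow> sqint f \<and> sqint g \<and>
     (\<forall>x y. x \<le> y \<longrightarrow> f y - f x = (LINT s|lborel. indicator {x..y} s * g s))"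

lemma L2_primD:
  assumes "L2_prim f g"
  shows "sqint f" "sqint g"
    "x \<le> y \<Longrightarrow> f y - f x = (LINT s|lborel. indicator {x..y} s * g s)"
  using assms by (auto simp: L2_prim_def)

lemma integrable_indicator_Icc [simp]: "integrable lborel (indicator {x..y} :: real \<Rightarrow> real)"
  by (intro integrable_real_indicator) (auto simp: emeasure_lborel_Icc_eq)

lemma sqint_indicator [simp]: "sqint (indicator {x..y})"
proof -
  have "(\<lambda>s. (indicator {x..y} s)\<^sup>2 :: real) = indicator {x..y}"
    by (auto simp: indicator_def)
  then show ?thesis by (simp add: sqint_def)
qed

lemma nrm_indicator: "x \<le> y \<Longrightarrow> nrm (indicator {x..y}) = sqrt (y - x)"
proof -
  assume "x \<le> y"
  moreover have "(\<lambda>s. (indicator {x..y} s)\<^sup>2 :: real) = indicator {x..y}"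
    by (auto simp: indicator_def)
  ultimately show ?thesis by (simp add: nrm_def)
qed

lemma L2_prim_diff:
  assumes "L2_prim f f'" "L2_prim g g'"
  shows "L2_prim (\<lambda>x. f x - g x) (\<lambda>x. f' x - g' x)"
proof -
  note a = L2_primD[OF assms(1)] and b = L2_primD[OF assms(2)]
  have "(f y - g y) - (f x - g x) = (LINT s|lborel. indicator {x..y} s * (f' s - g' s))" if "x \<le> y" for x y
  proof -
    have "(f y - g y) - (f x - g x)
       = (LINT s|lborel. indicator {x..y} s * f' s) - (LINT s|lborel. indicator {x..y} s * g' s)"
      using a(3)[OF that] b(3)[OF that] by simp
    also have "\<dots> = (LINT s|lborel. indicator {x..y} s * f' s - indicator {x..y} s * g' s)"
      by (intro Bochner_Integration.integral_diff[symmetric] integrable_mult_sqint a b sqint_indicator)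
    finally show ?thesis by (simp add: right_diff_distrib)
  qed
  then show ?thesis using a b by (auto simp: L2_prim_def)
qed

lemma L2_prim_holder:
  assumes "L2_prim f g"
  shows "\<bar>f y - f x\<bar> \<le> sqrt \<bar>y - x\<bar> * nrm g"
proof -
  have *: "\<bar>f y - f x\<bar> \<le> sqrt (y - x) * nrm g" if "x \<le> y" for x y
    using L2_primD(3)[OF assms that] Cauchy_Schwarz_sqint[OF sqint_indicator[of x y] L2_primD(2)[OF assms]] that
    by (simp add: nrm_indicator)
  show ?thesis
    using *[of x y] *[of y x] by (cases "x \<le> y") (auto simp: abs_minus_commute)
qed

text \<open>Compare f(x) with f(y) for y in [x, x + l], where the Hoelder bound controls the square
  of f(y) - f(x) by l times that of \<open>nrm g\<close>, and average over y. The length l stays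
  free so that it can later be adapted to the two norms.\<close>

lemma L2_prim_sup_bound:
  assumes "L2_prim f g" "l > 0"
  shows "(f x)\<^sup>2 \<le> 2 / l * (nrm f)\<^sup>2 + 2 * l * (nrm g)\<^sup>2"
proof -
  note a = L2_primD[OF assms(1)]
  let ?i = "indicator {x..x+l} :: real \<Rightarrow> real"
  have int1: "integrable lborel (\<lambda>y. ?i y * c)" for c by simp
  have int2: "integrable lborel (\<lambda>y. ?i y * (f y)\<^sup>2)"
    using integrable_mult_indicator[of "{x..x+l}" lborel "\<lambda>y. (f y)\<^sup>2"] sqintD(2)[OF a(1)] by simp
  have pt: "?i y * (f x)\<^sup>2 \<le> 2 * (f y)\<^sup>2 + ?i y * (2 * l * (nrm g)\<^sup>2)" for y
  proof (cases "y \<in> {x..x+l}")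
    case True
    have "\<bar>f y - f x\<bar> \<le> sqrt l * nrm g"
    proof (rule order_trans[OF L2_prim_holder[OF assms(1)]])
      show "sqrt \<bar>y - x\<bar> * nrm g \<le> sqrt l * nrm g"
        using True by (intro mult_right_mono) auto
    qed
    then have "(f y - f x)\<^sup>2 \<le> (sqrt l * nrm g)\<^sup>2"
      using abs_le_square_iff[of "f y - f x" "sqrt l * nrm g"] assms(2) by simp
    then have "(f y - f x)\<^sup>2 \<le> l * (nrm g)\<^sup>2" using assms(2) by (simp add: power_mult_distrib)
    \<comment> \<open>The right side minus the left side is the square of 2 f(y) - f(x).\<close>
    moreover have "(f x)\<^sup>2 \<le> 2 * (f y)\<^sup>2 + 2 * (f y - f x)\<^sup>2"
      using zero_le_power2[of "2 * f y - f x"] by (simp add: power2_eq_square algebra_simps)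
    ultimately show ?thesis using True by simp
  qed simp
  have "l * (f x)\<^sup>2 = (LINT y|lborel. ?i y * (f x)\<^sup>2)" using assms(2) by simp
  also have "\<dots> \<le> (LINT y|lborel. 2 * (f y)\<^sup>2 + ?i y * (2 * l * (nrm g)\<^sup>2))"
    by (rule integral_mono[OF int1 _ pt]) (use sqintD(2)[OF a(1)] in simp)
  also have "\<dots> = 2 * (nrm f)\<^sup>2 + l * (2 * l * (nrm g)\<^sup>2)"
    using sqintD(2)[OF a(1)] assms(2) by (simp add: nrm_sq)
  finally show ?thesis using assms(2) by (simp add: field_simps)
qed

lemma L2_prim_BUC:
  assumes "L2_prim f g"
  shows "BUC f"
  unfolding BUC_def bdd_cont_def
proof (intro conjI allI)
  note a = L2_primD[OF assms]
  fix s
  show "(\<lambda>x. f (x + s)) \<in> borel_measurable borel"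
    using sqintD(1)[OF a(1)] by simp
  have "\<bar>f x\<bar> \<le> sqrt (2 * (nrm f)\<^sup>2 + 2 * (nrm g)\<^sup>2)" for x
    using L2_prim_sup_bound[OF assms, of 1 x] by (intro real_le_rsqrt) simp
  then show "bounded (range (\<lambda>x. f (x + s)))"
    unfolding bounded_iff by auto
next
  have "((\<lambda>h. sqrt \<bar>h\<bar> * nrm g) \<longlongrightarrow> sqrt \<bar>0\<bar> * nrm g) (at 0)"
    by (intro tendsto_intros)
  then have lim: "((\<lambda>h. sqrt \<bar>h\<bar> * nrm g) \<longlongrightarrow> 0) (at 0)" by simp
  show "uniform_limit UNIV (\<lambda>h x. f (x + (0 + h))) (\<lambda>x. f (x + 0)) (at 0)"
  proof (rule uniform_limitI)
    fix e :: real assume "e > 0"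
    then have "\<forall>\<^sub>F h in at 0. sqrt \<bar>h\<bar> * nrm g < e"
      using order_tendstoD(2)[OF lim] by blast
    then show "\<forall>\<^sub>F h in at 0. \<forall>x\<in>UNIV. dist (f (x + (0 + h))) (f (x + 0)) < e"
    proof eventually_elim
      case (elim h)
      then show ?case
        using order.strict_trans1[OF L2_prim_holder[OF assms, of "_ + h" _]] by (auto simp: dist_real_def)
    qed
  qed
qed

text \<open>The substitution s = x + h \<theta> carries both signs of h to the interval [0, 1] and
  exhibits the error of the quotient as an average of translation errors of g.\<close>

lemma L2_prim_average:
  assumes "L2_prim f g" "h \<noteq> 0"
  shows "(f (x + h) - f x) / h - g x = (LINT \<theta>|lborel. indicator {0..1} \<theta> * (g (x + h * \<theta>) - g x))"
proof -
  note a = L2_primD[OF assms(1)]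
  have "f (x + h) - f x = h * (LINT \<theta>|lborel. indicator {0..1} \<theta> * g (x + h * \<theta>))"
  proof (cases "h > 0")
    case True
    have "f (x + h) - f x = (LINT s|lborel. indicator {x..x+h} s * g s)" using a(3)[of x "x + h"] True by simp
    also have "\<dots> = h * (LINT \<theta>|lborel. indicator {x..x+h} (x + h * \<theta>) * g (x + h * \<theta>))"
      using True by (subst lborel_integral_real_affine[of h _ x]) auto
    also have "(LINT \<theta>|lborel. indicator {x..x+h} (x + h * \<theta>) * g (x + h * \<theta>))
       = (LINT \<theta>|lborel. indicator {0..1} \<theta> * g (x + h * \<theta>))"
      using True by (intro Bochner_Integration.integral_cong) (auto simp: indicator_def zero_le_mult_iff)
    finally show ?thesis .
  next
    case False
    then have h: "h < 0" using assms(2) by simp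
    have "f x - f (x + h) = (LINT s|lborel. indicator {x+h..x} s * g s)" using a(3)[of "x + h" x] h by simp
    also have "\<dots> = - h * (LINT \<theta>|lborel. indicator {x+h..x} (x + h * \<theta>) * g (x + h * \<theta>))"
      using h by (subst lborel_integral_real_affine[of h _ x]) auto
    also have "(LINT \<theta>|lborel. indicator {x+h..x} (x + h * \<theta>) * g (x + h * \<theta>))
       = (LINT \<theta>|lborel. indicator {0..1} \<theta> * g (x + h * \<theta>))"
      using h by (intro Bochner_Integration.integral_cong) (auto simp: indicator_def mult_le_0_iff)
    finally show ?thesis by simp
  qed
  moreover have "integrable lborel (\<lambda>\<theta>. indicator {0..1} \<theta> * g (x + h * \<theta>))"
  proof (rule integrable_mult_sqint[OF sqint_indicator])
    show "sqint (\<lambda>\<theta>. g (x + h * \<theta>))"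
      using lborel_integrable_real_affine[OF sqintD(2)[OF a(2)] assms(2), of x] sqintD(1)[OF a(2)]
      by (simp add: sqint_def)
  qed
  ultimately show ?thesis using assms(2) by (simp add: right_diff_distrib)
qed

text \<open>Minkowski's inequality for the average over \<theta>, in the form of pointwise
  Cauchy-Schwarz on [0, 1] followed by an exchange of the order of integration. With nonnegative
  integrals the exchange rests on measurability alone.\<close>

lemma L2_prim_quotient_le:
  assumes "L2_prim f g" "h \<noteq> 0" "\<And>s. \<bar>s\<bar> \<le> \<bar>h\<bar> \<Longrightarrow> nrm (\<lambda>x. g (x + s) - g x) \<le> e"
  shows "nrm (\<lambda>x. (f (x + h) - f x) / h - g x) \<le> e"
proof -
  note a = L2_primD[OF assms(1)]
  note [measurable] = sqintD(1)[OF a(1)] sqintD(1)[OF a(2)]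
  have e: "0 \<le> e" using order_trans[OF nrm_nonneg assms(3)[of 0]] by simp
  let ?i = "indicator {0..1} :: real \<Rightarrow> real"
  let ?r = "\<lambda>x. (f (x + h) - f x) / h - g x"
  have pt: "ennreal ((?r x)\<^sup>2) \<le> (\<integral>\<^sup>+\<theta>. ennreal (?i \<theta> * (g (x + h * \<theta>) - g x)\<^sup>2) \<partial>lborel)" for x
  proof -
    have sq: "sqint (\<lambda>\<theta>. ?i \<theta> * (g (x + h * \<theta>) - g x))"
    proof -
      have "sqint (\<lambda>\<theta>. g (x + h * \<theta>))"
        using lborel_integrable_real_affine[OF sqintD(2)[OF a(2)] assms(2), of x] sqintD(1)[OF a(2)]
        by (simp add: sqint_def)
      then have "sqint (\<lambda>\<theta>. g (x + h * \<theta>) * ?i \<theta> - g x * ?i \<theta>)"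
        by (intro sqint_diff sqint_cmult sqint_indicator sqint_mult_bdd[where B=1]) (auto simp: indicator_def)
      then show ?thesis by (simp add: algebra_simps)
    qed
    have i2: "(?i \<theta> * y)\<^sup>2 = ?i \<theta> * y\<^sup>2" "?i \<theta> * (?i \<theta> * y) = ?i \<theta> * y" for \<theta> y
      by (auto simp: indicator_def)
    have "\<bar>?r x\<bar> = \<bar>LINT \<theta>|lborel. ?i \<theta> * (?i \<theta> * (g (x + h * \<theta>) - g x))\<bar>"
      unfolding L2_prim_average[OF assms(1,2)] i2 ..
    also have "\<dots> \<le> nrm ?i * nrm (\<lambda>\<theta>. ?i \<theta> * (g (x + h * \<theta>) - g x))"
      by (rule Cauchy_Schwarz_sqint[OF sqint_indicator sq])
    finally have "(?r x)\<^sup>2 \<le> (nrm (\<lambda>\<theta>. ?i \<theta> * (g (x + h * \<theta>) - g x)))\<^sup>2"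
      by (subst abs_le_square_iff[symmetric]) (simp add: nrm_indicator)
    also have "\<dots> = (LINT \<theta>|lborel. ?i \<theta> * (g (x + h * \<theta>) - g x)\<^sup>2)"
      by (simp add: nrm_sq i2)
    finally have "ennreal ((?r x)\<^sup>2) \<le> ennreal (LINT \<theta>|lborel. ?i \<theta> * (g (x + h * \<theta>) - g x)\<^sup>2)"
      by (rule ennreal_leI)
    also have "\<dots> = (\<integral>\<^sup>+\<theta>. ennreal (?i \<theta> * (g (x + h * \<theta>) - g x)\<^sup>2) \<partial>lborel)"
      using sqintD(2)[OF sq] by (intro nn_integral_eq_integral[symmetric]) (auto simp: i2)
    finally show ?thesis .
  qed
  have sr: "sqint ?r" by (intro sqint_diff sqint_divide sqint_shift a)
  have "ennreal ((nrm ?r)\<^sup>2) = (\<integral>\<^sup>+x. ennreal ((?r x)\<^sup>2) \<partial>lborel)"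
    unfolding nrm_sq using sqintD(2)[OF sr] by (intro nn_integral_eq_integral[symmetric]) auto
  also have "\<dots> \<le> (\<integral>\<^sup>+x. (\<integral>\<^sup>+\<theta>. ennreal (?i \<theta> * (g (x + h * \<theta>) - g x)\<^sup>2) \<partial>lborel) \<partial>lborel)"
    by (intro nn_integral_mono pt)
  also have "\<dots> = (\<integral>\<^sup>+\<theta>. (\<integral>\<^sup>+x. ennreal (?i \<theta> * (g (x + h * \<theta>) - g x)\<^sup>2) \<partial>lborel) \<partial>lborel)"
    by (rule lborel_pair.Fubini') simp
  also have "\<dots> \<le> (\<integral>\<^sup>+\<theta>. ennreal (e\<^sup>2) * indicator {0..1::real} \<theta> \<partial>lborel)"
  proof (rule nn_integral_mono)
    fix \<theta> :: real
    show "(\<integral>\<^sup>+x. ennreal (?i \<theta> * (g (x + h * \<theta>) - g x)\<^sup>2) \<partial>lborel) \<le> ennreal (e\<^sup>2) * indicator {0..1} \<theta>"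
    proof (cases "\<theta> \<in> {0..1}")
      case True
      have "(\<integral>\<^sup>+x. ennreal ((g (x + h * \<theta>) - g x)\<^sup>2) \<partial>lborel) = ennreal ((nrm (\<lambda>x. g (x + h * \<theta>) - g x))\<^sup>2)"
        unfolding nrm_sq by (intro nn_integral_eq_integral sqintD sqint_diff sqint_shift a) auto
      also have "\<dots> \<le> ennreal (e\<^sup>2)"
      proof (intro ennreal_leI power_mono assms(3))
        show "\<bar>h * \<theta>\<bar> \<le> \<bar>h\<bar>" using True by (simp add: abs_mult mult_left_le)
      qed simp
      finally show ?thesis using True by simp
    qed simp
  qed
  also have "\<dots> = ennreal (e\<^sup>2)" by (simp add: nn_integral_cmult_indicator)
  finally have "(nrm ?r)\<^sup>2 \<le> e\<^sup>2" by simp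
  then show ?thesis using e power2_le_imp_le by blast
qed

lemma L2_prim_L2_deriv:
  assumes "L2_prim f g"
  shows "L2_deriv f g"
proof -
  note a = L2_primD[OF assms]
  have "((\<lambda>h. nrm (\<lambda>x. (f (x + h) - f x) / h - g x)) \<longlongrightarrow> 0) (at 0)"
  proof (rule tendstoI)
    fix e :: real assume e: "e > 0"
    from tendstoD[OF L2limD(3)[OF translation_L2[OF a(2)]], of "e/2"] e
    obtain d where d: "d > 0" "\<And>s. s \<noteq> 0 \<Longrightarrow> \<bar>s\<bar> < d \<Longrightarrow> nrm (\<lambda>x. g (x + s) - g x) < e / 2"
      by (auto simp: eventually_at)
    have d': "nrm (\<lambda>x. g (x + s) - g x) \<le> e / 2" if "\<bar>s\<bar> < d" for s
      using d(2)[of s] that e by (cases "s = 0") auto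
    have "nrm (\<lambda>x. (f (x + h) - f x) / h - g x) \<le> e / 2" if "h \<noteq> 0" "\<bar>h\<bar> < d" for h
      by (rule L2_prim_quotient_le[OF assms]) (use that d' in auto)
    then have "nrm (\<lambda>x. (f (x + h) - f x) / h - g x) < e" if "h \<noteq> 0" "\<bar>h\<bar> < d" for h
      using that e by fastforce
    then show "\<forall>\<^sub>F h in at 0. dist (nrm (\<lambda>x. (f (x + h) - f x) / h - g x)) 0 < e"
      using d(1) by (auto simp: eventually_at)
  qed
  moreover have "sqint (\<lambda>x. (f (x + h) - f x) / h)" for h
    by (intro sqint_divide sqint_diff sqint_shift a)
  moreover have "sqint (\<lambda>x. f (x + h))" for h by (intro sqint_shift a)
  ultimately show ?thesis using a by (simp add: L2_deriv_def mean_deriv_def L2lim_def)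
qed

text \<open>The zero function is a primitive of z, so z is its derivative in the mean: an L^2 limit
  of quotients that all vanish.\<close>

lemma AE_zero_if_interval_integrals_zero:
  assumes "sqint z" "\<And>x y. x \<le> y \<Longrightarrow> (LINT s|lborel. indicator {x..y} s * z s) = 0"
  shows "AE x in lborel. z x = 0"
proof -
  have "L2_prim (\<lambda>x. 0) z" using assms by (auto simp: L2_prim_def)
  from L2_derivD(3)[OF L2_prim_L2_deriv[OF this]] have "L2lim (\<lambda>h x. 0) z (at (0::real))" by simp
  from L2lim_nrm[OF this] have "((\<lambda>h::real. 0) \<longlongrightarrow> nrm z) (at 0)" by simp
  then have "nrm z = 0" using tendsto_unique[OF trivial_limit_at tendsto_const] by metis
  then have "(LINT x|lborel. (z x)\<^sup>2) = 0" by (simp add: nrm_def)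
  then show ?thesis
    using integral_nonneg_eq_0_iff_AE[of lborel "\<lambda>x. (z x)\<^sup>2"] sqintD(2)[OF assms(1)] by simp
qed

subsection \<open>Test functions and weak derivatives\<close>

text \<open>A family closed under differentiation: with z = 1/y the derivative of p(z) exp(-z) is
  z^2 (p(z) - p'(z)) exp(-z), and all derivatives vanish at 0.\<close>

definition flat :: "real poly \<Rightarrow> real \<Rightarrow> real" where
  "flat p y = (if y > 0 then poly p (1 / y) * exp (- (1 / y)) else 0)"

text \<open>Test functions must have every iterated \<open>deriv\<close> differentiable. Closure of
  an inductive class under derivatives gives this by induction, without formulas for the higher
  ones.\<close>

inductive smooth_alg :: "(real \<Rightarrow> real) \<Rightarrow> bool" where
  flat: "smooth_alg (\<lambda>x. flat p (r * x + c))"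
| cmult: "smooth_alg f \<Longrightarrow> smooth_alg (\<lambda>x. k * f x)"
| add: "smooth_alg f \<Longrightarrow> smooth_alg g \<Longrightarrow> smooth_alg (\<lambda>x. f x + g x)"
| mult: "smooth_alg f \<Longrightarrow> smooth_alg g \<Longrightarrow> smooth_alg (\<lambda>x. f x * g x)"

lemma poly_exp_neg_tendsto_0: "((\<lambda>z. poly p z * exp (- z)) \<longlongrightarrow> (0::real)) at_top"
proof -
  have "((\<lambda>z. \<Sum>i\<le>degree p. coeff p i * (z ^ i / exp z)) \<longlongrightarrow> (\<Sum>i\<le>degree p. coeff p i * 0)) at_top"
    by (intro tendsto_sum tendsto_mult tendsto_const tendsto_power_div_exp_0)
  then show ?thesis
    by (simp add: poly_altdef sum_divide_distrib exp_minus divide_inverse sum_distrib_right mult.assoc)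
qed

lemma flat_has_derivative:
  "(flat p has_real_derivative flat ([:0, 0, 1:] * (p - pderiv p)) y) (at y)"
proof -
  consider "y > 0" | "y < 0" | "y = 0" by linarith
  then show ?thesis
  proof cases
    case 1
    have "((\<lambda>y. poly p (1 / y) * exp (- (1 / y))) has_real_derivative
       flat ([:0, 0, 1:] * (p - pderiv p)) y) (at y)"
      using 1 by (auto intro!: derivative_eq_intros simp: flat_def power2_eq_square field_simps)
    moreover have "\<forall>\<^sub>F z in nhds y. flat p z = poly p (1 / z) * exp (- (1 / z))"
      using 1 eventually_nhds_in_open[of "{0<..}" y] by (auto elim!: eventually_mono simp: flat_def)
    ultimately show ?thesis by (subst DERIV_cong_ev[OF refl _ refl]) 
  next
    case 2
    have "\<forall>\<^sub>F z in nhds y. flat p z = 0"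
      using 2 eventually_nhds_in_open[of "{..<0}" y] by (auto elim!: eventually_mono simp: flat_def)
    then show ?thesis using 2 by (subst DERIV_cong_ev[OF refl _ refl]) (auto simp: flat_def)
  next
    case 3
    have "((\<lambda>h. flat p h / h) \<longlongrightarrow> 0) (at_right 0)"
    proof -
      have "((\<lambda>z. poly ([:0, 1:] * p) z * exp (- z)) \<longlongrightarrow> 0) at_top" by (rule poly_exp_neg_tendsto_0)
      from filterlim_compose[OF this filterlim_inverse_at_top_right]
      have "((\<lambda>h. inverse h * poly p (inverse h) * exp (- inverse h)) \<longlongrightarrow> 0) (at_right 0)" by simp
      then show ?thesis
        by (rule Lim_transform_eventually) (auto simp: eventually_at_filter flat_def field_simps)
    qed
    moreover have "((\<lambda>h. flat p h / h) \<longlongrightarrow> 0) (at_left 0)"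
      by (rule tendsto_eventually) (auto simp: eventually_at_filter flat_def)
    ultimately show ?thesis
      using 3 by (simp add: DERIV_def filterlim_at_split flat_def[of _ 0])
  qed
qed

lemma smooth_alg_deriv:
  "smooth_alg f \<Longrightarrow> \<exists>f'. smooth_alg f' \<and> (\<forall>x. (f has_real_derivative f' x) (at x))"
proof (induction rule: smooth_alg.induct)
  case (flat p r c)
  show ?case
  proof (intro exI conjI allI)
    show "smooth_alg (\<lambda>x. r * flat ([:0, 0, 1:] * (p - pderiv p)) (r * x + c))"
      by (intro smooth_alg.intros)
    fix x
    show "((\<lambda>x. flat p (r * x + c)) has_real_derivative r * flat ([:0, 0, 1:] * (p - pderiv p)) (r * x + c)) (at x)"
      by (rule DERIV_chain2[OF flat_has_derivative, THEN DERIV_cong])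
         (auto intro!: derivative_eq_intros)
  qed
next
  case (cmult f k)
  then obtain f' where "smooth_alg f'" "\<And>x. (f has_real_derivative f' x) (at x)" by blast
  then show ?case
    by (intro exI[of _ "\<lambda>x. k * f' x"]) (auto intro!: smooth_alg.intros DERIV_cmult)
next
  case (add f g)
  then obtain f' g' where "smooth_alg f'" "\<And>x. (f has_real_derivative f' x) (at x)"
    "smooth_alg g'" "\<And>x. (g has_real_derivative g' x) (at x)" by blast
  then show ?case
    by (intro exI[of _ "\<lambda>x. f' x + g' x"]) (auto intro!: smooth_alg.intros DERIV_add)
next
  case (mult f g)
  then obtain f' g' where fg: "smooth_alg f'" "\<And>x. (f has_real_derivative f' x) (at x)"
    "smooth_alg g'" "\<And>x. (g has_real_derivative g' x) (at x)" by blast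
  show ?case
  proof (intro exI conjI allI)
    show "smooth_alg (\<lambda>x. f' x * g x + g' x * f x)"
      using fg mult by (intro smooth_alg.intros)
    show "((\<lambda>x. f x * g x) has_real_derivative f' x * g x + g' x * f x) (at x)" for x
      using fg by (intro DERIV_mult) auto
  qed
qed

lemma smooth_alg_continuous: "smooth_alg f \<Longrightarrow> continuous_on A f"
  using smooth_alg_deriv[of f] DERIV_isCont continuous_at_imp_continuous_on by metis

lemma smooth_alg_higher_deriv: "smooth_alg f \<Longrightarrow> smooth_alg ((deriv ^^ n) f)"
proof (induction n)
  case (Suc n)
  then obtain f' where f': "smooth_alg f'" "\<And>x. ((deriv ^^ n) f has_real_derivative f' x) (at x)"
    using smooth_alg_deriv by blast
  then have "deriv ((deriv ^^ n) f) = f'"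
    by (intro ext DERIV_imp_deriv)
  then show ?case using f' by simp
qed simp

text \<open>Only the derivative of \<phi> has to lie in the class: the test functions used below are
  antiderivatives, for which no expression in the class is at hand.\<close>

lemma test_functionI:
  assumes "smooth_alg \<psi>" "\<And>x. (\<phi> has_real_derivative \<psi> x) (at x)"
    and "\<And>x. x \<notin> {a..b} \<Longrightarrow> \<phi> x = 0"
  shows "test_function \<phi>" "deriv \<phi> = \<psi>"
proof -
  show d: "deriv \<phi> = \<psi>" using assms(2) by (intro ext DERIV_imp_deriv)
  have "(deriv ^^ n) \<phi> field_differentiable at x" for n x
  proof (cases n)
    case 0
    then show ?thesis using assms(2) field_differentiable_def by auto
  next
    case (Suc m)
    have "(deriv ^^ n) \<phi> = (deriv ^^ m) \<psi>" using Suc d by (simp add: funpow_swap1)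
    then show ?thesis
      using smooth_alg_deriv[OF smooth_alg_higher_deriv[OF assms(1)], of m] field_differentiable_def by metis
  qed
  moreover have "compact (closure {x. \<phi> x \<noteq> 0})"
  proof -
    have "{x. \<phi> x \<noteq> 0} \<subseteq> {a..b}" using assms(3) by blast
    then have "bounded {x. \<phi> x \<noteq> 0}" using bounded_subset bounded_closed_interval by blast
    then show ?thesis by simp
  qed
  ultimately show "test_function \<phi>" by (simp add: test_function_def)
qed

text \<open>Approximates the indicator of the interval from below as n grows: zero outside, tending
  to 1 in the interior. For n = 0 it vanishes identically.\<close>

definition bump :: "real \<Rightarrow> real \<Rightarrow> nat \<Rightarrow> real \<Rightarrow> real" where
  "bump a b n x = flat 1 (real n * x + (- real n * a)) * flat 1 (- real n * x + real n * b)"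

lemma smooth_bump: "smooth_alg (bump a b n)"
  unfolding bump_def[abs_def] by (intro smooth_alg.intros)

lemma flat_1_bounds: "0 \<le> flat 1 y" "flat 1 y \<le> 1"
  by (auto simp: flat_def)

lemma bump_bounds: "0 \<le> bump a b n x" "bump a b n x \<le> indicator {a..b} x"
proof -
  show "0 \<le> bump a b n x" by (simp add: bump_def flat_1_bounds)
  have 1: "bump a b n x \<le> 1" unfolding bump_def using flat_1_bounds by (intro mult_le_one)
  have "bump a b n x = 0" if "x \<notin> {a..b}"
  proof -
    have "real n * x + (- real n * a) = real n * (x - a)" "- real n * x + real n * b = real n * (b - x)"
      by (auto simp: algebra_simps)
    then show ?thesis
      using that by (auto simp: bump_def flat_def not_le zero_less_mult_iff)
  qed
  with 1 show "bump a b n x \<le> indicator {a..b} x" by (auto simp: indicator_def)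
qed

lemma bump_pos: "a < x \<Longrightarrow> x < b \<Longrightarrow> 0 < n \<Longrightarrow> 0 < bump a b n x"
proof -
  assume "a < x" "x < b" "0 < n"
  then have "0 < real n * (x - a)" "0 < real n * (b - x)" by auto
  then show ?thesis by (auto simp: bump_def flat_def algebra_simps)
qed

lemma bump_tendsto:
  assumes "a < x" "x < b"
  shows "(\<lambda>n. bump a b n x) \<longlonglongrightarrow> 1"
proof -
  have *: "(\<lambda>n. flat 1 (real n * d)) \<longlonglongrightarrow> 1" if "d > 0" for d
  proof -
    have "(\<lambda>n. 1 / (real n * d)) \<longlonglongrightarrow> 0"
      using tendsto_mult_left[OF lim_1_over_n, of "1/d"] by (simp add: mult.commute)
    then have "(\<lambda>n. exp (- (1 / (real n * d)))) \<longlonglongrightarrow> exp (- 0)"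
      by (intro tendsto_intros)
    moreover have "\<forall>\<^sub>F n in sequentially. exp (- (1 / (real n * d))) = flat 1 (real n * d)"
      using eventually_gt_at_top[of 0] by eventually_elim (use that in \<open>auto simp: flat_def\<close>)
    ultimately show ?thesis using Lim_transform_eventually by fastforce
  qed
  have "(\<lambda>n. flat 1 (real n * (x - a)) * flat 1 (real n * (b - x))) \<longlonglongrightarrow> 1 * 1"
    using assms by (intro tendsto_mult *) auto
  then show ?thesis by (simp add: bump_def algebra_simps)
qed

section \<open>Real weak derivatives and the lemma of du Bois-Reymond\<close>

definition weak_deriv_real :: "(real \<Rightarrow> real) \<Rightarrow> (real \<Rightarrow> real) \<Rightarrow> bool" where
  "weak_deriv_real f g \<longleftrightarrow> (\<forall>\<phi>. test_function \<phi> \<longrightarrow>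
     (LINT x|lborel. deriv \<phi> x * f x) = - (LINT x|lborel. \<phi> x * g x))"

text \<open>The difference of the indicators carries the orientation, so one formula is the integral
  from 0 to x for both signs of x.\<close>

definition prim :: "(real \<Rightarrow> real) \<Rightarrow> real \<Rightarrow> real" where
  "prim g x = (LINT s|lborel. (indicator {0..x} s - indicator {x..0} s) * g s)"

lemma integrable_indicator_mult_sqint:
  assumes "sqint g"
  shows "integrable lborel (\<lambda>s. indicator {x..y} s * g s)"
  by (rule integrable_mult_sqint[OF sqint_indicator assms])

lemma prim_diff:
  assumes "sqint g" "x \<le> y"
  shows "prim g y - prim g x = (LINT s|lborel. indicator {x..y} s * g s)"
proof -
  note [measurable] = sqintD(1)[OF assms(1)]
  have i: "integrable lborel (\<lambda>s. (indicator {0..x} s - indicator {x..0} s) * g s)" for x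
    unfolding left_diff_distrib
    by (intro Bochner_Integration.integrable_diff integrable_indicator_mult_sqint assms)
  have "prim g y - prim g x = (LINT s|lborel. (indicator {0..y} s - indicator {y..0} s) * g s
     - (indicator {0..x} s - indicator {x..0} s) * g s)"
    unfolding prim_def by (intro Bochner_Integration.integral_diff[symmetric] i)
  also have "\<dots> = (LINT s|lborel. indicator {x..y} s * g s)"
  proof (rule integral_cong_AE)
    \<comment> \<open>At the end points the closed intervals overlap and the pointwise identity can
      fail.\<close>
    have "AE s in lborel. s \<noteq> 0 \<and> s \<noteq> x \<and> s \<noteq> y"
      by (intro AE_conjI AE_lborel_singleton)
    then show "AE s in lborel. (indicator {0..y} s - indicator {y..0} s) * g s
     - (indicator {0..x} s - indicator {x..0} s) * g s = indicator {x..y} s * g s"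
      by eventually_elim (use assms(2) in \<open>auto simp: indicator_def\<close>)
  qed simp_all
  finally show ?thesis .
qed

lemma prim_continuous:
  assumes "sqint g"
  shows "continuous_on UNIV (prim g)"
proof (rule continuous_at_imp_continuous_on, rule ballI)
  fix x
  have hold: "\<bar>prim g z - prim g y\<bar> \<le> sqrt \<bar>z - y\<bar> * nrm g" for y z
  proof -
    have *: "\<bar>prim g y - prim g x\<bar> \<le> sqrt (y - x) * nrm g" if "x \<le> y" for x y
      using prim_diff[OF assms that] Cauchy_Schwarz_sqint[OF sqint_indicator[of x y] assms] that
      by (simp add: nrm_indicator)
    show ?thesis
      using *[of y z] *[of z y] by (cases "y \<le> z") (auto simp: abs_minus_commute)
  qed
  have "((\<lambda>z. sqrt \<bar>z - x\<bar> * nrm g) \<longlongrightarrow> sqrt \<bar>x - x\<bar> * nrm g) (at x)"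
    by (intro tendsto_intros)
  then have lim: "((\<lambda>z. sqrt \<bar>z - x\<bar> * nrm g) \<longlongrightarrow> 0) (at x)" by simp
  have "((\<lambda>z. prim g z - prim g x) \<longlongrightarrow> 0) (at x)"
    by (rule Lim_null_comparison[OF _ lim]) (use hold in auto)
  then show "isCont (prim g) x"
    by (simp add: isCont_def LIM_zero_iff)
qed

lemma integrable_continuous_compact:
  fixes f g :: "real \<Rightarrow> real"
  assumes "continuous_on UNIV f" "\<And>x. x \<notin> {a..b} \<Longrightarrow> f x = 0"
  shows "integrable lborel f"
proof -
  have "integrable lborel (\<lambda>x. indicator {a..b} x *\<^sub>R f x)"
    by (rule borel_integrable_compact) (auto intro: continuous_on_subset[OF assms(1)])
  moreover have "(\<lambda>x. indicator {a..b} x *\<^sub>R f x) = f"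
    using assms(2) by (force simp: indicator_def)
  ultimately show ?thesis by simp
qed

definition cumul :: "(real \<Rightarrow> real) \<Rightarrow> real \<Rightarrow> real \<Rightarrow> real" where
  "cumul \<psi> a x = (LINT y|lborel. indicator {a..x} y * \<psi> y)"

text \<open>Mean zero makes the primitive vanish again to the right of b; this is what turns it into
  a compactly supported function.\<close>

lemma cumul_properties:
  assumes c: "continuous_on UNIV \<psi>" and z: "\<And>x. x \<notin> {a..b} \<Longrightarrow> \<psi> x = 0"
    and i: "(LINT x|lborel. \<psi> x) = 0" 
  shows "x \<notin> {a..b} \<Longrightarrow> cumul \<psi> a x = 0" "(cumul \<psi> a has_real_derivative \<psi> x) (at x)"
proof -
  have out: "cumul \<psi> a x = 0" if "x < a \<or> b < x" for x
    using that
  proof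
    assume "b < x"
    then have "(LINT y|lborel. indicator {a..x} y * \<psi> y) = (LINT y|lborel. \<psi> y)"
      using z by (intro Bochner_Integration.integral_cong) (force simp: indicator_def)+
    then show ?thesis using i by (simp add: cumul_def)
  qed (simp add: cumul_def)
  then show "x \<notin> {a..b} \<Longrightarrow> cumul \<psi> a x = 0" by auto
  \<comment> \<open>Starting at a - 1 places every x \<ge> a in the interior of an interval, where
    the fundamental theorem gives a two-sided derivative; far to the left the primitive is locally
    zero.\<close>
  have eq: "cumul \<psi> a x = integral {a - 1..x} \<psi>" for x
  proof -
    have "cumul \<psi> a x = (LINT y|lborel. indicator {a - 1..x} y *\<^sub>R \<psi> y)"
      unfolding cumul_def using z by (intro Bochner_Integration.integral_cong) (force simp: indicator_def)+
    also have "\<dots> = integral {a - 1..x} \<psi>"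
      using set_borel_integral_eq_integral(2)[of "{a-1..x}" \<psi>] borel_integrable_compact[of "{a-1..x}" \<psi>]
        continuous_on_subset[OF c]
      by (simp add: set_lebesgue_integral_def set_integrable_def)
    finally show ?thesis .
  qed
  show "(cumul \<psi> a has_real_derivative \<psi> x) (at x)"
  proof (cases "x > a - 1")
    case True
    have "((\<lambda>x. integral {a - 1..x} \<psi>) has_real_derivative \<psi> x) (at x within {a - 1..x + 1})"
      by (rule integral_has_real_derivative) (use True continuous_on_subset[OF c] in auto)
    then show ?thesis
      using True at_within_Icc_at[of "a - 1" x "x + 1"] by (simp add: eq[abs_def])
  next
    case False
    have "\<forall>\<^sub>F z in nhds x. cumul \<psi> a z = 0"
      using False eventually_nhds_in_open[of "{..<a}" x] by (auto elim!: eventually_mono simp: out)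
    then show ?thesis using False z[of x]
      by (subst DERIV_cong_ev[OF refl _ refl]) auto
  qed
qed

text \<open>Fubini over the triangle a \<le> y \<le> x \<le> b. Since \<psi> has mean zero, the
  constant \<open>prim g a\<close> may be subtracted beforehand, and the integral of \<psi> over x
  \<ge> y is minus \<open>cumul \<psi> a y\<close>.\<close>

lemma integral_prim_by_parts:
  assumes g: "sqint g" and c: "continuous_on UNIV \<psi>" and z: "\<And>x. x \<notin> {a..b} \<Longrightarrow> \<psi> x = 0"
    and i: "(LINT x|lborel. \<psi> x) = 0"
  shows "(LINT x|lborel. \<psi> x * prim g x) = - (LINT x|lborel. cumul \<psi> a x * g x)"
proof -
  note [measurable] = sqintD(1)[OF g]
  have [measurable]: "\<psi> \<in> borel_measurable borel" by (rule borel_measurable_continuous_onI[OF c])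
  have ip: "integrable lborel \<psi>" by (rule integrable_continuous_compact[OF c z])
  have ipp: "integrable lborel (\<lambda>x. \<psi> x * prim g x)"
    by (rule integrable_continuous_compact[where a=a and b=b])
       (use z in \<open>auto intro!: continuous_on_mult c prim_continuous g\<close>)
  let ?k = "\<lambda>x y. \<psi> x * (indicator {a..b} y * g y) * (if y \<le> x then 1 else 0)"
  have ig: "integrable lborel (\<lambda>y. indicator {a..b} y * g y)"
    by (rule integrable_indicator_mult_sqint[OF g])
  have "integrable (lborel \<Otimes>\<^sub>M lborel) (case_prod ?k)"
  proof (rule Bochner_Integration.integrable_bound)
    show "integrable (lborel \<Otimes>\<^sub>M lborel) (\<lambda>(x, y). \<psi> x * (indicator {a..b} y * g y))"
      by (rule lborel_pair.Fubini_integrable) (use ip ig in \<open>auto simp: abs_mult\<close>)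
  qed (auto simp: split_beta')
  then have Fub: "(LINT y|lborel. (LINT x|lborel. ?k x y)) = (LINT x|lborel. (LINT y|lborel. ?k x y))"
    by (rule lborel_pair.Fubini_integral)
  have "(LINT x|lborel. \<psi> x * prim g x) = (LINT x|lborel. \<psi> x * prim g x - prim g a * \<psi> x)"
    using ip ipp i by simp
  also have "\<dots> = (LINT x|lborel. (LINT y|lborel. ?k x y))"
  proof (rule Bochner_Integration.integral_cong[OF refl])
    fix x
    show "\<psi> x * prim g x - prim g a * \<psi> x = (LINT y|lborel. ?k x y)"
    proof (cases "x \<in> {a..b}")
      case True
      have "(LINT y|lborel. ?k x y) = (LINT y|lborel. \<psi> x * (indicator {a..x} y * g y))"
        using True by (intro Bochner_Integration.integral_cong) (auto simp: indicator_def)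
      also have "\<dots> = \<psi> x * (prim g x - prim g a)"
        using prim_diff[OF g, of a x] True by simp
      finally show ?thesis by (simp add: algebra_simps)
    qed (use z in simp)
  qed
  also have "\<dots> = (LINT y|lborel. (LINT x|lborel. ?k x y))" using Fub by simp
  also have "\<dots> = (LINT y|lborel. - (cumul \<psi> a y * g y))"
  proof (rule integral_cong_AE)
    show "AE y in lborel. (LINT x|lborel. ?k x y) = - (cumul \<psi> a y * g y)"
    proof (rule AE_I2)
      fix y
      show "(LINT x|lborel. ?k x y) = - (cumul \<psi> a y * g y)"
      proof (cases "y \<in> {a..b}")
        case True
        have "AE x in lborel. ?k x y = g y * (\<psi> x - indicator {a..y} x * \<psi> x)"
          using AE_lborel_singleton[of y]
          by eventually_elim (use True z in \<open>auto simp: indicator_def\<close>)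
        then have "(LINT x|lborel. ?k x y) = (LINT x|lborel. g y * (\<psi> x - indicator {a..y} x * \<psi> x))"
          by (intro integral_cong_AE) auto
        also have "\<dots> = g y * ((LINT x|lborel. \<psi> x) - cumul \<psi> a y)"
          using ip integrable_mult_indicator[of "{a..y}" lborel \<psi>] by (simp add: cumul_def)
        finally show ?thesis using i by simp
      next
        case False
        then show ?thesis using cumul_properties(1)[OF c z i] by simp
      qed
    qed
    have "continuous_on UNIV (cumul \<psi> a)"
      using cumul_properties(2)[OF c z i] DERIV_isCont continuous_at_imp_continuous_on by metis
    then have [measurable]: "cumul \<psi> a \<in> borel_measurable borel" by (rule borel_measurable_continuous_onI)
    show "(\<lambda>y. - (cumul \<psi> a y * g y)) \<in> borel_measurable lborel" by simp
    show "(\<lambda>y. LINT x|lborel. ?k x y) \<in> borel_measurable lborel" by measurable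
  qed
  finally show ?thesis by simp
qed

text \<open>The function r = f - \<open>prim g\<close> annihilates every compactly supported member
  of the smooth class with mean zero, because the primitive of such a member is a test function.
  Hence r is constant almost everywhere, and \<open>prim g\<close> plus that constant is the
  representative.\<close>

lemma weak_deriv_real_representative:
  assumes f: "sqint f" and g: "sqint g" and w: "weak_deriv_real f g"
  shows "\<exists>F. (AE x in lborel. F x = f x) \<and> L2_prim F g"
proof -
  note [measurable] = sqintD(1)[OF f] sqintD(1)[OF g]
  have [measurable]: "prim g \<in> borel_measurable borel"
    by (rule borel_measurable_continuous_onI[OF prim_continuous[OF g]])
  define r where "r = (\<lambda>x. f x - prim g x)"
  have [measurable]: "r \<in> borel_measurable borel" by (simp add: r_def)
  have sq_prim: "sqint (\<lambda>x. indicator {a..b} x * prim g x)" for a b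
  proof -
    have "continuous_on {a..b} (\<lambda>x. (prim g x)\<^sup>2)"
      by (intro continuous_intros continuous_on_subset[OF prim_continuous[OF g]]) auto
    from borel_integrable_compact[OF _ this]
    have "integrable lborel (\<lambda>x. indicator {a..b} x * (prim g x)\<^sup>2)" by simp
    moreover have "(indicator {a..b} x * prim g x)\<^sup>2 = indicator {a..b} x * (prim g x)\<^sup>2" for x
      by (auto simp: indicator_def)
    ultimately show ?thesis by (simp add: sqint_def)
  qed
  have sq_r: "sqint (\<lambda>x. indicator {a..b} x * r x)" for a b
  proof -
    have "sqint (\<lambda>x. f x * indicator {a..b} x - indicator {a..b} x * prim g x)"
      by (intro sqint_diff sq_prim sqint_mult_bdd[OF f, where B=1]) (auto simp: indicator_def)
    then show ?thesis by (simp add: r_def algebra_simps)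
  qed
  have ir: "integrable lborel (\<lambda>x. indicator {a..b} x * r x)" for a b
    using integrable_mult_sqint[OF sqint_indicator[of a b] sq_r[of a b]]
    by (rule back_subst[where P = "integrable lborel"]) (auto simp: indicator_def)
  have zero: "(LINT x|lborel. \<psi> x * r x) = 0"
    if s: "smooth_alg \<psi>" and z: "\<And>x. x \<notin> {a..b} \<Longrightarrow> \<psi> x = 0" and i: "(LINT x|lborel. \<psi> x) = 0" for \<psi> a b
  proof -
    have c: "continuous_on UNIV \<psi>" by (rule smooth_alg_continuous[OF s])
    note cum = cumul_properties[OF c z i]
    have test: "test_function (cumul \<psi> a)" "deriv (cumul \<psi> a) = \<psi>"
      using test_functionI[of \<psi> "cumul \<psi> a" a b, OF s cum(2) cum(1)] by simp_all
    have "(LINT x|lborel. \<psi> x * f x) = - (LINT x|lborel. cumul \<psi> a x * g x)"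
      using w[unfolded weak_deriv_real_def, rule_format, OF test(1)] test(2) by simp
    moreover have "integrable lborel (\<lambda>x. \<psi> x * f x)"
    proof (rule integrable_mult_sqint[OF _ f])
      show "sqint \<psi>"
        unfolding sqint_def
        by (intro conjI borel_measurable_continuous_onI c integrable_continuous_compact[where a=a and b=b])
           (use z in \<open>auto intro!: continuous_intros c\<close>)
    qed
    moreover have "integrable lborel (\<lambda>x. \<psi> x * prim g x)"
      by (rule integrable_continuous_compact[where a=a and b=b])
         (use z in \<open>auto intro!: continuous_on_mult c prim_continuous g\<close>)
    ultimately show ?thesis
      using integral_prim_by_parts[OF g c z i] by (simp add: r_def right_diff_distrib)
  qed
  have ibump: "integrable lborel (bump a b n)" and ibumpr: "integrable lborel (\<lambda>x. bump a b n x * r x)" for a b n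
  proof -
    have [measurable]: "bump a b n \<in> borel_measurable borel"
      by (rule borel_measurable_continuous_onI[OF smooth_alg_continuous[OF smooth_bump]])
    show "integrable lborel (bump a b n)"
      by (rule Bochner_Integration.integrable_bound[OF integrable_indicator_Icc[of a b]])
         (use bump_bounds in auto)
    show "integrable lborel (\<lambda>x. bump a b n x * r x)"
    proof (rule Bochner_Integration.integrable_bound[OF ir[of a b]])
      have "\<bar>bump a b n x * r x\<bar> \<le> \<bar>indicator {a..b} x * r x\<bar>" for x
        unfolding abs_mult using bump_bounds[of a b n x] by (intro mult_right_mono) auto
      then show "AE x in lborel. norm (bump a b n x * r x) \<le> norm (indicator {a..b} x * r x)" by simp
    qed simp
  qed
  define C0 where "C0 = (LINT x|lborel. bump 0 1 1 x)"
  have "C0 \<noteq> 0"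
  proof
    assume "C0 = 0"
    then have "AE x in lborel. bump 0 1 1 x = 0"
      using integral_nonneg_eq_0_iff_AE[OF ibump[of 0 1 1]] bump_bounds(1) by (simp add: C0_def)
    then have "AE x in lborel. x \<notin> {0<..<1::real}"
      by eventually_elim (use bump_pos[of 0 _ 1 1] in force)
    then have "{0<..<1::real} \<in> null_sets lborel"
      by (subst (asm) AE_iff_null_sets[symmetric]) auto
    then show False by (simp add: null_sets_def)
  qed
  \<comment> \<open>The mean of r with weight \<open>bump 0 1 1\<close>: the constant that r turns
    out to be.\<close>
  define c where "c = (LINT x|lborel. bump 0 1 1 x * r x) / C0"
  have key: "(LINT x|lborel. bump a b n x * r x) = c * (LINT x|lborel. bump a b n x)" for a b n
  proof -
    \<comment> \<open>Subtracting this multiple of the reference bump leaves a function of mean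
      zero, to which \<open>zero\<close> applies.\<close>
    define k where "k = (LINT x|lborel. bump a b n x) / C0"
    have "(LINT x|lborel. (bump a b n x + - k * bump 0 1 1 x) * r x) = 0"
    proof (rule zero)
      show "smooth_alg (\<lambda>x. bump a b n x + - k * bump 0 1 1 x)"
        by (intro smooth_alg.intros smooth_bump)
      show "bump a b n x + - k * bump 0 1 1 x = 0" if "x \<notin> {min a 0..max b 1}" for x
      proof -
        have "x \<notin> {a..b}" "x \<notin> {0..1}" using that by auto
        then show ?thesis
          using bump_bounds[of a b n x] bump_bounds[of 0 1 1 x] by auto
      qed
      show "(LINT x|lborel. bump a b n x + - k * bump 0 1 1 x) = 0"
        using ibump \<open>C0 \<noteq> 0\<close> by (simp add: k_def C0_def)
    qed
    then have "(LINT x|lborel. bump a b n x * r x) - k * (LINT x|lborel. bump 0 1 1 x * r x) = 0"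
      using ibumpr by (simp add: left_diff_distrib mult.assoc)
    then show ?thesis by (simp add: k_def c_def)
  qed
  have lim: "(LINT x|lborel. indicator {a..b} x * r x) = c * (b - a)" if "a \<le> b" for a b
  proof -
    have AE: "AE x in lborel. (\<lambda>n. bump a b n x) \<longlonglongrightarrow> indicator {a..b} x"
    proof -
      have "AE x in lborel. x \<noteq> a \<and> x \<noteq> b" by (intro AE_conjI AE_lborel_singleton)
      then show ?thesis
      proof eventually_elim
        case (elim x)
        show ?case
        proof (cases "x \<in> {a..b}")
          case True
          then show ?thesis using elim bump_tendsto[of a x b] by auto
        next
          case False
          then have "bump a b n x = 0" for n using bump_bounds[of a b n x] by auto
          then show ?thesis using False by simp
        qed
      qed
    qed
    have 1: "(\<lambda>n. LINT x|lborel. bump a b n x) \<longlonglongrightarrow> (LINT x|lborel. indicator {a..b} x)"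
    proof (rule integral_dominated_convergence[where w = "indicator {a..b}"])
      show "AE x in lborel. norm (bump a b n x) \<le> indicator {a..b} x" for n
        using bump_bounds by auto
    qed (use AE ibump in auto)
    have 2: "(\<lambda>n. LINT x|lborel. bump a b n x * r x) \<longlonglongrightarrow> (LINT x|lborel. indicator {a..b} x * r x)"
    proof (rule integral_dominated_convergence[where w = "\<lambda>x. \<bar>indicator {a..b} x * r x\<bar>"])
      have "\<bar>bump a b n x * r x\<bar> \<le> \<bar>indicator {a..b} x * r x\<bar>" for x n
        unfolding abs_mult using bump_bounds[of a b n x] by (intro mult_right_mono) auto
      then show "AE x in lborel. norm (bump a b n x * r x) \<le> \<bar>indicator {a..b} x * r x\<bar>" for n by simp
      show "AE x in lborel. (\<lambda>n. bump a b n x * r x) \<longlonglongrightarrow> indicator {a..b} x * r x"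
        using AE by eventually_elim (intro tendsto_intros)
    qed (use ir ibumpr in auto)
    have "(\<lambda>n. LINT x|lborel. bump a b n x * r x) \<longlonglongrightarrow> c * (LINT x|lborel. indicator {a..b} x)"
      unfolding key by (intro tendsto_mult tendsto_const 1)
    from LIMSEQ_unique[OF 2 this] show ?thesis using that by simp
  qed
  \<comment> \<open>So far r is known to be square-integrable only locally, so the vanishing
    criterion is used on each [-N, N] and countably many null sets are united.\<close>
  have "AE x in lborel. \<forall>N::nat. indicator {-real N..real N} x * (r x - c) = 0"
    unfolding AE_all_countable
  proof
    fix N :: nat
    show "AE x in lborel. indicator {-real N..real N} x * (r x - c) = 0"
    proof (rule AE_zero_if_interval_integrals_zero)
      show "sqint (\<lambda>x. indicator {-real N..real N} x * (r x - c))"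
        using sqint_diff[OF sq_r[of "- real N" "real N"] sqint_cmult[OF sqint_indicator[of "- real N" "real N"], of c]]
        by (simp add: algebra_simps)
      fix x y :: real assume "x \<le> y"
      let ?a = "max x (- real N)" and ?b = "min y (real N)"
      have "(LINT s|lborel. indicator {x..y} s * (indicator {-real N..real N} s * (r s - c)))
         = (LINT s|lborel. indicator {?a..?b} s * r s - c * indicator {?a..?b} s)"
        by (intro Bochner_Integration.integral_cong) (auto simp: indicator_def)
      also have "\<dots> = (LINT s|lborel. indicator {?a..?b} s * r s) - c * (LINT s|lborel. indicator {?a..?b} s)"
        using ir by simp
      also have "\<dots> = 0"
      proof (cases "?a \<le> ?b")
        case True
        then show ?thesis using lim[OF True] by simp
      next
        case False
        then have "{?a..?b} = {}" by simp
        then show ?thesis by simp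
      qed
      finally show "(LINT s|lborel. indicator {x..y} s * (indicator {-real N..real N} s * (r s - c))) = 0" .
    qed
  qed
  then have "AE x in lborel. prim g x + c = f x"
  proof eventually_elim
    case (elim x)
    obtain N :: nat where "\<bar>x\<bar> \<le> real N" using real_arch_simple by blast
    then have "x \<in> {-real N..real N}" by auto
    then have "indicator {-real N..real N} x = (1::real)" by simp
    then have "r x - c = 0" using elim[rule_format, of N] by (metis mult_1)
    then show ?case unfolding r_def by linarith
  qed
  moreover have "L2_prim (\<lambda>x. prim g x + c) g"
    unfolding L2_prim_def
  proof (intro conjI allI impI)
    show "sqint (\<lambda>x. prim g x + c)" by (rule sqint_cong_AE[OF calculation _ f]) simp
    show "prim g y + c - (prim g x + c) = (LINT s|lborel. indicator {x..y} s * g s)" if "x \<le> y" for x y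
      using prim_diff[OF g that] by simp
  qed (rule g)
  ultimately show ?thesis by (intro exI[of _ "\<lambda>x. prim g x + c"] conjI)
qed

subsection \<open>Product rules and time derivatives of integrals\<close>

definition bdd_mean_deriv :: "(real \<Rightarrow> real \<Rightarrow> real) \<Rightarrow> (real \<Rightarrow> real) \<Rightarrow> real \<Rightarrow> bool" where
  "bdd_mean_deriv f f' t \<longleftrightarrow> mean_deriv f f' t \<and> bdd_cont f t"

lemma bdd_mean_deriv_mean_deriv: "bdd_mean_deriv f f' t \<Longrightarrow> mean_deriv f f' t"
  by (simp add: bdd_mean_deriv_def)

text \<open>Separates computing from simplifying: the product rules fill in \<open>g\<close> by
  following the syntax of the expression, and only an identity of functions is left. The similar
  rules for \<open>bdd_L2_deriv\<close> and \<open>integral_deriv\<close> serve the same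
  purpose.\<close>

lemma bdd_mean_deriv_cong: "bdd_mean_deriv f g t \<Longrightarrow> g = f' \<Longrightarrow> bdd_mean_deriv f f' t"
  by simp

lemma bdd_mean_deriv_cmult: "bdd_mean_deriv f f' t \<Longrightarrow> bdd_mean_deriv (\<lambda>s x. k * f s x) (\<lambda>x. k * f' x) t"
  and bdd_mean_deriv_add: "bdd_mean_deriv f f' t \<Longrightarrow> bdd_mean_deriv g g' t \<Longrightarrow> bdd_mean_deriv (\<lambda>s x. f s x + g s x) (\<lambda>x. f' x + g' x) t"
  and bdd_mean_deriv_diff: "bdd_mean_deriv f f' t \<Longrightarrow> bdd_mean_deriv g g' t \<Longrightarrow> bdd_mean_deriv (\<lambda>s x. f s x - g s x) (\<lambda>x. f' x - g' x) t"
  and bdd_mean_deriv_minus: "bdd_mean_deriv f f' t \<Longrightarrow> bdd_mean_deriv (\<lambda>s x. - f s x) (\<lambda>x. - f' x) t"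
  and bdd_mean_deriv_mult: "bdd_mean_deriv f f' t \<Longrightarrow> bdd_mean_deriv g g' t \<Longrightarrow>
    bdd_mean_deriv (\<lambda>s x. f s x * g s x) (\<lambda>x. f' x * g t x + f t x * g' x) t"
  unfolding bdd_mean_deriv_def using mean_deriv_mult by blast+

lemmas bdd_mean_deriv_intros = bdd_mean_deriv_cmult bdd_mean_deriv_add bdd_mean_deriv_diff bdd_mean_deriv_minus bdd_mean_deriv_mult

definition bdd_L2_deriv :: "(real \<Rightarrow> real) \<Rightarrow> (real \<Rightarrow> real) \<Rightarrow> bool" where
  "bdd_L2_deriv f g \<longleftrightarrow> L2_deriv f g \<and> BUC f"

lemma bdd_L2_deriv_cong: "bdd_L2_deriv f g \<Longrightarrow> g = f' \<Longrightarrow> bdd_L2_deriv f f'"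
  by simp

lemma bdd_L2_deriv_cmult: "bdd_L2_deriv f f' \<Longrightarrow> bdd_L2_deriv (\<lambda>x. k * f x) (\<lambda>x. k * f' x)"
  and bdd_L2_deriv_add: "bdd_L2_deriv f f' \<Longrightarrow> bdd_L2_deriv g g' \<Longrightarrow> bdd_L2_deriv (\<lambda>x. f x + g x) (\<lambda>x. f' x + g' x)"
  and bdd_L2_deriv_diff: "bdd_L2_deriv f f' \<Longrightarrow> bdd_L2_deriv g g' \<Longrightarrow> bdd_L2_deriv (\<lambda>x. f x - g x) (\<lambda>x. f' x - g' x)"
  and bdd_L2_deriv_minus: "bdd_L2_deriv f f' \<Longrightarrow> bdd_L2_deriv (\<lambda>x. - f x) (\<lambda>x. - f' x)"
  and bdd_L2_deriv_mult: "bdd_L2_deriv f f' \<Longrightarrow> bdd_L2_deriv g g' \<Longrightarrow> bdd_L2_deriv (\<lambda>x. f x * g x) (\<lambda>x. f' x * g x + f x * g' x)"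
  unfolding bdd_L2_deriv_def using L2_deriv_mult by blast+

lemmas bdd_L2_deriv_intros = bdd_L2_deriv_cmult bdd_L2_deriv_add bdd_L2_deriv_diff bdd_L2_deriv_minus bdd_L2_deriv_mult

text \<open>Integrability is built in because the integral of a non-integrable function is 0 by
  convention, so without it densities could not be added term by term.\<close>

definition integral_deriv :: "(real \<Rightarrow> real \<Rightarrow> real) \<Rightarrow> (real \<Rightarrow> real) \<Rightarrow> real \<Rightarrow> bool" where
  "integral_deriv F F' t \<longleftrightarrow> (\<forall>s. integrable lborel (F s)) \<and> integrable lborel F' \<and>
     ((\<lambda>s. LINT x|lborel. F s x) has_real_derivative (LINT x|lborel. F' x)) (at t)"

lemma integral_deriv_cong: "integral_deriv F G t \<Longrightarrow> G = F' \<Longrightarrow> integral_deriv F F' t"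
  by simp

lemma integral_deriv_cmult: "integral_deriv F F' t \<Longrightarrow> integral_deriv (\<lambda>s x. k * F s x) (\<lambda>x. k * F' x) t"
  by (auto simp: integral_deriv_def intro: DERIV_cmult)

lemma integral_deriv_add: "integral_deriv F F' t \<Longrightarrow> integral_deriv G G' t \<Longrightarrow> integral_deriv (\<lambda>s x. F s x + G s x) (\<lambda>x. F' x + G' x) t"
  by (auto simp: integral_deriv_def intro: DERIV_add)

lemma integral_deriv_diff: "integral_deriv F F' t \<Longrightarrow> integral_deriv G G' t \<Longrightarrow> integral_deriv (\<lambda>s x. F s x - G s x) (\<lambda>x. F' x - G' x) t"
  by (auto simp: integral_deriv_def intro: DERIV_diff)

lemma integral_deriv_mult:
  assumes "mean_deriv f f' t" "mean_deriv g g' t"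
  shows "integral_deriv (\<lambda>s x. f s x * g s x) (\<lambda>x. f' x * g t x + f t x * g' x) t"
  unfolding integral_deriv_def
  by (intro conjI allI mean_deriv_integral_mult assms integrable_mult_sqint Bochner_Integration.integrable_add
      mean_derivD[OF assms(1)] mean_derivD[OF assms(2)])

text \<open>Every time slice has the same integral in the moving frame as at rest, so a density may
  be differentiated along whichever characteristics suit it.\<close>

lemma integral_deriv_unframe:
  assumes "integral_deriv (frame \<sigma> t F) F' t"
  shows "integral_deriv F F' t"
proof -
  have "(LINT x|lborel. frame \<sigma> t F s x) = (LINT x|lborel. F s x)" for s
    unfolding frame_def by (rule integral_shift)
  moreover have "integrable lborel (frame \<sigma> t F s) \<longleftrightarrow> integrable lborel (F s)" for s
    using lborel_integrable_real_affine_iff[of 1 "F s" "\<sigma> * (s - t)"]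
    unfolding frame_def[abs_def] by (simp add: add.commute)
  ultimately show ?thesis using assms by (simp add: integral_deriv_def)
qed

text \<open>The sup norm inequality with l = 1, applied to the difference of two time slices, turns
  convergence in H^1 into uniform convergence.\<close>

lemma L2_prim_L2lim_bdd_cont:
  assumes L2_prim: "\<And>s. L2_prim (f s) (fx s)"
    and "L2lim (\<lambda>h. f (t + h)) (f t) (at 0)" "L2lim (\<lambda>h. fx (t + h)) (fx t) (at 0)"
  shows "bdd_cont f t"
  unfolding bdd_cont_def
proof (intro conjI allI)
  fix s
  show "f s \<in> borel_measurable borel" "bounded (range (f s))"
    using bdd_contD(1,2)[OF L2_prim_BUC[OF L2_prim[of s], unfolded BUC_def], of 0] by simp_all
next
  let ?r = "\<lambda>h. sqrt (2 * (nrm (\<lambda>x. f (t + h) x - f t x))\<^sup>2 + 2 * (nrm (\<lambda>x. fx (t + h) x - fx t x))\<^sup>2)"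
  have "(?r \<longlongrightarrow> sqrt (2 * 0\<^sup>2 + 2 * 0\<^sup>2)) (at 0)"
    by (intro tendsto_intros L2limD(3)[OF assms(2)] L2limD(3)[OF assms(3)])
  then have r: "(?r \<longlongrightarrow> 0) (at 0)" by simp
  have le: "\<bar>f (t + h) x - f t x\<bar> \<le> ?r h" for h x
    using L2_prim_sup_bound[OF L2_prim_diff[OF L2_prim[of "t + h"] L2_prim[of t]], of 1 x] by (intro real_le_rsqrt) simp
  show "uniform_limit UNIV (\<lambda>h. f (t + h)) (f t) (at 0)"
  proof (rule uniform_limitI)
    fix e :: real assume "e > 0"
    then have "\<forall>\<^sub>F h in at 0. ?r h < e" using order_tendstoD(2)[OF r] by blast
    then show "\<forall>\<^sub>F h in at 0. \<forall>x\<in>UNIV. dist (f (t + h) x) (f t x) < e"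
      by eventually_elim (auto simp: dist_real_def intro: le_less_trans[OF le])
  qed
qed

text \<open>Along the characteristic only the sum of the time derivative and the transported space
  derivative occurs, so the equation, valid almost everywhere, allows it to be exchanged for
  \<open>k\<close>, which may be more regular than either term.\<close>

lemma mean_deriv_transport:
  assumes "mean_deriv f f' s" "L2_deriv (f s) fx" "AE x in lborel. f' x + \<sigma> * fx x = k x"
    "k \<in> borel_measurable borel" "\<sigma> \<noteq> 0"
  shows "mean_deriv (frame \<sigma> t f) (\<lambda>x. k (x + \<sigma> * (s - t))) s"
proof -
  \<comment> \<open>Anchoring at s makes the exchange one between unshifted functions; a translation
    by \<open>\<sigma> * (s - t)\<close> then moves the anchor to t.\<close>
  have "mean_deriv (frame \<sigma> s f) (\<lambda>x. f' x + \<sigma> * fx x) s"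
    using mean_deriv_frame[OF assms(1,2,5), of s] by simp
  from mean_deriv_cong_AE[OF this assms(3,4)] have L: "mean_deriv (frame \<sigma> s f) k s" .
  from L2lim_shift[OF mean_derivD(3)[OF this], of "\<sigma> * (s - t)"]
  have "L2lim (\<lambda>h x. (frame \<sigma> t f (s + h) x - frame \<sigma> t f s x) / h) (\<lambda>x. k (x + \<sigma> * (s - t))) (at 0)"
    by (simp add: frame_def algebra_simps)
  moreover have "sqint (frame \<sigma> t f r)" for r
    unfolding frame_def[abs_def] by (intro sqint_shift mean_derivD(1)[OF assms(1)])
  ultimately show ?thesis by (simp add: mean_deriv_def)
qed

subsection \<open>The Thirring system in real form\<close>

text \<open>For \<open>\<sigma> = 1\<close> the pair \<open>(a, b)\<close> is the real and imaginary part of \<open>u\<close> and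
  \<open>(c, d)\<close> that of \<open>v\<close>; for \<open>\<sigma> = -1\<close> the roles are exchanged.  The functions
  \<open>X, Y, Z, W\<close> are the spatial and \<open>p, q, r, w\<close> the temporal derivatives of
  \<open>a, b, c, d\<close>.\<close>

locale thirring =
  fixes \<sigma> :: real and a b c d X Y Z W p q r w :: "real \<Rightarrow> real \<Rightarrow> real"
  assumes sigma: "\<sigma> = 1 \<or> \<sigma> = -1"
    and L2_prim: "L2_prim (a t) (X t)" "L2_prim (b t) (Y t)" "L2_prim (c t) (Z t)" "L2_prim (d t) (W t)"
    and Xlim: "L2lim (\<lambda>h. X (t + h)) (X t) (at 0)" "L2lim (\<lambda>h. Y (t + h)) (Y t) (at 0)"
      "L2lim (\<lambda>h. Z (t + h)) (Z t) (at 0)" "L2lim (\<lambda>h. W (t + h)) (W t) (at 0)"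
    and mean_deriv: "mean_deriv a (p t) t" "mean_deriv b (q t) t" "mean_deriv c (r t) t" "mean_deriv d (w t) t"
    and eqs: "AE x in lborel. p t x + \<sigma> * X t x = - d t x + 2 * ((c t x * c t x + d t x * d t x) * b t x)"
      "AE x in lborel. q t x + \<sigma> * Y t x = c t x - 2 * ((c t x * c t x + d t x * d t x) * a t x)"
      "AE x in lborel. r t x - \<sigma> * Z t x = - b t x + 2 * ((a t x * a t x + b t x * b t x) * d t x)"
      "AE x in lborel. w t x - \<sigma> * W t x = a t x - 2 * ((a t x * a t x + b t x * b t x) * c t x)"
begin

lemma sigma_nz: "\<sigma> \<noteq> 0"
  using sigma by auto

lemma bdd_L2_deriv: "bdd_L2_deriv (a t) (X t)" "bdd_L2_deriv (b t) (Y t)" "bdd_L2_deriv (c t) (Z t)" "bdd_L2_deriv (d t) (W t)"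
  using L2_prim[THEN L2_prim_L2_deriv] L2_prim[THEN L2_prim_BUC] by (auto simp: bdd_L2_deriv_def)

lemma gens: "L2_deriv (a t) (X t)" "L2_deriv (b t) (Y t)" "L2_deriv (c t) (Z t)" "L2_deriv (d t) (W t)"
  using L2_prim_L2_deriv L2_prim by auto

lemma bdd_cont: "bdd_cont a t" "bdd_cont b t" "bdd_cont c t" "bdd_cont d t"
  using L2_prim_L2lim_bdd_cont[OF L2_prim(1) mean_deriv_L2lim[OF mean_deriv(1)] Xlim(1)] L2_prim_L2lim_bdd_cont[OF L2_prim(2) mean_deriv_L2lim[OF mean_deriv(2)] Xlim(2)]
    L2_prim_L2lim_bdd_cont[OF L2_prim(3) mean_deriv_L2lim[OF mean_deriv(3)] Xlim(3)] L2_prim_L2lim_bdd_cont[OF L2_prim(4) mean_deriv_L2lim[OF mean_deriv(4)] Xlim(4)]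
  by auto

lemma meas [measurable]:
  "a t \<in> borel_measurable borel" "b t \<in> borel_measurable borel"
  "c t \<in> borel_measurable borel" "d t \<in> borel_measurable borel"
  "X t \<in> borel_measurable borel" "Y t \<in> borel_measurable borel"
  "Z t \<in> borel_measurable borel" "W t \<in> borel_measurable borel"
  using L2_prim by (auto simp: L2_prim_def sqint_def)

text \<open>Derivatives of a and b along their own characteristics. As polynomials in H^1 functions
  they have spatial derivatives \<open>Gax\<close> and \<open>Gbx\<close>, which are written as L^2
  factors times bounded ones, the shape in which limits in time are taken.\<close>

definition "Ga s x = - d s x + 2 * ((c s x * c s x + d s x * d s x) * b s x)"
definition "Gb s x = c s x - 2 * ((c s x * c s x + d s x * d s x) * a s x)"
definition "Gax s x = - W s x + (4 * (Z s x * (c s x * b s x)) + 4 * (W s x * (d s x * b s x)) +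
  2 * (Y s x * (c s x * c s x + d s x * d s x)))"
definition "Gbx s x = Z s x - (4 * (Z s x * (c s x * a s x)) + 4 * (W s x * (d s x * a s x)) +
  2 * (X s x * (c s x * c s x + d s x * d s x)))"
text \<open>Derivatives of c and d along the characteristics of (a, b): the equations supply r -
  \<sigma> Z and w - \<sigma> W, whereas the frame produces r + \<sigma> Z and w + \<sigma>
  W.\<close>

definition "Gc s x = 2 * \<sigma> * Z s x - b s x + 2 * ((a s x * a s x + b s x * b s x) * d s x)"
definition "Gd s x = 2 * \<sigma> * W s x + a s x - 2 * ((a s x * a s x + b s x * b s x) * c s x)"

lemma L2_deriv_G: "L2_deriv (Ga s) (Gax s)" "L2_deriv (Gb s) (Gbx s)"
proof -
  have "bdd_L2_deriv (Ga s) (Gax s)"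
    unfolding Ga_def[abs_def]
    by (rule bdd_L2_deriv_cong, (rule bdd_L2_deriv bdd_L2_deriv_intros)+) (auto simp: Gax_def algebra_simps)
  moreover have "bdd_L2_deriv (Gb s) (Gbx s)"
    unfolding Gb_def[abs_def]
    by (rule bdd_L2_deriv_cong, (rule bdd_L2_deriv bdd_L2_deriv_intros)+) (auto simp: Gbx_def algebra_simps)
  ultimately show "L2_deriv (Ga s) (Gax s)" "L2_deriv (Gb s) (Gbx s)" by (auto simp: bdd_L2_deriv_def)
qed

lemma L2lim_Gx: "L2lim (\<lambda>h. Gax (t + h)) (Gax t) (at 0)" "L2lim (\<lambda>h. Gbx (t + h)) (Gbx t) (at 0)"
proof -
  have m: "L2lim (\<lambda>h x. F (t + h) x * (f (t + h) x * g (t + h) x)) (\<lambda>x. F t x * (f t x * g t x)) (at 0)"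
    if "L2lim (\<lambda>h. F (t + h)) (F t) (at 0)" "bdd_cont f t" "bdd_cont g t" for F f g
    using L2lim_mult_bdd_cont[OF that(1) bdd_cont_mult[OF that(2,3)]] .
  have m2: "L2lim (\<lambda>h x. F (t + h) x * (f (t + h) x * f (t + h) x + g (t + h) x * g (t + h) x))
      (\<lambda>x. F t x * (f t x * f t x + g t x * g t x)) (at 0)"
    if "L2lim (\<lambda>h. F (t + h)) (F t) (at 0)" "bdd_cont f t" "bdd_cont g t" for F f g
    using L2lim_mult_bdd_cont[OF that(1) bdd_cont_add[OF bdd_cont_mult[OF that(2,2)] bdd_cont_mult[OF that(3,3)]]] .
  show "L2lim (\<lambda>h. Gax (t + h)) (Gax t) (at 0)"
    unfolding Gax_def[abs_def]
    by (intro L2lim_add L2lim_minus L2lim_cmult m m2 bdd_cont Xlim)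
  show "L2lim (\<lambda>h. Gbx (t + h)) (Gbx t) (at 0)"
    unfolding Gbx_def[abs_def]
    by (intro L2lim_add L2lim_diff L2lim_cmult m m2 bdd_cont Xlim)
qed

text \<open>Stated at every time s of the frame anchored at t, because the exchange of time and
  space derivatives applies the mean value theorem in time.\<close>

lemma mean_deriv_frame_ab:
  "mean_deriv (frame \<sigma> t a) (frame \<sigma> t Ga s) s" "mean_deriv (frame \<sigma> t b) (frame \<sigma> t Gb s) s"
proof -
  have k: "Ga s \<in> borel_measurable borel" "Gb s \<in> borel_measurable borel"
    by (simp_all add: Ga_def[abs_def] Gb_def[abs_def])
  show "mean_deriv (frame \<sigma> t a) (frame \<sigma> t Ga s) s"
    using mean_deriv_transport[OF mean_deriv(1) gens(1) _ k(1) sigma_nz, of s t] eqs(1)[of s]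
    by (simp add: Ga_def frame_def[abs_def])
  show "mean_deriv (frame \<sigma> t b) (frame \<sigma> t Gb s) s"
    using mean_deriv_transport[OF mean_deriv(2) gens(2) _ k(2) sigma_nz, of s t] eqs(2)[of s]
    by (simp add: Gb_def frame_def[abs_def])
qed

lemma mean_deriv_frame_cd: "mean_deriv (frame \<sigma> t c) (Gc t) t" "mean_deriv (frame \<sigma> t d) (Gd t) t"
proof -
  have k: "Gc t \<in> borel_measurable borel" "Gd t \<in> borel_measurable borel"
    by (simp_all add: Gc_def[abs_def] Gd_def[abs_def])
  have 1: "AE x in lborel. r t x + \<sigma> * Z t x = Gc t x"
    using eqs(3)[of t] by eventually_elim (simp add: Gc_def)
  have 2: "AE x in lborel. w t x + \<sigma> * W t x = Gd t x"
    using eqs(4)[of t] by eventually_elim (simp add: Gd_def)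
  show "mean_deriv (frame \<sigma> t c) (Gc t) t"
    using mean_deriv_transport[OF mean_deriv(3) gens(3) 1 k(1) sigma_nz, of t] by simp
  show "mean_deriv (frame \<sigma> t d) (Gd t) t"
    using mean_deriv_transport[OF mean_deriv(4) gens(4) 2 k(2) sigma_nz, of t] by simp
qed

lemma bdd_mean_deriv_frame:
  "bdd_mean_deriv (frame \<sigma> t a) (Ga t) t" "bdd_mean_deriv (frame \<sigma> t b) (Gb t) t"
  "bdd_mean_deriv (frame \<sigma> t c) (Gc t) t" "bdd_mean_deriv (frame \<sigma> t d) (Gd t) t"
  using mean_deriv_frame_ab[of t t] mean_deriv_frame_cd[of t] bdd_cont_frame[OF _ _ sigma_nz] bdd_cont bdd_L2_deriv by (auto simp: bdd_mean_deriv_def bdd_L2_deriv_def)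

text \<open>The exchange of derivatives makes the L^2 functions X and Y differentiable along the
  frame. It does not reach Z and W here, since \<open>Gc\<close> and \<open>Gd\<close> contain them
  undamped by any smoothing; the copy of the locale with opposite sign covers them.\<close>

lemma mean_deriv_frame_XY: "mean_deriv (frame \<sigma> t X) (Gax t) t" "mean_deriv (frame \<sigma> t Y) (Gbx t) t"
proof -
  have "mean_deriv (frame \<sigma> t X) (frame \<sigma> t Gax t) t"
    by (rule mean_deriv_L2_deriv_commute[where fx = "frame \<sigma> t X" and Gx = "frame \<sigma> t Gax", OF mean_deriv_frame_ab(1)[where t = t]])
       (simp_all add: L2_deriv_frame gens L2_deriv_G L2lim_frame L2lim_Gx sigma_nz)
  then show "mean_deriv (frame \<sigma> t X) (Gax t) t" by simp
  have "mean_deriv (frame \<sigma> t Y) (frame \<sigma> t Gbx t) t"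
    by (rule mean_deriv_L2_deriv_commute[where fx = "frame \<sigma> t Y" and Gx = "frame \<sigma> t Gbx", OF mean_deriv_frame_ab(2)[where t = t]])
       (simp_all add: L2_deriv_frame gens L2_deriv_G L2lim_frame L2lim_Gx sigma_nz)
  then show "mean_deriv (frame \<sigma> t Y) (Gbx t) t" by simp
qed

definition "charge s x = a s x * a s x + b s x * b s x"

text \<open>Every spatial derivative in this density belongs to (a, b), so one frame suffices for
  it; c and d occur undifferentiated.\<close>

definition "energy s x = X s x * X s x + Y s x * Y s x +
  \<sigma> * (Y s x * (a s x * (a s x * a s x + b s x * b s x + 2 * (c s x * c s x + d s x * d s x))) -
       X s x * (b s x * (a s x * a s x + b s x * b s x + 2 * (c s x * c s x + d s x * d s x))))"

definition "potential s x = 2 * (((a s x * a s x + b s x * b s x) * (c s x * c s x + d s x * d s x)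
     - (a s x * c s x + b s x * d s x)) * (a s x * a s x + b s x * b s x + (c s x * c s x + d s x * d s x)))"

text \<open>Charge passes between the two components, so this rate need not vanish; the cancellation
  takes place in the sum with the other copy of the locale.\<close>

lemma integral_deriv_charge: "integral_deriv charge (\<lambda>x. 2 * (a t x * Ga t x + b t x * Gb t x)) t"
proof (rule integral_deriv_unframe[of \<sigma>])
  have "integral_deriv (\<lambda>s x. frame \<sigma> t a s x * frame \<sigma> t a s x + frame \<sigma> t b s x * frame \<sigma> t b s x)
    (\<lambda>x. 2 * (a t x * Ga t x + b t x * Gb t x)) t"
    by (rule integral_deriv_cong, (rule integral_deriv_add integral_deriv_mult bdd_mean_deriv_frame[THEN bdd_mean_deriv_mean_deriv])+) (auto simp: algebra_simps)
  then show "integral_deriv (frame \<sigma> t charge) (\<lambda>x. 2 * (a t x * Ga t x + b t x * Gb t x)) t"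
    by (simp add: frame_def[abs_def] charge_def)
qed

definition "energy_rate s x =
  (let N = a s x * a s x + b s x * b s x + 2 * (c s x * c s x + d s x * d s x);
       N' = 2 * (a s x * Ga s x + b s x * Gb s x) + 4 * (c s x * Gc s x + d s x * Gd s x)
   in 2 * Gax s x * X s x + 2 * Gbx s x * Y s x +
      \<sigma> * (Gbx s x * a s x * N + Y s x * (Ga s x * N + a s x * N')
         - Gax s x * b s x * N - X s x * (Gb s x * N + b s x * N')))"

text \<open>X and Y carry no sup bound, so in each product under the integral they are one factor;
  the other is X or Y again, or a or b times N, to which the pointwise product rule applies. The
  bracketing of the density reflects this.\<close>

lemma integral_deriv_energy: "integral_deriv energy (energy_rate t) t"
proof (rule integral_deriv_unframe[of \<sigma>])
  let ?X = "frame \<sigma> t X" and ?Y = "frame \<sigma> t Y" and ?a = "frame \<sigma> t a" and ?b = "frame \<sigma> t b"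
    and ?c = "frame \<sigma> t c" and ?d = "frame \<sigma> t d"
  have N: "bdd_mean_deriv (\<lambda>s x. ?a s x * ?a s x + ?b s x * ?b s x + 2 * (?c s x * ?c s x + ?d s x * ?d s x))
     (\<lambda>x. 2 * (a t x * Ga t x + b t x * Gb t x) + 4 * (c t x * Gc t x + d t x * Gd t x)) t"
    by (rule bdd_mean_deriv_cong, (rule bdd_mean_deriv_frame bdd_mean_deriv_intros)+) (auto simp: algebra_simps)
  have "integral_deriv (\<lambda>s x. ?X s x * ?X s x + ?Y s x * ?Y s x +
    \<sigma> * (?Y s x * (?a s x * (?a s x * ?a s x + ?b s x * ?b s x + 2 * (?c s x * ?c s x + ?d s x * ?d s x))) -
       ?X s x * (?b s x * (?a s x * ?a s x + ?b s x * ?b s x + 2 * (?c s x * ?c s x + ?d s x * ?d s x)))))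
    (energy_rate t) t"
    by (rule integral_deriv_cong, (rule integral_deriv_cmult integral_deriv_add integral_deriv_diff integral_deriv_mult mean_deriv_frame_XY bdd_mean_deriv_mult[OF bdd_mean_deriv_frame(1) N, THEN bdd_mean_deriv_mean_deriv]
          bdd_mean_deriv_mult[OF bdd_mean_deriv_frame(2) N, THEN bdd_mean_deriv_mean_deriv])+)
       (auto simp: energy_rate_def Let_def algebra_simps)
  then show "integral_deriv (frame \<sigma> t energy) (energy_rate t) t"
    by (simp add: frame_def[abs_def] energy_def)
qed

definition "potential_rate s x =
  (let n = a s x * a s x + b s x * b s x; m = c s x * c s x + d s x * d s x;
       n' = 2 * (a s x * Ga s x + b s x * Gb s x); m' = 2 * (c s x * Gc s x + d s x * Gd s x)
   in 2 * ((n' * m + n * m' - (Ga s x * c s x + a s x * Gc s x + Gb s x * d s x + b s x * Gd s x)) * (n + m)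
      + (n * m - (a s x * c s x + b s x * d s x)) * (n' + m')))"

lemma integral_deriv_potential: "integral_deriv potential (potential_rate t) t"
proof (rule integral_deriv_unframe[of \<sigma>])
  let ?a = "frame \<sigma> t a" and ?b = "frame \<sigma> t b" and ?c = "frame \<sigma> t c" and ?d = "frame \<sigma> t d"
  have n: "bdd_mean_deriv (\<lambda>s x. ?a s x * ?a s x + ?b s x * ?b s x) (\<lambda>x. 2 * (a t x * Ga t x + b t x * Gb t x)) t"
    by (rule bdd_mean_deriv_cong, (rule bdd_mean_deriv_frame bdd_mean_deriv_intros)+) (auto simp: algebra_simps)
  have m: "bdd_mean_deriv (\<lambda>s x. ?c s x * ?c s x + ?d s x * ?d s x) (\<lambda>x. 2 * (c t x * Gc t x + d t x * Gd t x)) t"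
    by (rule bdd_mean_deriv_cong, (rule bdd_mean_deriv_frame bdd_mean_deriv_intros)+) (auto simp: algebra_simps)
  have e: "bdd_mean_deriv (\<lambda>s x. ?a s x * ?c s x + ?b s x * ?d s x)
      (\<lambda>x. Ga t x * c t x + a t x * Gc t x + Gb t x * d t x + b t x * Gd t x) t"
    by (rule bdd_mean_deriv_cong, (rule bdd_mean_deriv_frame bdd_mean_deriv_intros)+) (auto simp: algebra_simps)
  have "integral_deriv (\<lambda>s x. 2 * (((?a s x * ?a s x + ?b s x * ?b s x) * (?c s x * ?c s x + ?d s x * ?d s x)
     - (?a s x * ?c s x + ?b s x * ?d s x)) * (?a s x * ?a s x + ?b s x * ?b s x + (?c s x * ?c s x + ?d s x * ?d s x))))
    (potential_rate t) t"
    by (rule integral_deriv_cong, rule integral_deriv_cmult,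
        rule integral_deriv_mult[OF bdd_mean_deriv_diff[OF bdd_mean_deriv_mult[OF n m] e, THEN bdd_mean_deriv_mean_deriv] bdd_mean_deriv_add[OF n m, THEN bdd_mean_deriv_mean_deriv]])
       (auto simp: potential_rate_def Let_def)
  then show "integral_deriv (frame \<sigma> t potential) (potential_rate t) t"
    by (simp add: frame_def[abs_def] potential_def)
qed

end

text \<open>Young's inequality |y k N| \<le> y^2 / 4 + (k N)^2 spends a quarter of the leading part;
  the rest is a multiple of a^2 + b^2, whose integral is controlled by the charge.\<close>

lemma density_bound:
  fixes \<sigma> a b X Y N S :: real
  assumes "\<sigma> = 1 \<or> \<sigma> = -1" "0 \<le> N" "N \<le> 2 * S"
  shows "\<bar>\<sigma> * (Y * (a * N) - X * (b * N))\<bar> \<le> (X\<^sup>2 + Y\<^sup>2) / 4 + 4 * S\<^sup>2 * (a\<^sup>2 + b\<^sup>2)"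
proof -
  have am: "\<bar>y * (k * N)\<bar> \<le> y\<^sup>2 / 4 + 4 * S\<^sup>2 * k\<^sup>2" for y k :: real
  proof -
    have "\<bar>y * (k * N)\<bar> \<le> y\<^sup>2 / 4 + (k * N)\<^sup>2"
      using zero_le_power2[of "y / 2 - k * N"] zero_le_power2[of "y / 2 + k * N"]
      by (auto simp: power2_eq_square algebra_simps abs_le_iff)
    moreover have "(k * N)\<^sup>2 \<le> 4 * S\<^sup>2 * k\<^sup>2"
    proof -
      have "N\<^sup>2 \<le> (2 * S)\<^sup>2" using assms by (intro power_mono)
      then have "N\<^sup>2 * k\<^sup>2 \<le> (2 * S)\<^sup>2 * k\<^sup>2" by (rule mult_right_mono) simp
      then show ?thesis by (simp add: power_mult_distrib mult.commute)
    qed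
    ultimately show ?thesis by linarith
  qed
  have "\<bar>\<sigma> * (Y * (a * N) - X * (b * N))\<bar> \<le> \<bar>Y * (a * N)\<bar> + \<bar>X * (b * N)\<bar>"
    using assms(1) by auto
  also have "\<dots> \<le> (Y\<^sup>2 / 4 + 4 * S\<^sup>2 * a\<^sup>2) + (X\<^sup>2 / 4 + 4 * S\<^sup>2 * b\<^sup>2)"
    by (intro add_mono am)
  also have "\<dots> = (X\<^sup>2 + Y\<^sup>2) / 4 + 4 * S\<^sup>2 * (a\<^sup>2 + b\<^sup>2)"
    by (simp add: field_simps)
  finally show ?thesis .
qed

text \<open>Uses 0 \<le> 2 n m \<le> S^2 and 2 |a c + b d| \<le> n + m \<le> S. One factor n + m is
  deliberately left in place, since its integral is the charge.\<close>

lemma potential_bound: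
  fixes a b c d S :: real
  assumes "a * a + b * b + (c * c + d * d) \<le> S"
  defines "n \<equiv> a * a + b * b" and "m \<equiv> c * c + d * d"
  shows "- S * (n + m) \<le> 2 * ((n * m - (a * c + b * d)) * (n + m))"
    "2 * ((n * m - (a * c + b * d)) * (n + m)) \<le> (S\<^sup>2 + S) * (n + m)"
proof -
  have nm: "0 \<le> n" "0 \<le> m" "n + m \<le> S" using assms by auto
  have e: "\<bar>2 * (a * c + b * d)\<bar> \<le> n + m"
    using zero_le_square[of "a - c"] zero_le_square[of "b - d"] zero_le_square[of "a + c"] zero_le_square[of "b + d"]
    by (auto simp: n_def m_def algebra_simps abs_le_iff)
  have "2 * (n * m) \<le> S\<^sup>2"
  proof -
    have "2 * (n * m) \<le> (n + m)\<^sup>2" by (simp add: power2_eq_square algebra_simps)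
    also have "\<dots> \<le> S\<^sup>2" using nm by (intro power_mono) auto
    finally show ?thesis .
  qed
  moreover have "0 \<le> n * m" using nm by simp
  ultimately have "- S \<le> 2 * (n * m - (a * c + b * d))" "2 * (n * m - (a * c + b * d)) \<le> S\<^sup>2 + S"
    using abs_le_D1[OF e] abs_le_D2[OF e] nm unfolding right_diff_distrib by - linarith+
  from this[THEN mult_right_mono, of "n + m"]
  have "- S * (n + m) \<le> 2 * (n * m - (a * c + b * d)) * (n + m)"
    "2 * (n * m - (a * c + b * d)) * (n + m) \<le> (S\<^sup>2 + S) * (n + m)"
    using nm by linarith+
  then show "- S * (n + m) \<le> 2 * ((n * m - (a * c + b * d)) * (n + m))"
    "2 * ((n * m - (a * c + b * d)) * (n + m)) \<le> (S\<^sup>2 + S) * (n + m)"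
    by (simp_all only: mult.assoc)
qed

subsection \<open>Conservation laws and coercivity\<close>

locale thirring_system = U: thirring 1 a b c d X Y Z W p q r w
  for a b c d X Y Z W p q r w :: "real \<Rightarrow> real \<Rightarrow> real"

text \<open>The system is invariant under exchanging u and v together with reversing space, that is,
  the sign of \<open>\<sigma>\<close>. Everything proved along the characteristics of u thus becomes
  available for v.\<close>

sublocale thirring_system \<subseteq> V: thirring "-1" c d a b Z W X Y r w p q
  using U.L2_prim U.Xlim U.mean_deriv U.eqs by unfold_locales simp_all

context thirring_system
begin

text \<open>In complex notation the density is
  \<open>|u\<^sub>x|\<^sup>2 + |v\<^sub>x|\<^sup>2 + Im (u\<^sub>x cnj u) (|u|\<^sup>2 + 2 |v|\<^sup>2) - Im (v\<^sub>x cnj v) (2 |u|\<^sup>2 + |v|\<^sup>2)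
  + 2 (|u|\<^sup>2 |v|\<^sup>2 - Re (u cnj v)) (|u|\<^sup>2 + |v|\<^sup>2)\<close>.\<close>

definition "total_density s x = U.energy s x + V.energy s x + U.potential s x"

text \<open>The rate of change is the spatial derivative of the flux
  \<open>- (a c + b d) (n + 3 m) + 2 n m (n + m)\<close> with \<open>n = a\<^sup>2 + b\<^sup>2\<close> and \<open>m = c\<^sup>2 + d\<^sup>2\<close>.\<close>

lemma flux_integral_zero:
  "(LINT x|lborel. U.energy_rate t x + V.energy_rate t x + U.potential_rate t x) = 0"
proof -
  define n where "n = (\<lambda>x. a t x * a t x + b t x * b t x)"
  define n' where "n' = (\<lambda>x. 2 * (a t x * X t x + b t x * Y t x))"
  define m where "m = (\<lambda>x. c t x * c t x + d t x * d t x)"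
  define m' where "m' = (\<lambda>x. 2 * (c t x * Z t x + d t x * W t x))"
  define e where "e = (\<lambda>x. a t x * c t x + b t x * d t x)"
  define e' where "e' = (\<lambda>x. X t x * c t x + a t x * Z t x + Y t x * d t x + b t x * W t x)"
  have n: "bdd_L2_deriv n n'" unfolding n_def
    by (rule bdd_L2_deriv_cong, (rule U.bdd_L2_deriv bdd_L2_deriv_intros)+) (auto simp: n'_def algebra_simps)
  have m: "bdd_L2_deriv m m'" unfolding m_def
    by (rule bdd_L2_deriv_cong, (rule U.bdd_L2_deriv bdd_L2_deriv_intros)+) (auto simp: m'_def algebra_simps)
  have e: "bdd_L2_deriv e e'" unfolding e_def
    by (rule bdd_L2_deriv_cong, (rule U.bdd_L2_deriv bdd_L2_deriv_intros)+) (auto simp: e'_def algebra_simps)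
  have gens: "L2_deriv e e'" "L2_deriv (\<lambda>x. n x + 3 * m x) (\<lambda>x. n' x + 3 * m' x)"
    "L2_deriv (\<lambda>x. n x * m x) (\<lambda>x. n' x * m x + n x * m' x)" "L2_deriv (\<lambda>x. n x + m x) (\<lambda>x. n' x + m' x)"
    using e bdd_L2_deriv_add[OF n bdd_L2_deriv_cmult[OF m]] bdd_L2_deriv_mult[OF n m] bdd_L2_deriv_add[OF n m] by (auto simp: bdd_L2_deriv_def)
  let ?f = "\<lambda>x. e' x * (n x + 3 * m x) + e x * (n' x + 3 * m' x)"
  let ?g = "\<lambda>x. (n' x * m x + n x * m' x) * (n x + m x) + n x * m x * (n' x + m' x)"
  have "integrable lborel ?f" "integrable lborel ?g"
    by (intro Bochner_Integration.integrable_add integrable_mult_sqint L2_derivD(1,2)[OF gens(1)]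
        L2_derivD(1,2)[OF gens(2)] L2_derivD(1,2)[OF gens(3)] L2_derivD(1,2)[OF gens(4)])+
  moreover have "(LINT x|lborel. - F x + 2 * G x) = - (LINT x|lborel. F x) + 2 * (LINT x|lborel. G x)"
    if "integrable lborel F" "integrable lborel G" for F G :: "real \<Rightarrow> real"
    using that by simp
  ultimately have "(LINT x|lborel. - ?f x + 2 * ?g x) = - (LINT x|lborel. ?f x) + 2 * (LINT x|lborel. ?g x)"
    by blast
  then have "(LINT x|lborel. - ?f x + 2 * ?g x) = 0"
    using L2_deriv_integral_by_parts[OF gens(1,2)] L2_deriv_integral_by_parts[OF gens(3,4)] by simp
  \<comment> \<open>Once expanded, this is a polynomial identity in the eight functions at x.
    Following \<open>U.potential\<close> along the characteristics of u is what makes the flux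
    asymmetric in n and m.\<close>
  moreover have "U.energy_rate t x + V.energy_rate t x + U.potential_rate t x = - ?f x + 2 * ?g x" for x
    unfolding U.energy_rate_def V.energy_rate_def U.potential_rate_def Let_def
      U.Ga_def U.Gb_def U.Gc_def U.Gd_def U.Gax_def U.Gbx_def
      V.Ga_def V.Gb_def V.Gc_def V.Gd_def V.Gax_def V.Gbx_def
      n_def n'_def m_def m'_def e_def e'_def
    by algebra
  ultimately show ?thesis by simp
qed

lemma integrable_total: "integrable lborel (total_density s)"
  and total_energy_conserved: "(LINT x|lborel. total_density s x) = (LINT x|lborel. total_density t x)"
proof -
  have I: "integral_deriv total_density (\<lambda>x. U.energy_rate t x + V.energy_rate t x + U.potential_rate t x) t" for t
    unfolding total_density_def[abs_def]
    by (intro integral_deriv_add U.integral_deriv_energy V.integral_deriv_energy U.integral_deriv_potential)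
  then show "integrable lborel (total_density s)" by (simp add: integral_deriv_def)
  have "\<forall>t. ((\<lambda>s. LINT x|lborel. total_density s x) has_real_derivative 0) (at t)"
    using I by (simp add: integral_deriv_def flux_integral_zero)
  then show "(LINT x|lborel. total_density s x) = (LINT x|lborel. total_density t x)"
    by (rule DERIV_isconst_all)
qed

section \<open>Coercivity for small charge\<close>

definition "mass s = (nrm (a s))\<^sup>2 + (nrm (b s))\<^sup>2 + (nrm (c s))\<^sup>2 + (nrm (d s))\<^sup>2"
definition "kinetic s = (nrm (X s))\<^sup>2 + (nrm (Y s))\<^sup>2 + (nrm (Z s))\<^sup>2 + (nrm (W s))\<^sup>2"

lemma sq: "sqint (a s)" "sqint (b s)" "sqint (c s)" "sqint (d s)"
  "sqint (X s)" "sqint (Y s)" "sqint (Z s)" "sqint (W s)"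
  using U.L2_prim L2_primD by blast+

lemma mass_conserved: "mass s = mass t"
proof -
  have I: "integral_deriv (\<lambda>s x. U.charge s x + V.charge s x)
     (\<lambda>x. 2 * (a t x * U.Ga t x + b t x * U.Gb t x) + 2 * (c t x * V.Ga t x + d t x * V.Gb t x)) t" for t
    by (intro integral_deriv_add U.integral_deriv_charge V.integral_deriv_charge)
  have "2 * (a t x * U.Ga t x + b t x * U.Gb t x) + 2 * (c t x * V.Ga t x + d t x * V.Gb t x) = 0" for t x
    by (simp add: U.Ga_def U.Gb_def V.Ga_def V.Gb_def algebra_simps)
  then have "\<forall>t. ((\<lambda>s. LINT x|lborel. U.charge s x + V.charge s x) has_real_derivative 0) (at t)"
    using I by (simp add: integral_deriv_def)
  then have "(LINT x|lborel. U.charge s x + V.charge s x) = (LINT x|lborel. U.charge t x + V.charge t x)"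
    by (rule DERIV_isconst_all)
  moreover have "(LINT x|lborel. U.charge s x + V.charge s x) = mass s" for s
    using sq[of s, THEN sqintD(2)]
    by (simp add: U.charge_def V.charge_def mass_def nrm_sq flip: power2_eq_square)
  ultimately show ?thesis by simp
qed

text \<open>Adding the four sup norm inequalities gives N \<le> (2 / l) \<open>mass s\<close> + 2 l
  \<open>kinetic s\<close> for every l > 0. With mass at most 1/16 the resulting bound is minimal at
  l = 1 / (4 \<open>sqrt (kinetic s)\<close>), where each of its two terms is half of
  \<open>sqrt (kinetic s)\<close>.\<close>

lemma sup_bound:
  assumes "mass s \<le> 1 / 16"
  shows "a s x * a s x + b s x * b s x + (c s x * c s x + d s x * d s x) \<le> sqrt (kinetic s)"
proof -
  define N where "N = (a s x)\<^sup>2 + (b s x)\<^sup>2 + (c s x)\<^sup>2 + (d s x)\<^sup>2"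
  have K0: "kinetic s \<ge> 0" by (simp add: kinetic_def)
  have bound: "N \<le> 1 / (8 * l) + 2 * l * kinetic s" if "l > 0" for l
  proof -
    have "N \<le> 2 / l * mass s + 2 * l * kinetic s"
      unfolding N_def mass_def kinetic_def
      using L2_prim_sup_bound[OF U.L2_prim(1) that, of s x] L2_prim_sup_bound[OF U.L2_prim(2) that, of s x]
        L2_prim_sup_bound[OF U.L2_prim(3) that, of s x] L2_prim_sup_bound[OF U.L2_prim(4) that, of s x]
      by (simp add: distrib_left)
    also have "2 / l * mass s \<le> 2 / l * (1 / 16)"
      using assms that by (intro mult_left_mono) auto
    finally show ?thesis by simp
  qed
  have "N \<le> sqrt (kinetic s)"
  proof (cases "kinetic s = 0")
    case True
    have "N \<le> 0"
    proof (rule ccontr)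
      assume "\<not> N \<le> 0"
      \<comment> \<open>With zero kinetic part the bound reads N \<le> 1 / (8 l) for all l; the
        choice l = 1/N gives N \<le> N / 8.\<close>
      then show False using bound[of "1 / N"] True by simp
    qed
    then show ?thesis using True by simp
  next
    case False
    then have k: "sqrt (kinetic s) > 0" using K0 by simp
    have "N \<le> 1 / (8 * (1 / (4 * sqrt (kinetic s)))) + 2 * (1 / (4 * sqrt (kinetic s))) * kinetic s"
      by (rule bound) (use k in simp)
    also have "\<dots> = sqrt (kinetic s)"
      using k real_sqrt_mult_self[of "kinetic s"] K0 by (simp add: field_simps)
    finally show ?thesis .
  qed
  then show ?thesis by (simp add: N_def power2_eq_square algebra_simps)
qed

text \<open>With S = K in the pointwise bounds, the corrections cost a quarter of the leading part
  plus, from below, (4 K^2 + K) times a density whose integral is the mass. The lower bound keeps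
  3/4 - 4/16 = 1/2 of K^2; here the small charge secures coercivity.\<close>

lemma energy_bounds:
  assumes "mass s \<le> 1 / 16"
  defines "K \<equiv> sqrt (kinetic s)"
  shows "K\<^sup>2 / 2 - K / 16 \<le> (LINT x|lborel. total_density s x)"
    "(LINT x|lborel. total_density s x) \<le> 2 * K\<^sup>2 + K"
proof -
  let ?k = "\<lambda>x. (X s x)\<^sup>2 + (Y s x)\<^sup>2 + (Z s x)\<^sup>2 + (W s x)\<^sup>2"
  let ?n = "\<lambda>x. (a s x)\<^sup>2 + (b s x)\<^sup>2 + (c s x)\<^sup>2 + (d s x)\<^sup>2"
  note sq2 [simp] = sq[of s, THEN sqintD(2)]
  have K: "0 \<le> K" "K\<^sup>2 = kinetic s" by (simp_all add: K_def kinetic_def)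
  have ik: "(LINT x|lborel. ?k x) = K\<^sup>2" by (simp add: K(2) kinetic_def nrm_sq)
  have im: "(LINT x|lborel. ?n x) = mass s" by (simp add: mass_def nrm_sq)
  have pt: "3 / 4 * ?k x - (4 * K\<^sup>2 + K) * ?n x \<le> total_density s x"
     "total_density s x \<le> 5 / 4 * ?k x + (5 * K\<^sup>2 + K) * ?n x" for x
  proof -
    have S: "a s x * a s x + b s x * b s x + (c s x * c s x + d s x * d s x) \<le> K"
      using sup_bound[OF assms(1), of x] by (simp add: K_def)
    note 1 = density_bound[of 1 "a s x * a s x + b s x * b s x + 2 * (c s x * c s x + d s x * d s x)" K
        "Y s x" "a s x" "X s x" "b s x"]
      and 2 = density_bound[of "-1" "c s x * c s x + d s x * d s x + 2 * (a s x * a s x + b s x * b s x)" K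
        "W s x" "c s x" "Z s x" "d s x"]
      and 3 = potential_bound[OF S]
    have pos: "0 \<le> a s x * a s x + b s x * b s x" "0 \<le> c s x * c s x + d s x * d s x" by simp_all
    have e1: "\<bar>U.energy s x - ((X s x)\<^sup>2 + (Y s x)\<^sup>2)\<bar> \<le> ((X s x)\<^sup>2 + (Y s x)\<^sup>2) / 4 + 4 * K\<^sup>2 * ((a s x)\<^sup>2 + (b s x)\<^sup>2)"
      using 1 S pos by (simp add: U.energy_def power2_eq_square)
    have e2: "\<bar>V.energy s x - ((Z s x)\<^sup>2 + (W s x)\<^sup>2)\<bar> \<le> ((Z s x)\<^sup>2 + (W s x)\<^sup>2) / 4 + 4 * K\<^sup>2 * ((c s x)\<^sup>2 + (d s x)\<^sup>2)"
      using 2 S pos by (simp add: V.energy_def power2_eq_square)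
    have e3: "- K * ?n x \<le> U.potential s x" "U.potential s x \<le> (K\<^sup>2 + K) * ?n x"
      using 3 by (simp_all add: U.potential_def power2_eq_square add.assoc)
    show "3 / 4 * ?k x - (4 * K\<^sup>2 + K) * ?n x \<le> total_density s x"
      using e1 e2 e3(1) unfolding total_density_def abs_le_iff by (simp add: distrib_left distrib_right field_simps)
    show "total_density s x \<le> 5 / 4 * ?k x + (5 * K\<^sup>2 + K) * ?n x"
      using e1 e2 e3(2) unfolding total_density_def abs_le_iff by (simp add: distrib_left distrib_right field_simps)
  qed
  have mass: "0 \<le> mass s" "mass s \<le> 1 / 16" using assms by (simp_all add: mass_def)
  have "K\<^sup>2 / 2 - K / 16 \<le> 3 / 4 * K\<^sup>2 - (4 * K\<^sup>2 + K) * mass s"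
    using mult_left_mono[OF mass(2), of "4 * K\<^sup>2 + K"] K(1) by (simp add: field_simps)
  also have "\<dots> = (LINT x|lborel. 3 / 4 * ?k x - (4 * K\<^sup>2 + K) * ?n x)"
    using ik im by simp
  also have "\<dots> \<le> (LINT x|lborel. total_density s x)"
    by (rule integral_mono[OF _ integrable_total pt(1)]) simp
  finally show "K\<^sup>2 / 2 - K / 16 \<le> (LINT x|lborel. total_density s x)" .
  have "(LINT x|lborel. total_density s x) \<le> (LINT x|lborel. 5 / 4 * ?k x + (5 * K\<^sup>2 + K) * ?n x)"
    by (rule integral_mono[OF integrable_total _ pt(2)]) simp
  also have "\<dots> = 5 / 4 * K\<^sup>2 + (5 * K\<^sup>2 + K) * mass s"
    using ik im by simp
  also have "\<dots> \<le> 5 / 4 * K\<^sup>2 + (5 * K\<^sup>2 + K) * (1 / 16)"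
    using mass(2) K(1) by (intro add_left_mono mult_left_mono) auto
  also have "\<dots> \<le> 2 * K\<^sup>2 + K"
    by (simp add: add_divide_distrib) (use K(1) zero_le_power2[of K] in linarith)
  finally show "(LINT x|lborel. total_density s x) \<le> 2 * K\<^sup>2 + K" .
qed

text \<open>Both square roots are absorbed by completing squares, the one at time t at the cost of a
  quarter of \<open>kinetic t\<close>. The remaining quarter is at most 3 \<open>kinetic 0\<close> +
  1 + 1/256, whence the factor 12 and the constant 5.\<close>

lemma kinetic_bound:
  assumes "mass 0 \<le> 1 / 16"
  shows "kinetic t \<le> 12 * kinetic 0 + 5"
proof -
  have K: "(sqrt (kinetic s))\<^sup>2 = kinetic s" for s by (simp add: kinetic_def)
  have "mass t \<le> 1 / 16" using assms mass_conserved[of t 0] by simp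
  from energy_bounds(1)[OF this] energy_bounds(2)[OF assms] total_energy_conserved[of t 0]
  have "kinetic t / 2 - sqrt (kinetic t) / 16 \<le> 2 * kinetic 0 + sqrt (kinetic 0)" by (simp add: K)
  moreover have "sqrt (kinetic 0) \<le> kinetic 0 + 1"
    using zero_le_power2[of "sqrt (kinetic 0) - 1 / 2"] K[of 0]
    by (simp add: power2_diff power_divide)
  moreover have "sqrt (kinetic t) / 16 \<le> kinetic t / 4 + 1 / 256"
    using zero_le_power2[of "sqrt (kinetic t) / 2 - 1 / 16"] K[of t] by (simp add: power2_diff power_divide)
  ultimately show ?thesis by linarith
qed

end

subsection \<open>Complex-valued functions\<close>

lemma L2D:
  assumes "f \<in> L2"
  shows "f \<in> borel_measurable borel" "integrable lborel (\<lambda>x. (cmod (f x))\<^sup>2)"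
  using assms by (auto simp: L2_def)

lemma L2_parts:
  assumes "f \<in> L2"
  shows "sqint (\<lambda>x. Re (f x))" "sqint (\<lambda>x. Im (f x))"
    "(L2_norm f)\<^sup>2 = (nrm (\<lambda>x. Re (f x)))\<^sup>2 + (nrm (\<lambda>x. Im (f x)))\<^sup>2"
proof -
  note [measurable] = L2D(1)[OF assms]
  have "integrable lborel (\<lambda>x. (Re (f x))\<^sup>2)" "integrable lborel (\<lambda>x. (Im (f x))\<^sup>2)"
    by (rule Bochner_Integration.integrable_bound[OF L2D(2)[OF assms]]; simp add: cmod_power2)+
  then show "sqint (\<lambda>x. Re (f x))" "sqint (\<lambda>x. Im (f x))" by (simp_all add: sqint_def)
  then show "(L2_norm f)\<^sup>2 = (nrm (\<lambda>x. Re (f x)))\<^sup>2 + (nrm (\<lambda>x. Im (f x)))\<^sup>2"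
    by (simp add: L2_norm_def nrm_sq cmod_power2 sqint_def)
qed

lemma L2I:
  assumes "f \<in> borel_measurable borel" "sqint (\<lambda>x. Re (f x))" "sqint (\<lambda>x. Im (f x))"
  shows "f \<in> L2"
  using assms by (simp add: L2_def cmod_power2 sqint_def)

lemma L2_diff: "f \<in> L2 \<Longrightarrow> g \<in> L2 \<Longrightarrow> (\<lambda>x. f x - g x) \<in> L2"
  by (rule L2I) (simp_all add: borel_measurable_diff L2D L2_parts sqint_diff)

lemma L2_divide: "f \<in> L2 \<Longrightarrow> (\<lambda>x. f x / complex_of_real k) \<in> L2"
  by (rule L2I) (simp_all add: borel_measurable_divide L2D L2_parts sqint_divide)

lemma L2_norm_nonneg [simp]: "L2_norm f \<ge> 0"
  by (simp add: L2_norm_def)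

lemma nrm_part_le:
  assumes "f \<in> L2" "P = Re \<or> P = Im"
  shows "nrm (\<lambda>x. P (f x)) \<le> L2_norm f"
proof -
  have "(nrm (\<lambda>x. P (f x)))\<^sup>2 \<le> (L2_norm f)\<^sup>2"
    using L2_parts(3)[OF assms(1)] assms(2) by auto
  then show ?thesis by (rule power2_le_imp_le) simp
qed

lemma test_function_sqint:
  assumes "test_function \<phi>"
  shows "sqint \<phi>" "sqint (deriv \<phi>)"
proof -
  have d: "(deriv ^^ n) \<phi> field_differentiable at x" for n x
    using assms by (simp add: test_function_def)
  have cont: "continuous_on UNIV ((deriv ^^ n) \<phi>)" for n
    using d field_differentiable_imp_continuous_at continuous_at_imp_continuous_on by blast
  let ?K = "closure {x. \<phi> x \<noteq> 0}"
  have "compact ?K" using assms by (simp add: test_function_def)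
  then obtain B where B: "\<And>x. x \<in> ?K \<Longrightarrow> \<bar>x\<bar> \<le> B"
    using compact_imp_bounded bounded_iff by (metis real_norm_def)
  have z: "\<phi> x = 0" if "x \<notin> {-B..B}" for x
    using B[of x] closure_subset[of "{x. \<phi> x \<noteq> 0}"] that by (auto simp: abs_le_iff)
  have z': "deriv \<phi> x = 0" if "x \<notin> {-B..B}" for x
  proof -
    have "\<forall>\<^sub>F y in nhds x. y \<in> - {-B..B}"
      by (rule eventually_nhds_in_open) (use that in auto)
    then have "\<forall>\<^sub>F y in nhds x. \<phi> y = 0"
      by eventually_elim (use z in auto)
    then have "(\<phi> has_real_derivative 0) (at x)"
      by (subst DERIV_cong_ev[OF refl _ refl, of _ "\<lambda>y. 0"]) auto
    then show ?thesis by (rule DERIV_imp_deriv)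
  qed
  have *: "sqint f" if "continuous_on UNIV f" "\<And>x. x \<notin> {-B..B} \<Longrightarrow> f x = 0" for f
    unfolding sqint_def
    by (intro conjI borel_measurable_continuous_onI that(1) integrable_continuous_compact[where a="-B" and b=B])
       (use that in \<open>auto intro!: continuous_intros that(1)\<close>)
  show "sqint \<phi>" using *[OF cont[of 0]] z by simp
  show "sqint (deriv \<phi>)" using *[OF cont[of 1]] z' by simp
qed

lemma integral_sqint_L2:
  assumes "sqint \<phi>" "f \<in> L2"
  shows "(LINT x|lborel. complex_of_real (\<phi> x) * f x) =
    Complex (LINT x|lborel. \<phi> x * Re (f x)) (LINT x|lborel. \<phi> x * Im (f x))"
proof -
  have "integrable lborel (\<lambda>x. complex_of_real (\<phi> x * Re (f x)) + \<i> * complex_of_real (\<phi> x * Im (f x)))"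
    by (intro Bochner_Integration.integrable_add integrable_mult_right integrable_of_real
        integrable_mult_sqint assms L2_parts)
  moreover have "complex_of_real (\<phi> x * Re (f x)) + \<i> * complex_of_real (\<phi> x * Im (f x))
     = complex_of_real (\<phi> x) * f x" for x
    by (simp add: complex_eq_iff)
  ultimately have "integrable lborel (\<lambda>x. complex_of_real (\<phi> x) * f x)" by simp
  from integral_Re[OF this] integral_Im[OF this] show ?thesis
    by (simp add: complex_eq_iff)
qed

lemma weak_deriv_iff:
  assumes "f \<in> L2" "g \<in> L2"
  shows "weak_deriv f g \<longleftrightarrow> weak_deriv_real (\<lambda>x. Re (f x)) (\<lambda>x. Re (g x)) \<and>
    weak_deriv_real (\<lambda>x. Im (f x)) (\<lambda>x. Im (g x))"
  unfolding weak_deriv_def weak_deriv_real_def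
  by (auto simp: integral_sqint_L2[OF _ assms(1)] integral_sqint_L2[OF _ assms(2)]
      test_function_sqint complex_eq_iff)

lemma weak_deriv_real_diff:
  assumes "weak_deriv_real f f'" "weak_deriv_real g g'" "sqint f" "sqint f'" "sqint g" "sqint g'"
  shows "weak_deriv_real (\<lambda>x. f x - g x) (\<lambda>x. f' x - g' x)"
  unfolding weak_deriv_real_def
proof (intro allI impI)
  fix \<phi> assume t: "test_function \<phi>"
  note s = test_function_sqint[OF t]
  have "(LINT x|lborel. deriv \<phi> x * (f x - g x)) = (LINT x|lborel. deriv \<phi> x * f x) - (LINT x|lborel. deriv \<phi> x * g x)"
    unfolding right_diff_distrib
    by (intro Bochner_Integration.integral_diff integrable_mult_sqint s assms)
  moreover have "(LINT x|lborel. \<phi> x * (f' x - g' x)) = (LINT x|lborel. \<phi> x * f' x) - (LINT x|lborel. \<phi> x * g' x)"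
    unfolding right_diff_distrib
    by (intro Bochner_Integration.integral_diff integrable_mult_sqint s assms)
  ultimately show "(LINT x|lborel. deriv \<phi> x * (f x - g x)) = - (LINT x|lborel. \<phi> x * (f' x - g' x))"
    using assms(1,2) t by (simp add: weak_deriv_real_def)
qed

text \<open>The difference g - g' is a weak derivative of 0, so it has a primitive F vanishing
  almost everywhere. The sup norm inequality for F then leaves only the term with the factor l,
  which is arbitrarily small; hence F is 0 everywhere and the interval integrals of g - g'
  vanish.\<close>

lemma weak_deriv_real_unique:
  assumes "weak_deriv_real f g" "weak_deriv_real f g'" "sqint f" "sqint g" "sqint g'"
  shows "AE x in lborel. g x = g' x"
proof -
  have "weak_deriv_real (\<lambda>x. 0) (\<lambda>x. g x - g' x)"
    using weak_deriv_real_diff[OF assms(1,2,3,4,3,5)] by simp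
  from weak_deriv_real_representative[OF sqint_zero sqint_diff[OF assms(4,5)] this]
  obtain F where F: "AE x in lborel. F x = 0" "L2_prim F (\<lambda>x. g x - g' x)" by blast
  have "nrm F = nrm (\<lambda>x. 0)"
    by (rule nrm_cong_AE[OF F(1) sqintD(1)[OF L2_primD(1)[OF F(2)]]]) simp
  then have le: "(F x)\<^sup>2 \<le> 2 * l * (nrm (\<lambda>x. g x - g' x))\<^sup>2" if "l > 0" for l x
    using L2_prim_sup_bound[OF F(2) that, of x] by simp
  have "F x = 0" for x
  proof (rule ccontr)
    assume "F x \<noteq> 0"
    then have p: "(F x)\<^sup>2 > 0" by simp
    define k where "k = (nrm (\<lambda>x. g x - g' x))\<^sup>2"
    have k: "k \<ge> 0" by (simp add: k_def)
    \<comment> \<open>This l makes the right side a multiple of \<open>(F x)\<^sup>2\<close> with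
      factor k / (2 k + 2) < 1.\<close>
    have "(F x)\<^sup>2 \<le> 2 * ((F x)\<^sup>2 / (4 * k + 4)) * k"
      unfolding k_def by (rule le) (use p k in \<open>simp add: k_def add_nonneg_pos\<close>)
    also have "\<dots> = (F x)\<^sup>2 * (k / (2 * k + 2))" using k by (simp add: field_simps)
    also have "\<dots> < (F x)\<^sup>2 * 1" using p k by (intro mult_strict_left_mono) (auto simp: field_simps)
    finally show False by simp
  qed
  then have "(LINT s|lborel. indicator {x..y} s * (g s - g' s)) = 0" if "x \<le> y" for x y
    using L2_primD(3)[OF F(2) that] by simp
  then have "AE x in lborel. g x - g' x = 0"
    by (intro AE_zero_if_interval_integrals_zero sqint_diff assms)
  then show ?thesis by simp
qed

section \<open>Real components of H^1 functions and curves\<close>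

lemma H1D:
  assumes "f \<in> H1"
  shows "f \<in> L2" "dx f \<in> L2" "weak_deriv f (dx f)"
proof -
  show "f \<in> L2" using assms by (simp add: H1_def)
  have "\<exists>g. g \<in> L2 \<and> weak_deriv f g" using assms by (auto simp: H1_def)
  from someI_ex[OF this] show "dx f \<in> L2" "weak_deriv f (dx f)" by (auto simp: dx_def)
qed

lemma H1_weak_deriv_part:
  assumes "f \<in> H1" "P = Re \<or> P = Im"
  shows "sqint (\<lambda>x. P (f x))" "sqint (\<lambda>x. P (dx f x))" "weak_deriv_real (\<lambda>x. P (f x)) (\<lambda>x. P (dx f x))"
  using L2_parts[OF H1D(1)[OF assms(1)]] L2_parts[OF H1D(2)[OF assms(1)]] H1D(3)[OF assms(1)]
    weak_deriv_iff[OF H1D(1,2)[OF assms(1)]] assms(2) by auto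

lemma H1_diff:
  assumes "f \<in> H1" "g \<in> H1"
  shows "(\<lambda>x. f x - g x) \<in> H1"
proof -
  note a = H1D[OF assms(1)] and b = H1D[OF assms(2)]
  have "weak_deriv (\<lambda>x. f x - g x) (\<lambda>x. dx f x - dx g x)"
    unfolding weak_deriv_iff[OF L2_diff[OF a(1) b(1)] L2_diff[OF a(2) b(2)]]
    by (simp only: minus_complex.sel, intro conjI weak_deriv_real_diff
        H1_weak_deriv_part[OF assms(1)] H1_weak_deriv_part[OF assms(2)] disjI1[OF refl] disjI2[OF refl])
  then show ?thesis using L2_diff[OF a(1) b(1)] L2_diff[OF a(2) b(2)] by (auto simp: H1_def)
qed

text \<open>As \<open>dx\<close> picks a representative by choice, its linearity is available only
  almost everywhere; uniqueness of weak derivatives supplies it, and norms do not see null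
  sets.\<close>

lemma dx_diff_part:
  assumes "f \<in> H1" "g \<in> H1" "P = Re \<or> P = Im"
  shows "nrm (\<lambda>x. P (dx f x) - P (dx g x)) \<le> H1_norm (\<lambda>x. f x - g x)"
proof -
  let ?d = "\<lambda>x. f x - g x"
  have d: "?d \<in> H1" by (rule H1_diff[OF assms(1,2)])
  note a = H1_weak_deriv_part[OF assms(1,3)] and b = H1_weak_deriv_part[OF assms(2,3)]
    and c = H1_weak_deriv_part[OF d assms(3)]
  have P: "P (z - w) = P z - P w" for z w using assms(3) by auto
  have "AE x in lborel. P (dx f x) - P (dx g x) = P (dx ?d x)"
    by (rule weak_deriv_real_unique[OF weak_deriv_real_diff[OF a(3) b(3) a(1,2) b(1,2)] c(3)[unfolded P]])
       (intro sqint_diff a b c)+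
  then have "nrm (\<lambda>x. P (dx f x) - P (dx g x)) = nrm (\<lambda>x. P (dx ?d x))"
    by (rule nrm_cong_AE) (use sqintD(1)[OF a(2)] sqintD(1)[OF b(2)] sqintD(1)[OF c(2)] in auto)
  also have "\<dots> \<le> L2_norm (dx ?d)" by (rule nrm_part_le[OF H1D(2)[OF d] assms(3)])
  also have "\<dots> \<le> H1_norm ?d" unfolding H1_norm_def by (rule real_le_rsqrt) simp
  finally show ?thesis .
qed

lemma continuous_H1_part:
  assumes "continuous_H1 u" "P = Re \<or> P = Im"
  shows "L2lim (\<lambda>h x. P (dx (u (t + h)) x)) (\<lambda>x. P (dx (u t) x)) (at 0)"
proof (rule L2limI_le)
  have u: "u s \<in> H1" for s using assms by (simp add: continuous_H1_def)
  show "((\<lambda>h. H1_norm (\<lambda>x. u (t + h) x - u t x)) \<longlongrightarrow> 0) (at 0)"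
    using assms(1) LIM_offset_zero[of "\<lambda>s. H1_norm (\<lambda>x. u s x - u t x)" 0 t]
    by (simp add: continuous_H1_def)
  show "\<forall>\<^sub>F h in at 0. nrm (\<lambda>x. P (dx (u (t + h)) x) - P (dx (u t) x)) \<le> H1_norm (\<lambda>x. u (t + h) x - u t x)"
    by (rule always_eventually) (use dx_diff_part[OF u u assms(2)] in blast)
qed (use assms H1_weak_deriv_part in \<open>auto simp: continuous_H1_def\<close>)

text \<open>The representatives may differ from the curve on a null set depending on s; only two
  time slices enter each quotient, so its norm is unaffected.\<close>

lemma has_time_deriv_part:
  assumes w: "has_time_deriv u w t" and u: "\<And>s. u s \<in> L2" and P: "P = Re \<or> P = Im"
    and f: "\<And>s. AE x in lborel. f s x = P (u s x)" "\<And>s. sqint (f s)"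
  shows "mean_deriv f (\<lambda>x. P (w x)) t"
proof -
  have wL: "w \<in> L2" using w by (simp add: has_time_deriv_def)
  have lin: "P (z / complex_of_real h) = P z / h" "P (z - z') = P z - P z'" for z z' h using P by auto
  have sP: "sqint (\<lambda>x. P (w x))" "sqint (\<lambda>x. P (u s x))" for s
    using L2_parts[OF wL] L2_parts[OF u] P by auto
  have "L2lim (\<lambda>h x. (f (t + h) x - f t x) / h) (\<lambda>x. P (w x)) (at 0)"
  proof (rule L2limI_le)
    show "((\<lambda>h. L2_norm (\<lambda>x. (u (t + h) x - u t x) / complex_of_real h - w x)) \<longlongrightarrow> 0) (at 0)"
      using w by (simp add: has_time_deriv_def)
    show "sqint (\<lambda>x. (f (t + h) x - f t x) / h)" for h by (intro sqint_divide sqint_diff f)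
    show "\<forall>\<^sub>F h in at 0. nrm (\<lambda>x. (f (t + h) x - f t x) / h - P (w x))
        \<le> L2_norm (\<lambda>x. (u (t + h) x - u t x) / complex_of_real h - w x)"
    proof (rule always_eventually, rule allI)
      fix h
      let ?D = "\<lambda>x. (u (t + h) x - u t x) / complex_of_real h - w x"
      have L: "?D \<in> L2" by (intro L2_diff L2_divide u wL)
      have "nrm (\<lambda>x. (f (t + h) x - f t x) / h - P (w x)) = nrm (\<lambda>x. P (?D x))"
      proof (rule nrm_cong_AE)
        show "AE x in lborel. (f (t + h) x - f t x) / h - P (w x) = P (?D x)"
          using f(1)[of "t + h"] f(1)[of t] by eventually_elim (simp add: lin)
        show "(\<lambda>x. (f (t + h) x - f t x) / h - P (w x)) \<in> borel_measurable borel"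
          by (rule sqintD, intro sqint_diff sqint_divide f sP)
        show "(\<lambda>x. P (?D x)) \<in> borel_measurable borel"
          unfolding lin by (rule sqintD, intro sqint_diff sqint_divide sP)
      qed
      also have "\<dots> \<le> L2_norm ?D" by (rule nrm_part_le[OF L P])
      finally show "nrm (\<lambda>x. (f (t + h) x - f t x) / h - P (w x)) \<le> L2_norm ?D" .
    qed
  qed (rule sP)
  then show ?thesis using f by (simp add: mean_deriv_def)
qed

text \<open>Representatives are chosen separately for each s. Regularity in time is recovered
  afterwards from norms, which do not depend on this choice.\<close>

lemma continuous_H1_representative:
  assumes "continuous_H1 u" "P = Re \<or> P = Im"
  obtains f where "\<And>s. AE x in lborel. f s x = P (u s x)" "\<And>s. L2_prim (f s) (\<lambda>x. P (dx (u s) x))"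
proof -
  have "\<exists>F. (AE x in lborel. F x = P (u s x)) \<and> L2_prim F (\<lambda>x. P (dx (u s) x))" for s
    by (rule weak_deriv_real_representative; rule H1_weak_deriv_part[OF _ assms(2)])
       (use assms(1) in \<open>auto simp: continuous_H1_def\<close>)
  then show thesis using that by metis
qed

lemma MTM_real_system:
  assumes "MTM_solution u v"
  obtains a b c d X Y Z W p q r w where "thirring_system a b c d X Y Z W p q r w"
    "\<And>t. (L2_norm (u t))\<^sup>2 + (L2_norm (v t))\<^sup>2
      = (nrm (a t))\<^sup>2 + (nrm (b t))\<^sup>2 + (nrm (c t))\<^sup>2 + (nrm (d t))\<^sup>2"
    "\<And>t. (L2_norm (dx (u t)))\<^sup>2 + (L2_norm (dx (v t)))\<^sup>2
      = (nrm (X t))\<^sup>2 + (nrm (Y t))\<^sup>2 + (nrm (Z t))\<^sup>2 + (nrm (W t))\<^sup>2"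
proof -
  have cu: "continuous_H1 u" and cv: "continuous_H1 v" using assms by (auto simp: MTM_solution_def)
  have H: "u s \<in> H1" "v s \<in> H1" for s using cu cv by (auto simp: continuous_H1_def)
  define sol where "sol t ut vt \<longleftrightarrow> has_time_deriv u ut t \<and> has_time_deriv v vt t \<and>
       (AE x in lborel.
          \<i> * (ut x + dx (u t) x) + v t x = 2 * complex_of_real ((cmod (v t x))\<^sup>2) * u t x \<and>
          \<i> * (vt x - dx (v t) x) + u t x = 2 * complex_of_real ((cmod (u t x))\<^sup>2) * v t x)" for t ut vt
  have "\<forall>t. \<exists>ut vt. sol t ut vt" using assms by (simp add: MTM_solution_def sol_def)
  from choice[OF this] obtain ut where "\<forall>t. \<exists>vt. sol t (ut t) vt" by blast
  from choice[OF this] obtain vt where sol: "\<And>t. sol t (ut t) (vt t)" by blast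
  have t: "has_time_deriv u (ut t) t" "has_time_deriv v (vt t) t"
    and eq: "AE x in lborel.
          \<i> * (ut t x + dx (u t) x) + v t x = 2 * complex_of_real ((cmod (v t x))\<^sup>2) * u t x \<and>
          \<i> * (vt t x - dx (v t) x) + u t x = 2 * complex_of_real ((cmod (u t x))\<^sup>2) * v t x" for t
    using sol[of t] by (auto simp only: sol_def)
  obtain a where a: "\<And>s. AE x in lborel. a s x = Re (u s x)" "\<And>s. L2_prim (a s) (\<lambda>x. Re (dx (u s) x))"
    using continuous_H1_representative[OF cu, of Re] by blast
  obtain b where b: "\<And>s. AE x in lborel. b s x = Im (u s x)" "\<And>s. L2_prim (b s) (\<lambda>x. Im (dx (u s) x))"
    using continuous_H1_representative[OF cu, of Im] by blast
  obtain c where c: "\<And>s. AE x in lborel. c s x = Re (v s x)" "\<And>s. L2_prim (c s) (\<lambda>x. Re (dx (v s) x))"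
    using continuous_H1_representative[OF cv, of Re] by blast
  obtain d where d: "\<And>s. AE x in lborel. d s x = Im (v s x)" "\<And>s. L2_prim (d s) (\<lambda>x. Im (dx (v s) x))"
    using continuous_H1_representative[OF cv, of Im] by blast
  note rep = a(1) b(1) c(1) d(1) and acs = a(2) b(2) c(2) d(2)
  have uL: "u s \<in> L2" "v s \<in> L2" for s by (rule H1D(1)[OF H(1)], rule H1D(1)[OF H(2)])
  have sq: "sqint (a s)" "sqint (b s)" "sqint (c s)" "sqint (d s)" for s
    by (rule L2_primD(1)[OF acs(1)] L2_primD(1)[OF acs(2)] L2_primD(1)[OF acs(3)] L2_primD(1)[OF acs(4)])+
  have eqs: "AE x in lborel. Re (ut s x) + Re (dx (u s) x) = - d s x + 2 * ((c s x * c s x + d s x * d s x) * b s x) \<and>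
     Im (ut s x) + Im (dx (u s) x) = c s x - 2 * ((c s x * c s x + d s x * d s x) * a s x) \<and>
     Re (vt s x) - Re (dx (v s) x) = - b s x + 2 * ((a s x * a s x + b s x * b s x) * d s x) \<and>
     Im (vt s x) - Im (dx (v s) x) = a s x - 2 * ((a s x * a s x + b s x * b s x) * c s x)" for s
    using eq[of s] rep[of s]
  proof eventually_elim
    case (elim x)
    \<comment> \<open>Multiplication by the imaginary unit exchanges the parts: imaginary parts give
      the equations for a and c, real parts those for b and d.\<close>
    from elim(1) have "Im (\<i> * (ut s x + dx (u s) x) + v s x) = Im (2 * complex_of_real ((cmod (v s x))\<^sup>2) * u s x)"
      "Re (\<i> * (ut s x + dx (u s) x) + v s x) = Re (2 * complex_of_real ((cmod (v s x))\<^sup>2) * u s x)"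
      "Im (\<i> * (vt s x - dx (v s) x) + u s x) = Im (2 * complex_of_real ((cmod (u s x))\<^sup>2) * v s x)"
      "Re (\<i> * (vt s x - dx (v s) x) + u s x) = Re (2 * complex_of_real ((cmod (u s x))\<^sup>2) * v s x)"
      by simp_all
    then show ?case
      using elim(2-5) unfolding cmod_power2
      by (simp add: power2_eq_square algebra_simps)
  qed
  have sys: "thirring_system a b c d (\<lambda>s x. Re (dx (u s) x)) (\<lambda>s x. Im (dx (u s) x))
     (\<lambda>s x. Re (dx (v s) x)) (\<lambda>s x. Im (dx (v s) x))
     (\<lambda>s x. Re (ut s x)) (\<lambda>s x. Im (ut s x)) (\<lambda>s x. Re (vt s x)) (\<lambda>s x. Im (vt s x))"
    unfolding thirring_system_def thirring_def
  proof (intro conjI allI)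
    fix s
    show "mean_deriv a (\<lambda>x. Re (ut s x)) s" by (rule has_time_deriv_part[OF t(1) uL(1) _ a(1) sq(1)]) simp
    show "mean_deriv b (\<lambda>x. Im (ut s x)) s" by (rule has_time_deriv_part[OF t(1) uL(1) _ b(1) sq(2)]) simp
    show "mean_deriv c (\<lambda>x. Re (vt s x)) s" by (rule has_time_deriv_part[OF t(2) uL(2) _ c(1) sq(3)]) simp
    show "mean_deriv d (\<lambda>x. Im (vt s x)) s" by (rule has_time_deriv_part[OF t(2) uL(2) _ d(1) sq(4)]) simp
    show "AE x in lborel. Re (ut s x) + 1 * Re (dx (u s) x) = - d s x + 2 * ((c s x * c s x + d s x * d s x) * b s x)"
      "AE x in lborel. Im (ut s x) + 1 * Im (dx (u s) x) = c s x - 2 * ((c s x * c s x + d s x * d s x) * a s x)"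
      "AE x in lborel. Re (vt s x) - 1 * Re (dx (v s) x) = - b s x + 2 * ((a s x * a s x + b s x * b s x) * d s x)"
      "AE x in lborel. Im (vt s x) - 1 * Im (dx (v s) x) = a s x - 2 * ((a s x * a s x + b s x * b s x) * c s x)"
      using eqs[of s] by (auto elim: eventually_mono)
  qed (simp_all add: acs continuous_H1_part[OF cu] continuous_H1_part[OF cv])
  have nrms: "nrm (a s) = nrm (\<lambda>x. Re (u s x))" "nrm (b s) = nrm (\<lambda>x. Im (u s x))"
    "nrm (c s) = nrm (\<lambda>x. Re (v s x))" "nrm (d s) = nrm (\<lambda>x. Im (v s x))" for s
    by (rule nrm_cong_AE[OF rep(1) sqintD(1)[OF sq(1)] sqintD(1)[OF L2_parts(1)[OF H1D(1)[OF H(1)]]]]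
          nrm_cong_AE[OF rep(2) sqintD(1)[OF sq(2)] sqintD(1)[OF L2_parts(2)[OF H1D(1)[OF H(1)]]]]
          nrm_cong_AE[OF rep(3) sqintD(1)[OF sq(3)] sqintD(1)[OF L2_parts(1)[OF H1D(1)[OF H(2)]]]]
          nrm_cong_AE[OF rep(4) sqintD(1)[OF sq(4)] sqintD(1)[OF L2_parts(2)[OF H1D(1)[OF H(2)]]]])+
  show thesis
    by (rule that[OF sys])
       (simp_all only: nrms L2_parts(3)[OF H1D(1)[OF H(1)]] L2_parts(3)[OF H1D(1)[OF H(2)]]
         L2_parts(3)[OF H1D(2)[OF H(1)]] L2_parts(3)[OF H1D(2)[OF H(2)]] add.assoc)
qed

text \<open>Data that agree almost everywhere have the same set of weak derivatives, so the choice
  operator in \<open>dx\<close> selects literally the same function.\<close>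

lemma initial_datum_norms:
  assumes "initial_datum u u0" "u 0 \<in> H1" "u0 \<in> H1"
  shows "L2_norm (u 0) = L2_norm u0" "dx (u 0) = dx u0"
proof -
  have AE: "AE x in lborel. u 0 x = u0 x" using assms(1) by (simp add: initial_datum_def)
  note [measurable] = L2D(1)[OF H1D(1)[OF assms(2)]] L2D(1)[OF H1D(1)[OF assms(3)]]
  show "L2_norm (u 0) = L2_norm u0"
    unfolding L2_norm_def by (intro arg_cong[where f = sqrt] integral_cong_AE) (use AE in auto)
  have "(LINT x|lborel. complex_of_real (deriv \<phi> x) * u 0 x) = (LINT x|lborel. complex_of_real (deriv \<phi> x) * u0 x)"
    if "test_function \<phi>" for \<phi>
    using AE sqintD(1)[OF test_function_sqint(2)[OF that]] by (intro integral_cong_AE) auto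
  then have "weak_deriv (u 0) = weak_deriv u0"
    by (auto simp: weak_deriv_def fun_eq_iff)
  then show "dx (u 0) = dx u0" by (simp add: dx_def)
qed

theorem theorem2:
  shows "\<exists>Q0::real. Q0 > 0 \<and>
    (\<forall>u0 \<in> H1. \<forall>v0 \<in> H1. (L2_norm u0)\<^sup>2 + (L2_norm v0)\<^sup>2 \<le> Q0 \<longrightarrow>
      (\<exists>C::real. C > 0 \<and>
        (\<forall>u v. MTM_solution u v \<and> initial_datum u u0 \<and> initial_datum v v0 \<longrightarrow>
          (\<forall>t. (H1_norm (u t))\<^sup>2 + (H1_norm (v t))\<^sup>2 \<le> C))))"
proof (rule exI[of _ "1 / 16"], intro conjI ballI impI)
  fix u0 v0 assume H0: "u0 \<in> H1" "v0 \<in> H1" and small: "(L2_norm u0)\<^sup>2 + (L2_norm v0)\<^sup>2 \<le> 1 / 16"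
  define M where "M = (L2_norm (dx u0))\<^sup>2 + (L2_norm (dx v0))\<^sup>2"
  have "M \<ge> 0" by (simp add: M_def)
  show "\<exists>C>0. \<forall>u v. MTM_solution u v \<and> initial_datum u u0 \<and> initial_datum v v0 \<longrightarrow>
          (\<forall>t. (H1_norm (u t))\<^sup>2 + (H1_norm (v t))\<^sup>2 \<le> C)"
  \<comment> \<open>The derivatives contribute at most 12 M + 5 and the conserved charge at most
    1/16.\<close>
  proof (intro exI[of _ "12 * M + 6"] conjI allI impI)
    show "12 * M + 6 > 0" using \<open>M \<ge> 0\<close> by simp
  next
    fix u v t assume asm: "MTM_solution u v \<and> initial_datum u u0 \<and> initial_datum v v0"
    then have "u 0 \<in> H1" "v 0 \<in> H1" by (auto simp: MTM_solution_def continuous_H1_def)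
    note init = initial_datum_norms[of u u0, OF _ this(1) H0(1)] initial_datum_norms[of v v0, OF _ this(2) H0(2)]
    obtain a b c d X Y Z W p q r w where sys: "thirring_system a b c d X Y Z W p q r w"
      and mass: "\<And>t. (L2_norm (u t))\<^sup>2 + (L2_norm (v t))\<^sup>2
        = (nrm (a t))\<^sup>2 + (nrm (b t))\<^sup>2 + (nrm (c t))\<^sup>2 + (nrm (d t))\<^sup>2"
      and kin: "\<And>t. (L2_norm (dx (u t)))\<^sup>2 + (L2_norm (dx (v t)))\<^sup>2
        = (nrm (X t))\<^sup>2 + (nrm (Y t))\<^sup>2 + (nrm (Z t))\<^sup>2 + (nrm (W t))\<^sup>2"
      using MTM_real_system[OF conjunct1[OF asm]] by blast
    interpret thirring_system a b c d X Y Z W p q r w by (rule sys)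
    have m0: "mass 0 \<le> 1 / 16"
      using small init asm mass[of 0] by (simp add: mass_def)
    have "kinetic 0 = M"
      using init asm kin[of 0] by (simp add: kinetic_def M_def)
    then have "kinetic t \<le> 12 * M + 5" using kinetic_bound[OF m0, of t] by simp
    moreover have "mass t \<le> 1 / 16" using m0 mass_conserved[of t 0] by simp
    moreover have "(H1_norm (u t))\<^sup>2 + (H1_norm (v t))\<^sup>2 = mass t + kinetic t"
      using mass[of t] kin[of t] by (simp add: H1_norm_def mass_def kinetic_def)
    ultimately show "(H1_norm (u t))\<^sup>2 + (H1_norm (v t))\<^sup>2 \<le> 12 * M + 6" by simp
  qed
qed simp

end
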